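(* There exist maps $$\mathrm{Gr}_2(\mathbb{R}^4)\to \mathbb{R}\mathrm{P}^{2},\quad \mathrm{Gr}_2(\mathbb{R}^8)\to \mathbb{R}\mathrm{P}^{6},\quad \mathrm{Gr}_2(\mathbb{R}^9)\to \mathbb{R}\mathrm{P}^{14},$$ $$\mathrm{Gr}_2(\mathbb{R}^{10})\to \mathbb{R}\mathrm{P}^{15},\quad \mathrm{Gr}_2(\mathbb{R}^{12})\to \mathbb{R}\mathrm{P}^{17},\quad \mathrm{Gr}_2(\mathbb{R}^{16})\to \mathbb{R}\mathrm{P}^{21}$$ each inducing a $\pi_1$-isomorphism. Moreover, any precomposition of such a map $\mathrm{Gr}_2(\mathbb{R}^n)\to\mathbb{R}\mathrm{P}^k$ with an inclusion $\mathrm{Gr}_2(\mathbb{R}^{n-1})\to \mathrm{Gr}_2(\mathbb{R}^n)$, where $n-1>2$, induces a $\pi_1$-isomorphism.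
   Context: $\mathrm{Gr}_2(\mathbb{R}^n)$ denotes the real Grassmannian of $2$-dimensional linear subspaces of $\mathbb{R}^n$, and $\mathbb{R}\mathrm{P}^k$ is real projective $k$-space. "Map" means continuous map. A map induces a $\pi_1$-isomorphism if it induces an isomorphism between the fundamental groups. The inclusion $\mathrm{Gr}_2(\mathbb{R}^{n-1})\to \mathrm{Gr}_2(\mathbb{R}^n)$ is the one induced by the linear inclusion $\mathbb{R}^{n-1}\subset\mathbb{R}^n$. *)

theory Defs
  imports "HOL-Analysis.Analysis" "HOL-Algebra.Group" "HOL-Library.Function_Algebras"
begin

instantiation "fun" :: (type, real_vector) real_vector
begin

definition scaleR_fun_def: "c *\<^sub>R f = (\<lambda>x. c *\<^sub>R f x)"

instance
  by standard (auto simp: scaleR_fun_def fun_eq_iff scaleR_add_right scaleR_add_left)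

end

subsection \<open>Quotient topologies\<close>

definition quotient_topology :: "'a topology \<Rightarrow> ('a \<Rightarrow> 'b) \<Rightarrow> 'b topology" where
  "quotient_topology X q =
     topology (\<lambda>U. U \<subseteq> q ` topspace X \<and> openin X {x \<in> topspace X. q x \<in> U})"

lemma openin_quotient_topology:
  "openin (quotient_topology X q) U \<longleftrightarrow>
     U \<subseteq> q ` topspace X \<and> openin X {x \<in> topspace X. q x \<in> U}"
proof -
  let ?P = "\<lambda>U. U \<subseteq> q ` topspace X \<and> openin X {x \<in> topspace X. q x \<in> U}"
  have "?P (S \<inter> T)" if "?P S" "?P T" for S T
  proof -
    have "{x \<in> topspace X. q x \<in> S \<inter> T}
        = {x \<in> topspace X. q x \<in> S} \<inter> {x \<in> topspace X. q x \<in> T}" by auto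
    then show ?thesis using that by auto
  qed
  moreover have "?P (\<Union>K)" if "\<forall>S\<in>K. ?P S" for K
  proof -
    have "{x \<in> topspace X. q x \<in> \<Union>K} = (\<Union>S\<in>K. {x \<in> topspace X. q x \<in> S})" by auto
    then show ?thesis using that by auto
  qed
  ultimately have "istopology ?P"
    unfolding istopology_def by blast
  then show ?thesis
    unfolding quotient_topology_def by (simp add: topology_inverse')
qed

lemma topspace_quotient_topology [simp]: "topspace (quotient_topology X q) = q ` topspace X"
proof -
  have "{x \<in> topspace X. q x \<in> q ` topspace X} = topspace X" by auto
  then have "openin (quotient_topology X q) (q ` topspace X)"
    by (simp add: openin_quotient_topology)
  then show ?thesis
    by (meson openin_quotient_topology openin_subset openin_topspace subset_antisym)
qed

lemma quotient_map_quotient_topology: "quotient_map X (quotient_topology X q) q"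
  by (auto simp: quotient_map_def openin_quotient_topology)

subsection \<open>Real projective spaces and Grassmannians of planes\<close>

definition real_projective_space :: "nat \<Rightarrow> (nat \<Rightarrow> real) set topology" where
  "real_projective_space k =
     quotient_topology (subtopology (Euclidean_space (k + 1)) (- {0})) (\<lambda>u. span {u})"

text \<open>The Grassmannian carries the quotient topology from the space of linearly
  independent pairs of vectors.  The condition \<open>u \<noteq> v\<close> is needed because
  \<open>{u, v}\<close> is a set, not a family.\<close>

definition Gr2 :: "nat \<Rightarrow> (nat \<Rightarrow> real) set topology" where
  "Gr2 n =
     quotient_topology
       (subtopology (prod_topology (Euclidean_space n) (Euclidean_space n))
          {(u, v). u \<noteq> v \<and> independent {u, v}})
       (\<lambda>(u, v). span {u, v})"

lemma subspace_topspace_Euclidean_space: "subspace (topspace (Euclidean_space n))"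
  by (auto simp: subspace_def topspace_Euclidean_space scaleR_fun_def)

lemma topspace_real_projective_space:
  "topspace (real_projective_space k) =
     {S. subspace S \<and> dim S = 1 \<and> S \<subseteq> topspace (Euclidean_space (k + 1))}" (is "?L = ?R")
proof
  show "?L \<subseteq> ?R"
  proof
    fix S assume "S \<in> ?L"
    then obtain u where u: "u \<in> topspace (Euclidean_space (k + 1))" "u \<noteq> 0" "S = span {u}"
      by (auto simp: real_projective_space_def)
    then have "dim S = 1"
      using dim_eq_card_independent[of "{u}"] dependent_single by (simp add: dim_span)
    moreover have "S \<subseteq> topspace (Euclidean_space (k + 1))"
      using u by (simp add: span_minimal subspace_topspace_Euclidean_space)
    ultimately show "S \<in> ?R" using u by simp
  qed
  show "?R \<subseteq> ?L"
  proof
    fix S assume S: "S \<in> ?R"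
    obtain B where B: "B \<subseteq> S" "independent B" "S \<subseteq> span B" "card B = dim S"
      using basis_exists by blast
    then obtain u where u: "B = {u}" using S by (auto simp: card_Suc_eq)
    have "S = span {u}" using B u S by (auto simp: span_minimal subset_antisym)
    moreover have "u \<noteq> 0" using B u dependent_zero by blast
    ultimately show "S \<in> ?L" using B u S
      by (auto simp: real_projective_space_def)
  qed
qed

lemma topspace_Gr2:
  "topspace (Gr2 n) = {S. subspace S \<and> dim S = 2 \<and> S \<subseteq> topspace (Euclidean_space n)}"
  (is "?L = ?R")
proof
  show "?L \<subseteq> ?R"
  proof
    fix S assume "S \<in> ?L"
    then obtain u v where u: "u \<in> topspace (Euclidean_space n)" "v \<in> topspace (Euclidean_space n)"
        "u \<noteq> v" "independent {u, v}" "S = span {u, v}"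
      by (auto simp: Gr2_def)
    then have "dim S = 2"
      using dim_eq_card_independent[of "{u, v}"] by (simp add: dim_span)
    moreover have "S \<subseteq> topspace (Euclidean_space n)"
      using u by (simp add: span_minimal subspace_topspace_Euclidean_space)
    ultimately show "S \<in> ?R" using u by simp
  qed
  show "?R \<subseteq> ?L"
  proof
    fix S assume S: "S \<in> ?R"
    obtain B where B: "B \<subseteq> S" "independent B" "S \<subseteq> span B" "card B = dim S"
      using basis_exists by blast
    then obtain u v where u: "B = {u, v}" "u \<noteq> v" using S by (auto simp: card_2_iff)
    have "S = span {u, v}" using B u S by (auto simp: span_minimal subset_antisym)
    moreover have "(u, v) \<in> topspace (subtopology (prod_topology (Euclidean_space n) (Euclidean_space n))
        {(u, v). u \<noteq> v \<and> independent {u, v}})"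
      using B u S by auto
    ultimately show "S \<in> ?L"
      unfolding Gr2_def topspace_quotient_topology by (intro image_eqI[of _ _ "(u, v)"]) simp_all
  qed
qed

text \<open>In this model \<open>\<real>\<^sup>m\<close> is, for \<open>m \<le> n\<close>, literally a subset of \<open>\<real>\<^sup>n\<close> (pad by zero
  coordinates), so the linear inclusion is the identity on vectors; the map it induces on
  Grassmannians sends a plane to its image.\<close>

definition Gr2_inclusion :: "(nat \<Rightarrow> real) set \<Rightarrow> (nat \<Rightarrow> real) set" where
  "Gr2_inclusion S = id ` S"

lemma continuous_map_Gr2_inclusion:
  assumes "m \<le> n"
  shows "continuous_map (Gr2 m) (Gr2 n) Gr2_inclusion"
proof -
  let ?W = "{(u, v). u \<noteq> v \<and> independent {u, v}} :: ((nat \<Rightarrow> real) \<times> (nat \<Rightarrow> real)) set"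
  let ?E = "\<lambda>n. prod_topology (Euclidean_space n) (Euclidean_space n)"
  let ?q = "\<lambda>(u, v). span {u, v} :: (nat \<Rightarrow> real) set"
  have E: "continuous_map (Euclidean_space m) (Euclidean_space n) (\<lambda>x. x)"
    using assms unfolding Euclidean_space_def
    by (auto simp: continuous_map_in_subtopology continuous_map_from_subtopology)
  have "continuous_map (?E m) (?E n) (\<lambda>z. (fst z, snd z))"
    using continuous_map_compose[OF continuous_map_fst E] continuous_map_compose[OF continuous_map_snd E]
    by (auto simp: o_def continuous_map_pairwise)
  then have "continuous_map (subtopology (?E m) ?W) (subtopology (?E n) ?W) (\<lambda>z. z)"
    by (auto simp: continuous_map_in_subtopology continuous_map_from_subtopology)
  then have "continuous_map (subtopology (?E m) ?W) (Gr2 n) (?q \<circ> (\<lambda>z. z))"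
    unfolding Gr2_def
    using quotient_imp_continuous_map[OF quotient_map_quotient_topology] continuous_map_compose by blast
  then have "continuous_map (subtopology (?E m) ?W) (Gr2 n) (Gr2_inclusion \<circ> ?q)"
    by (simp add: o_def Gr2_inclusion_def)
  then show ?thesis
    unfolding Gr2_def[of m]
    by (rule continuous_compose_quotient_map[OF quotient_map_quotient_topology])
qed

subsection \<open>Fundamental groups\<close>

text \<open>The library's \<open>joinpaths\<close>, \<open>homotopic_paths\<close> and so on are tied to the class
  \<open>topological_space\<close>; the following are the same notions for an abstract topology.
  As there, a path is a function on all of \<open>real\<close> whose values outside \<open>{0..1}\<close> are irrelevant;
  paths agreeing on \<open>{0..1}\<close> are homotopic, so the homotopy classes do not see them.\<close>

definition based_loops :: "'a topology \<Rightarrow> 'a \<Rightarrow> (real \<Rightarrow> 'a) set" where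
  "based_loops X a = {p. pathin X p \<and> p 0 = a \<and> p 1 = a}"

definition loop_homotopic :: "'a topology \<Rightarrow> 'a \<Rightarrow> (real \<Rightarrow> 'a) \<Rightarrow> (real \<Rightarrow> 'a) \<Rightarrow> bool" where
  "loop_homotopic X a =
     homotopic_with (\<lambda>r. r 0 = a \<and> r 1 = a) (top_of_set {0..1}) X"

definition loop_class :: "'a topology \<Rightarrow> 'a \<Rightarrow> (real \<Rightarrow> 'a) \<Rightarrow> (real \<Rightarrow> 'a) set" where
  "loop_class X a p = {q. loop_homotopic X a p q}"

definition loop_join :: "(real \<Rightarrow> 'a) \<Rightarrow> (real \<Rightarrow> 'a) \<Rightarrow> real \<Rightarrow> 'a" where
  "loop_join p q t = (if t \<le> 1/2 then p (2 * t) else q (2 * t - 1))"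

definition fundamental_group :: "'a topology \<Rightarrow> 'a \<Rightarrow> (real \<Rightarrow> 'a) set monoid" where
  "fundamental_group X a =
     \<lparr>carrier = loop_class X a ` based_loops X a,
      mult = (\<lambda>A B. \<Union>p\<in>A. \<Union>q\<in>B. loop_class X a (loop_join p q)),
      one = loop_class X a (\<lambda>_. a)\<rparr>"

definition pi1_map :: "'a topology \<Rightarrow> 'b topology \<Rightarrow> ('a \<Rightarrow> 'b) \<Rightarrow> 'a \<Rightarrow>
    (real \<Rightarrow> 'a) set \<Rightarrow> (real \<Rightarrow> 'b) set" where
  "pi1_map X Y f a A = (\<Union>p\<in>A. loop_class Y (f a) (f \<circ> p))"

definition induces_pi1_isomorphism :: "'a topology \<Rightarrow> 'b topology \<Rightarrow> ('a \<Rightarrow> 'b) \<Rightarrow> bool" where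
  "induces_pi1_isomorphism X Y f \<longleftrightarrow>
     continuous_map X Y f \<and>
     (\<forall>a\<in>topspace X. pi1_map X Y f a \<in> iso (fundamental_group X a) (fundamental_group Y (f a)))"

lemma loop_homotopic_refl: "p \<in> based_loops X a \<Longrightarrow> loop_homotopic X a p p"
  by (simp add: loop_homotopic_def based_loops_def pathin_def)

lemma loop_homotopic_sym: "loop_homotopic X a p q \<Longrightarrow> loop_homotopic X a q p"
  unfolding loop_homotopic_def by (rule homotopic_with_symD)

lemma loop_homotopic_trans:
  "loop_homotopic X a p q \<Longrightarrow> loop_homotopic X a q r \<Longrightarrow> loop_homotopic X a p r"
  unfolding loop_homotopic_def by (rule homotopic_with_trans)

lemma loop_homotopic_imp_based_loops:
  assumes "loop_homotopic X a p q"
  shows "p \<in> based_loops X a" "q \<in> based_loops X a"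
  using homotopic_with_imp_property[OF assms[unfolded loop_homotopic_def]]
    homotopic_with_imp_continuous_maps[OF assms[unfolded loop_homotopic_def]]
  by (simp_all add: based_loops_def pathin_def)

lemma loop_class_eq_iff:
  assumes "p \<in> based_loops X a"
  shows "loop_class X a p = loop_class X a q \<longleftrightarrow> loop_homotopic X a p q"
proof
  assume "loop_class X a p = loop_class X a q"
  then have "loop_homotopic X a q p"
    using loop_homotopic_refl[OF assms] by (simp add: loop_class_def set_eq_iff)
  then show "loop_homotopic X a p q" by (rule loop_homotopic_sym)
next
  assume "loop_homotopic X a p q"
  then show "loop_class X a p = loop_class X a q"
    unfolding loop_class_def
    using loop_homotopic_trans[of X a p q] loop_homotopic_trans[of X a q p] loop_homotopic_sym[of X a p q]
    by blast
qed

abbreviation unit_square :: "(real \<times> real) topology" where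
  "unit_square \<equiv> prod_topology (top_of_set {0..1}) (top_of_set {0..1})"

lemma loop_homotopicI:
  assumes "continuous_map unit_square X h"
    and "\<And>s. s \<in> {0..1} \<Longrightarrow> h (0, s) = p s" "\<And>s. s \<in> {0..1} \<Longrightarrow> h (1, s) = q s"
    and "\<And>t. t \<in> {0..1} \<Longrightarrow> h (t, 0) = a \<and> h (t, 1) = a"
  shows "loop_homotopic X a p q"
  unfolding loop_homotopic_def
proof (subst homotopic_with)
  show "\<exists>h. continuous_map unit_square X h \<and>
      (\<forall>x\<in>topspace (top_of_set {0..1}). h (0, x) = p x) \<and>
      (\<forall>x\<in>topspace (top_of_set {0..1}). h (1, x) = q x) \<and>
      (\<forall>t\<in>{0..1}. h (t, 0) = a \<and> h (t, 1) = a)"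
    by (rule exI[of _ h]) (use assms in simp)
qed simp

lemma loop_homotopicE:
  assumes "loop_homotopic X a p q"
  obtains h where "continuous_map unit_square X h"
    "\<And>s. h (0, s) = p s" "\<And>s. h (1, s) = q s"
    "\<And>t. t \<in> {0..1} \<Longrightarrow> h (t, 0) = a \<and> h (t, 1) = a"
  using assms unfolding loop_homotopic_def homotopic_with_def by blast

lemma continuous_map_square_join:
  assumes h: "continuous_map unit_square X h"
    and k: "continuous_map unit_square X k"
    and eq: "\<And>t. t \<in> {0..1} \<Longrightarrow> h (t, 1) = k (t, 0)"
  shows "continuous_map unit_square X
    (\<lambda>z. if snd z \<le> (1/2::real) then h (fst z, 2 * snd z) else k (fst z, 2 * snd z - 1))"
proof -
  let ?J = "\<lambda>S. top_of_set {z \<in> {0..1} \<times> {0..1} :: (real \<times> real) set. z \<in> S}"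
  have sub: "subtopology unit_square {z \<in> topspace unit_square. z \<in> S} = ?J S" for S
    by (auto simp: subtopology_subtopology intro!: arg_cong[of _ _ top_of_set])
  have 1: "continuous_map (?J {z. snd z \<le> 1/2}) unit_square (\<lambda>z. (fst z, 2 * snd z))"
    by (auto intro!: continuous_intros)
  have 2: "continuous_map (?J {z. 1/2 \<le> snd z}) unit_square (\<lambda>z. (fst z, 2 * snd z - 1))"
    by (auto intro!: continuous_intros)
  show ?thesis
  proof (rule continuous_map_cases_le)
    show "continuous_map unit_square euclideanreal snd"
      by (rule continuous_map_snd[THEN continuous_map_into_fulltopology])
    show "continuous_map unit_square euclideanreal (\<lambda>x. 1/2)"
      by simp
    show "continuous_map (subtopology unit_square {z \<in> topspace unit_square. snd z \<le> 1/2})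
       X (\<lambda>z. h (fst z, 2 * snd z))"
      using continuous_map_compose[OF 1 h] sub[of "{z. snd z \<le> 1/2}"] by (simp only: o_def mem_Collect_eq)
    show "continuous_map (subtopology unit_square {z \<in> topspace unit_square. 1/2 \<le> snd z})
       X (\<lambda>z. k (fst z, 2 * snd z - 1))"
      using continuous_map_compose[OF 2 k] sub[of "{z. 1/2 \<le> snd z}"] by (simp only: o_def mem_Collect_eq)
    show "h (fst z, 2 * snd z) = k (fst z, 2 * snd z - 1)"
      if "z \<in> topspace unit_square" "snd z = 1/2" for z
    proof -
      have "2 * snd z = 1" "fst z \<in> {0..1}" using that by auto
      then show ?thesis using eq[of "fst z"] by simp
    qed
  qed
qed

lemma loop_homotopic_join:
  assumes "loop_homotopic X a p p'" "loop_homotopic X a q q'"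
  shows "loop_homotopic X a (loop_join p q) (loop_join p' q')"
proof -
  obtain h where h: "continuous_map unit_square X h"
    "\<And>s. h (0, s) = p s" "\<And>s. h (1, s) = p' s"
    "\<And>t. t \<in> {0..1} \<Longrightarrow> h (t, 0) = a \<and> h (t, 1) = a"
    by (rule loop_homotopicE[OF assms(1)]) blast
  obtain k where k: "continuous_map unit_square X k"
    "\<And>s. k (0, s) = q s" "\<And>s. k (1, s) = q' s"
    "\<And>t. t \<in> {0..1} \<Longrightarrow> k (t, 0) = a \<and> k (t, 1) = a"
    by (rule loop_homotopicE[OF assms(2)]) blast
  show ?thesis
    by (rule loop_homotopicI[OF continuous_map_square_join[OF h(1) k(1)]])
       (use h k in \<open>auto simp: loop_join_def\<close>)
qed

lemma loop_join_in_based_loops: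
  "p \<in> based_loops X a \<Longrightarrow> q \<in> based_loops X a \<Longrightarrow> loop_join p q \<in> based_loops X a"
  by (rule loop_homotopic_imp_based_loops(1)[OF loop_homotopic_join[OF loop_homotopic_refl loop_homotopic_refl]])

lemma loop_homotopic_reparametrize:
  fixes \<phi> \<psi> :: "real \<Rightarrow> real"
  assumes p: "pathin X p"
    and \<phi>: "continuous_on {0..1} \<phi>" "\<phi> ` {0..1} \<subseteq> {0..1}"
    and \<psi>: "continuous_on {0..1} \<psi>" "\<psi> ` {0..1} \<subseteq> {0..1}"
    and ends: "\<phi> 0 = \<psi> 0" "\<phi> 1 = \<psi> 1" "p (\<psi> 0) = a" "p (\<psi> 1) = a"
    and f: "\<And>s. s \<in> {0..1} \<Longrightarrow> f s = p (\<phi> s)" and g: "\<And>s. s \<in> {0..1} \<Longrightarrow> g s = p (\<psi> s)"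
  shows "loop_homotopic X a f g"
proof (rule loop_homotopicI)
  let ?I = "top_of_set ({0..1} :: real set)"
  let ?c = "\<lambda>z. (1 - fst z) * \<phi> (snd z) + fst z * \<psi> (snd z)"
  have "continuous_on ({0..1} \<times> {0..1}) ?c"
    by (intro continuous_intros continuous_on_compose2[OF \<phi>(1)] continuous_on_compose2[OF \<psi>(1)]) auto
  moreover have "?c z \<in> {0..1}" if "z \<in> {0..1} \<times> {0..1}" for z
  proof -
    have "\<phi> (snd z) \<in> {0..1}" "\<psi> (snd z) \<in> {0..1}" "fst z \<in> {0..1}" using that \<phi>(2) \<psi>(2) by auto
    then show ?thesis
      using convexD_alt[of "{0..1::real}" "\<phi> (snd z)" "\<psi> (snd z)" "fst z"] by auto
  qed
  ultimately have "continuous_map (prod_topology ?I ?I) ?I ?c"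
    by (auto simp del: atLeastAtMost_iff)
  from continuous_map_compose[OF this p[unfolded pathin_def]]
  show "continuous_map (prod_topology ?I ?I) X (p \<circ> ?c)" .
qed (use ends f g in \<open>auto simp: algebra_simps\<close>)

lemma carrier_fundamental_group:
  "carrier (fundamental_group X a) = loop_class X a ` based_loops X a"
  by (simp add: fundamental_group_def)

lemma one_fundamental_group: "\<one>\<^bsub>fundamental_group X a\<^esub> = loop_class X a (\<lambda>_. a)"
  by (simp add: fundamental_group_def)

lemma mult_fundamental_group:
  assumes "p \<in> based_loops X a" "q \<in> based_loops X a"
  shows "loop_class X a p \<otimes>\<^bsub>fundamental_group X a\<^esub> loop_class X a q = loop_class X a (loop_join p q)"
proof -
  have eq: "loop_class X a (loop_join p' q') = loop_class X a (loop_join p q)"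
    if "p' \<in> loop_class X a p" "q' \<in> loop_class X a q" for p' q'
  proof -
    have "loop_homotopic X a (loop_join p q) (loop_join p' q')"
      using that by (simp add: loop_class_def loop_homotopic_join)
    then show ?thesis
      using loop_class_eq_iff[OF loop_join_in_based_loops[OF assms]] by blast
  qed
  have mem: "p \<in> loop_class X a p" "q \<in> loop_class X a q"
    using assms by (auto simp: loop_class_def loop_homotopic_refl)
  have "(\<Union>p'\<in>loop_class X a p. \<Union>q'\<in>loop_class X a q. loop_class X a (loop_join p' q'))
      = (\<Union>p'\<in>loop_class X a p. \<Union>q'\<in>loop_class X a q. loop_class X a (loop_join p q))"
    by (intro SUP_cong refl eq)
  also have "\<dots> = loop_class X a (loop_join p q)"
    using mem by blast
  finally show ?thesis by (simp add: fundamental_group_def)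
qed

lemma pi1_map_loop_class:
  assumes f: "continuous_map X Y f" and p: "p \<in> based_loops X a"
  shows "pi1_map X Y f a (loop_class X a p) = loop_class Y (f a) (f \<circ> p)"
    and "f \<circ> p \<in> based_loops Y (f a)"
proof -
  have hom: "loop_homotopic Y (f a) (f \<circ> p) (f \<circ> q)" if pq: "loop_homotopic X a p q" for q
  proof -
    obtain h where h: "continuous_map unit_square X h"
      "\<And>s. h (0, s) = p s" "\<And>s. h (1, s) = q s"
      "\<And>t. t \<in> {0..1} \<Longrightarrow> h (t, 0) = a \<and> h (t, 1) = a"
      by (rule loop_homotopicE[OF pq]) blast
    show ?thesis
      by (rule loop_homotopicI[OF continuous_map_compose[OF h(1) f]]) (use h in auto)
  qed
  show fp: "f \<circ> p \<in> based_loops Y (f a)"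
    by (rule loop_homotopic_imp_based_loops(1)[OF hom[OF loop_homotopic_refl[OF p]]])
  have eq: "loop_class Y (f a) (f \<circ> q) = loop_class Y (f a) (f \<circ> p)" if "q \<in> loop_class X a p" for q
    using that loop_class_eq_iff[OF fp, THEN iffD2, OF hom[of q], symmetric]
    by (simp add: loop_class_def[of X])
  have mem: "p \<in> loop_class X a p" using p by (simp add: loop_class_def loop_homotopic_refl)
  have "pi1_map X Y f a (loop_class X a p) = (\<Union>q\<in>loop_class X a p. loop_class Y (f a) (f \<circ> p))"
    unfolding pi1_map_def by (intro SUP_cong refl eq)
  then show "pi1_map X Y f a (loop_class X a p) = loop_class Y (f a) (f \<circ> p)"
    using mem by blast
qed

lemma const_in_based_loops: "a \<in> topspace X \<Longrightarrow> (\<lambda>_. a) \<in> based_loops X a"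
  by (simp add: based_loops_def pathin_def)

lemma continuous_on_if_real:
  fixes f g :: "real \<Rightarrow> real"
  assumes "continuous_on {0..1} f" "continuous_on {0..1} g" "f c = g c"
  shows "continuous_on {0..1} (\<lambda>s. if s \<le> c then f s else g s)"
proof (rule continuous_on_cases_le)
  show "continuous_on {s \<in> {0..1}. s \<le> c} f" "continuous_on {s \<in> {0..1}. c \<le> s} g"
    by (rule continuous_on_subset[OF assms(1)], blast) (rule continuous_on_subset[OF assms(2)], blast)
  show "f s = g s" if "s \<in> {0..1}" "s = c" for s
    using that assms(3) by simp
qed (rule continuous_on_id)

lemma group_fundamental_group:
  assumes a: "a \<in> topspace X"
  shows "group (fundamental_group X a)"
proof (rule groupI)
  let ?G = "fundamental_group X a"
  fix A B C
  assume "A \<in> carrier ?G"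
  then obtain p where p: "p \<in> based_loops X a" and A: "A = loop_class X a p"
    by (auto simp: carrier_fundamental_group)
  have pa: "pathin X p" "p 0 = a" "p 1 = a" using p by (auto simp: based_loops_def)
  have "continuous_on {0..1} (\<lambda>s::real. if s \<le> 1/2 then 0 else 2 * s - 1)"
    by (intro continuous_on_if_real continuous_intros) simp
  then have unit: "loop_homotopic X a (loop_join (\<lambda>_. a) p) p"
    by (rule loop_homotopic_reparametrize[where \<phi> = "\<lambda>s. if s \<le> 1/2 then 0 else 2 * s - 1"
            and \<psi> = "\<lambda>s. s", OF pa(1)])
       (auto simp: loop_join_def pa simp del: le_divide_eq_numeral1)
  then show "\<one>\<^bsub>?G\<^esub> \<otimes>\<^bsub>?G\<^esub> A = A"
    using p a by (simp add: A one_fundamental_group mult_fundamental_group const_in_based_loops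
        loop_class_eq_iff loop_join_in_based_loops)
  define p' where "p' = (\<lambda>s. p (1 - s))"
  have "continuous_map (top_of_set {0..1}) (top_of_set {0..1::real}) (\<lambda>s. 1 - s)"
    by (auto intro!: continuous_intros)
  from continuous_map_compose[OF this pa(1)[unfolded pathin_def]]
  have p': "p' \<in> based_loops X a"
    using pa by (simp add: based_loops_def pathin_def p'_def o_def)
  have "continuous_on {0..1} (\<lambda>s::real. if s \<le> 1/2 then 1 - 2 * s else 2 * s - 1)"
    by (intro continuous_on_if_real continuous_intros) simp
  then have "loop_homotopic X a (loop_join p' p) (\<lambda>_. a)"
    by (rule loop_homotopic_reparametrize[where \<phi> = "\<lambda>s. if s \<le> 1/2 then 1 - 2 * s else 2 * s - 1"
            and \<psi> = "\<lambda>s. 1", OF pa(1)])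
       (auto simp: loop_join_def p'_def pa simp del: le_divide_eq_numeral1)
  then have "loop_class X a p' \<otimes>\<^bsub>?G\<^esub> A = \<one>\<^bsub>?G\<^esub>"
    using p p' by (simp add: A one_fundamental_group mult_fundamental_group
        loop_class_eq_iff loop_join_in_based_loops)
  then show "\<exists>B\<in>carrier ?G. B \<otimes>\<^bsub>?G\<^esub> A = \<one>\<^bsub>?G\<^esub>"
    using p' by (auto simp: carrier_fundamental_group)
  assume "B \<in> carrier ?G"
  then obtain q where q: "q \<in> based_loops X a" and B: "B = loop_class X a q"
    by (auto simp: carrier_fundamental_group)
  show "A \<otimes>\<^bsub>?G\<^esub> B \<in> carrier ?G"
    using p q by (simp add: A B mult_fundamental_group loop_join_in_based_loops carrier_fundamental_group)
  assume "C \<in> carrier ?G"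
  then obtain r where r: "r \<in> based_loops X a" and C: "C = loop_class X a r"
    by (auto simp: carrier_fundamental_group)
  have qr: "q 0 = a" "q 1 = a" "r 0 = a" "r 1 = a"
    using q r by (auto simp: based_loops_def)
  have j: "loop_join p (loop_join q r) \<in> based_loops X a"
    using p q r by (simp add: loop_join_in_based_loops)
  let ?\<phi> = "\<lambda>s::real. if s \<le> 1/2 then (if s \<le> 1/4 then 2 * s else s + 1/4) else s/2 + 1/2"
  have \<phi>: "continuous_on {0..1} ?\<phi>"
    by (intro continuous_on_if_real continuous_intros) simp_all
  have assoc: "loop_join (loop_join p q) r s = loop_join p (loop_join q r) (?\<phi> s)" for s
  proof -
    consider "s \<le> 1/4" | "1/4 < s" "s \<le> 1/2" | "1/2 < s" by linarith
    then show ?thesis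
    proof cases
      case 1
      then show ?thesis by (simp add: loop_join_def)
    next
      case 2
      then have "2 * (2 * (s + 1/4) - 1) = 2 * (2 * s) - 1" by (simp add: algebra_simps)
      with 2 show ?thesis by (simp add: loop_join_def)
    next
      case 3
      then have "2 * (2 * (s/2 + 1/2) - 1) - 1 = 2 * s - 1" by (simp add: algebra_simps)
      with 3 show ?thesis by (simp add: loop_join_def)
    qed
  qed
  have "loop_homotopic X a (loop_join (loop_join p q) r) (loop_join p (loop_join q r))"
  proof (rule loop_homotopic_reparametrize[where \<phi> = ?\<phi> and \<psi> = "\<lambda>s. s", OF _ \<phi>])
    show "pathin X (loop_join p (loop_join q r))" using j by (simp add: based_loops_def)
    show "loop_join p (loop_join q r) 0 = a" "loop_join p (loop_join q r) 1 = a"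
      using j by (auto simp: based_loops_def)
    show "loop_join (loop_join p q) r s = loop_join p (loop_join q r) (?\<phi> s)" for s
      by (rule assoc)
  qed auto
  then show "A \<otimes>\<^bsub>?G\<^esub> B \<otimes>\<^bsub>?G\<^esub> C = A \<otimes>\<^bsub>?G\<^esub> (B \<otimes>\<^bsub>?G\<^esub> C)"
    using p q r by (simp add: A B C mult_fundamental_group loop_class_eq_iff loop_join_in_based_loops)
qed (use a in \<open>auto simp: carrier_fundamental_group one_fundamental_group const_in_based_loops\<close>)

lemma pi1_map_hom:
  assumes f: "continuous_map X Y f"
  shows "pi1_map X Y f a \<in> hom (fundamental_group X a) (fundamental_group Y (f a))"
proof (rule homI)
  fix A B assume "A \<in> carrier (fundamental_group X a)" "B \<in> carrier (fundamental_group X a)"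
  then obtain p q where p: "p \<in> based_loops X a" "A = loop_class X a p"
    and q: "q \<in> based_loops X a" "B = loop_class X a q"
    by (auto simp: carrier_fundamental_group)
  have "f \<circ> loop_join p q = loop_join (f \<circ> p) (f \<circ> q)"
    by (auto simp: loop_join_def fun_eq_iff)
  then show "pi1_map X Y f a (A \<otimes>\<^bsub>fundamental_group X a\<^esub> B) =
      pi1_map X Y f a A \<otimes>\<^bsub>fundamental_group Y (f a)\<^esub> pi1_map X Y f a B"
    by (simp add: p q mult_fundamental_group pi1_map_loop_class[OF f] loop_join_in_based_loops)
qed (auto simp: carrier_fundamental_group pi1_map_loop_class[OF assms])

end

theory Submission
  imports Defs
begin

text \<open>
  Both \<open>\<real>P\<^sup>k\<close> and, via \<open>(u, v) \<mapsto> u \<and> v\<close>, the Grassmannian of planes are spaces of lines in a cone: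
  the nonzero vectors, respectively the nonzero decomposable bivectors.  A loop of lines lifts to a
  path from \<open>x\<close> to \<open>c x\<close> in the cone, and the sign of \<open>c\<close> is a homotopy invariant.  If paths in the cone
  are determined up to homotopy by their endpoints, the sign is a complete invariant, so every map
  induced by a linear map between two such cones is a \<open>\<pi>\<^sub>1\<close>-isomorphism.  It thus suffices to find linear maps
  that do not vanish on decomposable bivectors, that is, alternating bilinear maps \<open>f\<close> with
  \<open>f(u, v) \<noteq> 0\<close> for independent \<open>u, v\<close>.  With octonion multiplication the formula
  \<open>f((a, b), (c, d)) = (Im(a\<^sup>* c), d\<^sup>* a - b\<^sup>* c, Im(b\<^sup>* d))\<close> gives \<open>\<real>\<^sup>1\<^sup>6 \<times> \<real>\<^sup>1\<^sup>6 \<rightarrow> \<real>\<^sup>2\<^sup>2\<close>; restricting \<open>(a, b)\<close> to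
  \<open>\<real>\<^sup>4\<close>, \<open>\<real>\<^sup>8\<close> or \<open>\<real>\<^sup>8 \<times> K\<close> with \<open>K\<close> the reals, complex numbers or quaternions gives the other five maps.
  To contract the cones, paths are made piecewise linear and then coned off towards generic vectors.
\<close>

section \<open>Lines in a cone: path lifting and signs\<close>

text \<open>The obstacle is that decomposable bivectors are not closed under addition, so
  straight-line homotopies may leave the cone. Homotopies are therefore carried out on frames
  \<open>(u, v)\<close>, moving one vector at a time, and a path of bivectors first has to be
  replaced by the wedge of a path of frames. While the frame moves it stays in finitely many spans
  of three vectors; a vector outside all of them is only available in dimension at least four. The
  source Gr_2(R^3), which occurs in the statement on inclusions, thus needs its own argument: there
  every bivector is decomposable, and the cone is a punctured 3-space. Besides contracting the
  cones, both signs must be realised by loops; the negative one comes from a path from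
  \<open>x\<close> to \<open>- x\<close> in the source cone.\<close>

lemma scaleR_fun_apply [simp]: "(c *\<^sub>R f) x = c *\<^sub>R f x"
  by (simp add: scaleR_fun_def)

text \<open>Vectors are functions on a possibly infinite index type with the product topology, not
  elements of a normed space, so continuity is checked in each coordinate.\<close>

lemma continuous_on_fun_lincomb:
  fixes f g :: "'a::topological_space \<Rightarrow> 'i \<Rightarrow> real"
  assumes "continuous_on S a" "continuous_on S f" "continuous_on S b" "continuous_on S g"
  shows "continuous_on S (\<lambda>x. a x *\<^sub>R f x + b x *\<^sub>R g x)"
  by (rule continuous_on_coordinatewise_then_product)
     (simp, intro continuous_intros assms assms(2,4)[THEN continuous_on_product_then_coordinatewise])

lemma continuous_on_fun_scaleR:
  fixes f :: "'a::topological_space \<Rightarrow> 'i \<Rightarrow> real"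
  assumes "continuous_on S a" "continuous_on S f"
  shows "continuous_on S (\<lambda>x. a x *\<^sub>R f x)"
  by (rule continuous_on_coordinatewise_then_product)
     (simp, intro continuous_intros assms assms(2)[THEN continuous_on_product_then_coordinatewise])

text \<open>Amounts to simple connectivity of every path component. Path connectedness is not
  included; paths from \<open>x\<close> to \<open>- x\<close> are supplied separately.\<close>

definition homotopically_trivial :: "'a::topological_space set \<Rightarrow> bool" where
  "homotopically_trivial C \<longleftrightarrow>
     (\<forall>p r. path p \<and> path_image p \<subseteq> C \<and> path r \<and> path_image r \<subseteq> C \<and>
        pathstart p = pathstart r \<and> pathfinish p = pathfinish r \<longrightarrow> homotopic_paths C p r)"

lemma pos_of_nonvanishing:
  fixes f :: "real \<Rightarrow> real"
  assumes "continuous_on {0..1} f" "\<And>t. t \<in> {0..1} \<Longrightarrow> f t \<noteq> 0" "f 0 > 0"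
  shows "f 1 > 0"
proof (rule ccontr)
  assume "\<not> f 1 > 0"
  then have "\<exists>x\<ge>0. x \<le> 1 \<and> f x = 0"
    using assms by (intro IVT2') auto
  then show False using assms(2) by auto
qed

text \<open>\<open>C\<close> acts as a line bundle over \<open>X\<close> with the zero section
  removed; it may be curved, like the decomposable bivectors. Coordinates outside the finite set
  \<open>I\<close> vanish, so a sum over \<open>I\<close> gives an inner product that is positive
  definite on \<open>C\<close>.\<close>

locale projective_cone =
  fixes C :: "('i \<Rightarrow> real) set" and X :: "'b topology" and q :: "('i \<Rightarrow> real) \<Rightarrow> 'b" and I :: "'i set"
  assumes quot: "quotient_map (top_of_set C) X q"
    and fin: "finite I"
    and supp: "x \<in> C \<Longrightarrow> i \<notin> I \<Longrightarrow> x i = 0"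
    and nz: "0 \<notin> C"
    and scale: "x \<in> C \<Longrightarrow> c \<noteq> 0 \<Longrightarrow> c *\<^sub>R x \<in> C"
    and fib: "x \<in> C \<Longrightarrow> y \<in> C \<Longrightarrow> q x = q y \<longleftrightarrow> (\<exists>c. c \<noteq> 0 \<and> y = c *\<^sub>R x)"
begin

lemma q_image: "q ` C = topspace X"
  using quotient_imp_surjective_map[OF quot] by simp

lemma q_cont: "continuous_map (top_of_set C) X q"
  by (rule quotient_imp_continuous_map[OF quot])

lemma q_scale: "x \<in> C \<Longrightarrow> c \<noteq> 0 \<Longrightarrow> q (c *\<^sub>R x) = q x"
  using fib[of x "c *\<^sub>R x"] scale by auto

definition dot :: "('i \<Rightarrow> real) \<Rightarrow> ('i \<Rightarrow> real) \<Rightarrow> real" where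
  "dot x y = (\<Sum>i\<in>I. x i * y i)"

lemma dot_scaleR [simp]: "dot (c *\<^sub>R x) y = c * dot x y" "dot x (c *\<^sub>R y) = c * dot x y"
  by (simp_all add: dot_def sum_distrib_left mult_ac)

lemma dot_pos: assumes "x \<in> C" shows "dot x x > 0"
proof -
  have "x \<noteq> 0" using assms nz by auto
  then obtain i where i: "x i \<noteq> 0" by (auto simp: fun_eq_iff)
  then have "i \<in> I" using supp assms by blast
  moreover have "0 < x i * x i" using i not_real_square_gt_zero by blast
  ultimately show ?thesis
    unfolding dot_def using fin by (intro sum_pos2[of I i]) simp_all
qed

lemma dot_nz: "x \<in> C \<Longrightarrow> dot x x \<noteq> 0"
  using dot_pos by force

lemma continuous_on_dot:
  assumes "continuous_on S f" "continuous_on S g"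
  shows "continuous_on S (\<lambda>x. dot (f x) (g x))"
  unfolding dot_def
  by (intro continuous_intros assms[THEN continuous_on_product_then_coordinatewise])

text \<open>Matrix entries of the orthogonal projection to the line \<open>L\<close>. The chosen
  \<open>y\<close> cancels by homogeneity, so these are continuous real functions on
  \<open>X\<close> and give access to its quotient topology.\<close>

definition pr :: "'b \<Rightarrow> 'i \<Rightarrow> 'i \<Rightarrow> real" where
  "pr L i j = (let y = (SOME y. y \<in> C \<and> q y = L) in y i * y j / dot y y)"

lemma pr_q: assumes "y \<in> C" shows "pr (q y) i j = y i * y j / dot y y"
proof -
  define z where "z = (SOME z. z \<in> C \<and> q z = q y)"
  have z: "z \<in> C \<and> q z = q y"
    unfolding z_def by (rule someI[of _ y]) (use assms in auto)
  then obtain c where c: "c \<noteq> 0" "z = c *\<^sub>R y" using fib[of y z] assms by auto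
  have "z i * z j / dot z z = y i * y j / dot y y"
    using c dot_nz[OF assms] by (simp add: field_simps)
  then show ?thesis unfolding pr_def z_def[symmetric] by simp
qed

lemma continuous_map_pr: "continuous_map X euclideanreal (\<lambda>L. pr L i j)"
proof (rule continuous_compose_quotient_map[OF quot])
  have "continuous_on C (\<lambda>y. y i * y j / dot y y)"
    by (intro continuous_intros continuous_on_product_then_coordinatewise[OF continuous_on_id]
        continuous_on_dot ballI dot_nz)
  then have "continuous_on C (\<lambda>y. pr (q y) i j)"
    by (rule continuous_on_eq) (simp add: pr_q)
  then show "continuous_map (top_of_set C) euclideanreal ((\<lambda>L. pr L i j) \<circ> q)"
    by (simp add: o_def)
qed

definition proj :: "('i \<Rightarrow> real) \<Rightarrow> 'b \<Rightarrow> 'i \<Rightarrow> real" where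
  "proj x L i = (\<Sum>j\<in>I. pr L i j * x j)"

text \<open>The squared length of the projection of \<open>x\<close> to \<open>L\<close>; it is
  nonzero exactly when \<open>L\<close> is not perpendicular to \<open>x\<close>.\<close>

definition energy :: "('i \<Rightarrow> real) \<Rightarrow> 'b \<Rightarrow> real" where
  "energy x L = dot x (proj x L)"

lemma proj_q: "y \<in> C \<Longrightarrow> proj x (q y) = (dot x y / dot y y) *\<^sub>R y"
  by (rule ext) (simp add: proj_def pr_q dot_def sum_distrib_left sum_distrib_right sum_divide_distrib mult_ac)

lemma energy_q: "y \<in> C \<Longrightarrow> energy x (q y) = (dot x y)\<^sup>2 / dot y y"
  by (simp add: energy_def proj_q power2_eq_square)

section \<open>Lifting of loops and the sign of a lift\<close>

definition covers :: "(real \<Rightarrow> 'i \<Rightarrow> real) \<Rightarrow> (real \<Rightarrow> 'b) \<Rightarrow> bool" where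
  "covers g p \<longleftrightarrow> path g \<and> (\<forall>t\<in>{0..1}. g t \<in> C \<and> q (g t) = p t)"

text \<open>If \<open>x0\<close> spans \<open>p t0\<close>, its projection to \<open>p t\<close>
  varies continuously and stays nonzero as long as \<open>p t\<close> is not perpendicular to
  \<open>x0\<close>, hence for \<open>t\<close> near \<open>t0\<close>. This local section,
  multiplied by a constant to fit the starting vector, is the lift; Bolzano's principle glues the
  pieces.\<close>

lemma path_lifting:
  assumes p: "pathin X p" and x: "x \<in> C" "q x = p 0"
  obtains g where "covers g p" "g 0 = x"
proof -
  \<comment> \<open>Every starting vector over \<open>p a\<close> is allowed, so that the lift on
    the next interval can begin where the previous one stopped.\<close>
  define P where "P a b \<longleftrightarrow> (0 \<le> a \<longrightarrow> b \<le> 1 \<longrightarrow> (\<forall>x\<in>C. q x = p a \<longrightarrow>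
      (\<exists>g. continuous_on {a..b} g \<and> g a = x \<and> (\<forall>t\<in>{a..b}. g t \<in> C \<and> q (g t) = p t))))" for a b
  have contp: "continuous_map (top_of_set {0..1}) X p" using p by (simp add: pathin_def)
  have "P 0 1"
  proof (rule Bolzano)
    fix a b c :: real
    assume ab: "P a b" and bc: "P b c" and le: "a \<le> b" "b \<le> c"
    show "P a c" unfolding P_def
    proof (intro impI ballI)
      fix x assume "0 \<le> a" "c \<le> 1" "x \<in> C" "q x = p a"
      with ab le obtain g where g: "continuous_on {a..b} g" "g a = x" "\<forall>t\<in>{a..b}. g t \<in> C \<and> q (g t) = p t"
        unfolding P_def by force
      then have "g b \<in> C" "q (g b) = p b" using le by auto
      with bc le \<open>0 \<le> a\<close> \<open>c \<le> 1\<close> obtain h where h: "continuous_on {b..c} h" "h b = g b"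
          "\<forall>t\<in>{b..c}. h t \<in> C \<and> q (h t) = p t"
        unfolding P_def by force
      have "continuous_on ({a..b} \<union> {b..c}) (\<lambda>t. if t \<le> b then g t else h t)"
        using g h by (intro continuous_on_If closed_atLeastAtMost) auto
      moreover have "{a..b} \<union> {b..c} = {a..c}" using le by auto
      ultimately show "\<exists>g. continuous_on {a..c} g \<and> g a = x \<and> (\<forall>t\<in>{a..c}. g t \<in> C \<and> q (g t) = p t)"
        using g h le by (intro exI[of _ "\<lambda>t. if t \<le> b then g t else h t"]) auto
    qed
  next
    fix t0 :: real assume t0: "0 \<le> t0" "t0 \<le> 1"
    have "p t0 \<in> topspace X" using continuous_map_image_subset_topspace[OF contp] t0 by auto
    then obtain x0 where x0: "x0 \<in> C" "q x0 = p t0" using q_image by (metis imageE)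
    have proj: "continuous_on {0..1} (\<lambda>t. proj x0 (p t))"
    proof (rule continuous_on_coordinatewise_then_product)
      fix i
      have "continuous_on {0..1} (\<lambda>t. pr (p t) i j)" for j
        using continuous_map_compose[OF contp continuous_map_pr] by (simp add: o_def)
      then show "continuous_on {0..1} (\<lambda>t. proj x0 (p t) i)"
        unfolding proj_def by (intro continuous_intros)
    qed
    then have "continuous_on {0..1} (\<lambda>t. energy x0 (p t))"
      unfolding energy_def by (rule continuous_on_dot[OF continuous_on_const])
    moreover have e0: "energy x0 (p t0) > 0"
      using dot_pos[OF x0(1)] by (simp add: x0(2)[symmetric] energy_q[OF x0(1)])
    ultimately obtain d where d: "d > 0"
        "\<And>t. t \<in> {0..1} \<Longrightarrow> dist t t0 < d \<Longrightarrow> dist (energy x0 (p t)) (energy x0 (p t0)) < energy x0 (p t0)"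
      unfolding continuous_on_iff using t0 by (metis atLeastAtMost_iff)
    have pos: "proj x0 (p t) \<in> C \<and> q (proj x0 (p t)) = p t" if t: "t \<in> {0..1}" "dist t t0 < d" for t
    proof -
      have "p t \<in> topspace X" using continuous_map_image_subset_topspace[OF contp] t by auto
      then obtain y where y: "y \<in> C" "q y = p t" using q_image by (metis imageE)
      have "energy x0 (p t) \<noteq> 0" using d(2)[OF t] by (auto simp: dist_real_def)
      then have "dot x0 y \<noteq> 0" using energy_q[OF y(1)] y(2) by auto
      then have "dot x0 y / dot y y \<noteq> 0" using dot_pos[OF y(1)] by simp
      then show ?thesis
        using scale[OF y(1)] q_scale[OF y(1)] proj_q[OF y(1), of x0] y(2) by simp
    qed
    show "\<exists>d>0. \<forall>a b. a \<le> t0 \<and> t0 \<le> b \<and> b - a < d \<longrightarrow> P a b"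
    proof (intro exI[of _ d] conjI d allI impI)
      fix a b assume ab: "a \<le> t0 \<and> t0 \<le> b \<and> b - a < d"
      show "P a b" unfolding P_def
      proof (intro impI ballI)
        fix x assume a: "0 \<le> a" "b \<le> 1" and x: "x \<in> C" "q x = p a"
        have sub: "t \<in> {0..1} \<and> dist t t0 < d" if "t \<in> {a..b}" for t
          using that ab a by (auto simp: dist_real_def)
        have pa: "proj x0 (p a) \<in> C" "q (proj x0 (p a)) = q x"
          using pos[of a] sub[of a] ab x by auto
        then obtain c where c: "c \<noteq> 0" "x = c *\<^sub>R proj x0 (p a)"
          using fib[of "proj x0 (p a)" x] x by auto
        show "\<exists>g. continuous_on {a..b} g \<and> g a = x \<and> (\<forall>t\<in>{a..b}. g t \<in> C \<and> q (g t) = p t)"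
        proof (intro exI[of _ "\<lambda>t. c *\<^sub>R proj x0 (p t)"] conjI ballI)
          show "continuous_on {a..b} (\<lambda>t. c *\<^sub>R proj x0 (p t))"
            by (intro continuous_on_fun_scaleR continuous_on_const continuous_on_subset[OF proj])
               (use sub in auto)
          show "c *\<^sub>R proj x0 (p a) = x" using c by simp
          fix t assume "t \<in> {a..b}"
          then have "proj x0 (p t) \<in> C \<and> q (proj x0 (p t)) = p t" using pos sub by blast
          then show "c *\<^sub>R proj x0 (p t) \<in> C" "q (c *\<^sub>R proj x0 (p t)) = p t"
            using scale q_scale c(1) by auto
        qed
      qed
    qed
  qed simp
  then obtain g where "continuous_on {0..1} g" "g 0 = x" "\<forall>t\<in>{0..1}. g t \<in> C \<and> q (g t) = p t"
    unfolding P_def using x by force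
  then show ?thesis using that by (auto simp: covers_def path_def)
qed

lemma lift_endpoint:
  assumes "p \<in> based_loops X (q x)" "x \<in> C"
  obtains g c where "covers g p" "g 0 = x" "g 1 = c *\<^sub>R x" "c \<noteq> 0"
proof -
  have p: "pathin X p" "p 0 = q x" "p 1 = q x" using assms by (auto simp: based_loops_def)
  obtain g where g: "covers g p" "g 0 = x"
    using path_lifting[OF p(1) assms(2)] p by metis
  then have "g 1 \<in> C" "q x = q (g 1)" using p by (auto simp: covers_def)
  then obtain c where "c \<noteq> 0" "g 1 = c *\<^sub>R x" using fib assms by blast
  then show ?thesis using g that by blast
qed

text \<open>For neighbouring loops the inner product of two lifts never vanishes, since its square
  is a positive multiple of an energy close to a positive number. It starts at the squared length of
  \<open>x\<close>, so it ends positive, and its final value is the product of the two multipliers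
  times that squared length. No continuity of the lifts in the homotopy parameter is
  involved.\<close>

lemma homotopic_imp_same_sign:
  assumes hom: "loop_homotopic X (q x) p p'" and x: "x \<in> C"
    and g: "covers g p" "g 0 = x" "g 1 = c *\<^sub>R x"
    and g': "covers g' p'" "g' 0 = x" "g' 1 = c' *\<^sub>R x"
  shows "c * c' > 0"
proof -
  obtain h where h: "continuous_map unit_square X h"
    "\<And>s. h (0, s) = p s" "\<And>s. h (1, s) = p' s"
    "\<And>t. t \<in> {0..1} \<Longrightarrow> h (t, 0) = q x \<and> h (t, 1) = q x"
    using loop_homotopicE[OF hom] by metis
  have loops: "(\<lambda>t. h (s, t)) \<in> based_loops X (q x)" if s: "s \<in> {0..1}" for s
  proof -
    have "continuous_map (top_of_set {0..1}) unit_square (\<lambda>t. (s, t))"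
      using s by (auto intro!: continuous_intros)
    from continuous_map_compose[OF this h(1)] show ?thesis
      using h(4) s by (auto simp: based_loops_def pathin_def o_def)
  qed
  define P where "P a b \<longleftrightarrow> (0 \<le> a \<longrightarrow> b \<le> 1 \<longrightarrow> (\<forall>g c g' c'.
      covers g (\<lambda>t. h (a, t)) \<and> g 0 = x \<and> g 1 = c *\<^sub>R x \<and>
      covers g' (\<lambda>t. h (b, t)) \<and> g' 0 = x \<and> g' 1 = c' *\<^sub>R x \<longrightarrow> c * c' > 0))" for a b
  have "P 0 1"
  proof (rule Bolzano)
    fix a b d :: real
    assume ab: "P a b" and bc: "P b d" and le: "a \<le> b" "b \<le> d"
    show "P a d" unfolding P_def
    proof (intro impI allI, elim conjE)
      fix g c g' c'
      assume a: "0 \<le> a" "d \<le> 1" and g: "covers g (\<lambda>t. h (a, t))" "g 0 = x" "g 1 = c *\<^sub>R x"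
        "covers g' (\<lambda>t. h (d, t))" "g' 0 = x" "g' 1 = c' *\<^sub>R x"
      have "b \<in> {0..1}" using a le by auto
      from lift_endpoint[OF loops[OF this] x] obtain k e
        where k: "covers k (\<lambda>t. h (b, t))" "k 0 = x" "k 1 = e *\<^sub>R x" .
      have "c * e > 0"
        using ab[unfolded P_def, rule_format, of g c k e] k g a le by simp
      moreover have "e * c' > 0"
        using bc[unfolded P_def, rule_format, of k e g' c'] k g a le by simp
      ultimately show "c * c' > 0" by (auto simp: zero_less_mult_iff)
    qed
  next
    fix s0 :: real assume s0: "0 \<le> s0" "s0 \<le> 1"
    then have s01: "s0 \<in> {0..1}" by auto
    obtain k e where k: "covers k (\<lambda>t. h (s0, t))" "k 0 = x" "k 1 = e *\<^sub>R x" "e \<noteq> 0"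
      using lift_endpoint[OF loops[OF s01] x] .
    have kC: "k t \<in> C" "q (k t) = h (s0, t)" if "t \<in> {0..1}" for t using k(1) that by (auto simp: covers_def)
    \<comment> \<open>\<open>E (s, t)\<close> tests the fixed lift \<open>k\<close> of the loop at
      \<open>s0\<close> against the loop at \<open>s\<close>. It depends on the line only, so its
      continuity can be used before the latter loop is lifted.\<close>
    define E where "E z = energy (k (snd z)) (h z)" for z
    have contk: "continuous_on ({0..1} \<times> {0..1}) (\<lambda>z. k (snd z) i)" for i
    proof (rule continuous_on_compose2[of "{0..1}" "\<lambda>t. k t i" _ snd])
      show "continuous_on {0..1} (\<lambda>t. k t i)"
        using k(1) unfolding covers_def path_def
        by (rule continuous_on_product_then_coordinatewise[OF conjunct1])
    qed (auto intro: continuous_intros)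
    have conth: "continuous_on ({0..1} \<times> {0..1}) (\<lambda>z. pr (h z) i j)" for i j
      using continuous_map_compose[OF h(1) continuous_map_pr[of i j]] by (simp add: o_def)
    have "continuous_on ({0..1} \<times> {0..1}) E"
      unfolding E_def energy_def proj_def dot_def by (intro continuous_intros contk conth)
    moreover have E0: "E (s0, t) = dot (k t) (k t)" if "t \<in> {0..1}" for t
      using kC[OF that] energy_q[of "k t" "k t"] dot_pos[of "k t"] by (simp add: E_def power2_eq_square)
    have contd: "continuous_on {0..1} (\<lambda>t. dot (k t) (k t))"
      using k(1) unfolding covers_def path_def by (intro continuous_on_dot) auto
    \<comment> \<open>The minimum over the compact interval makes the bound uniform in
      \<open>t\<close>: a deviation of at most \<open>m / 2\<close> from a value at least
      \<open>m\<close> cannot reach 0.\<close>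
    obtain m where m: "m > 0" "\<And>t. t \<in> {0..1} \<Longrightarrow> dot (k t) (k t) \<ge> m"
    proof -
      obtain t1 where "t1 \<in> {0..1}" "\<forall>t\<in>{0..1}. dot (k t1) (k t1) \<le> dot (k t) (k t)"
        using continuous_attains_inf[OF _ _ contd] by auto
      then show ?thesis using that[of "dot (k t1) (k t1)"] dot_pos kC by blast
    qed
    ultimately obtain U where U: "s0 \<in> U" "open U"
      "\<forall>s\<in>U \<inter> {0..1}. \<forall>t\<in>{0..1}. dist (E (s, t)) (E (s0, t)) \<le> m / 2"
      using continuous_on_prod_compactE[of "{0..1}" "{0..1}" E s0 "m/2"] s01 by auto
    obtain d where d: "d > 0" "ball s0 d \<subseteq> U" using U by (meson openE)
    have Enz: "E (s, t) \<noteq> 0" if s: "s \<in> {0..1}" "dist s s0 < d" and t: "t \<in> {0..1}" for s t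
    proof -
      have "s \<in> U \<inter> {0..1}" using d(2) s by (auto simp: dist_commute)
      then have "dist (E (s, t)) (E (s0, t)) \<le> m / 2" using U(3) t by blast
      then show ?thesis using E0[OF t] m(1) m(2)[OF t] by (auto simp: dist_real_def)
    qed
    have key: "c * e > 0" if s: "s \<in> {0..1}" "dist s s0 < d"
      and g: "covers g (\<lambda>t. h (s, t))" "g 0 = x" "g 1 = c *\<^sub>R x" for s g c
    proof -
      have "dot (k 1) (g 1) > 0"
      proof (rule pos_of_nonvanishing)
        show "continuous_on {0..1} (\<lambda>t. dot (k t) (g t))"
          using k(1) g(1) unfolding covers_def path_def by (intro continuous_on_dot) auto
        fix t :: real assume t: "t \<in> {0..1}"
        have gt: "g t \<in> C" "q (g t) = h (s, t)" using g(1) t by (auto simp: covers_def)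
        have "E (s, t) = (dot (k t) (g t))\<^sup>2 / dot (g t) (g t)"
          using energy_q[OF gt(1), of "k t"] gt(2) by (simp add: E_def)
        then show "dot (k t) (g t) \<noteq> 0" using Enz[OF s t] by auto
      next
        show "dot (k 0) (g 0) > 0" using dot_pos[OF x] k g by simp
      qed
      then have "e * (c * dot x x) > 0" using k g by (simp add: mult.left_commute)
      then show ?thesis using dot_pos[OF x] by (auto simp: zero_less_mult_iff mult_less_0_iff)
    qed
    show "\<exists>d>0. \<forall>a b. a \<le> s0 \<and> s0 \<le> b \<and> b - a < d \<longrightarrow> P a b"
    proof (intro exI[of _ d] conjI d allI impI)
      fix a b assume ab: "a \<le> s0 \<and> s0 \<le> b \<and> b - a < d"
      show "P a b" unfolding P_def
      proof (intro impI allI, elim conjE)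
        fix g c g' c'
        assume a: "0 \<le> a" "b \<le> 1" and g: "covers g (\<lambda>t. h (a, t))" "g 0 = x" "g 1 = c *\<^sub>R x"
          "covers g' (\<lambda>t. h (b, t))" "g' 0 = x" "g' 1 = c' *\<^sub>R x"
        have "c * e > 0" "c' * e > 0"
          using key[of a g c] key[of b g' c'] g a ab by (auto simp: dist_real_def)
        then show "c * c' > 0" by (auto simp: zero_less_mult_iff)
      qed
    qed
  qed simp
  moreover have "(\<lambda>t. h (0, t)) = p" "(\<lambda>t. h (1, t)) = p'" using h by auto
  ultimately show ?thesis using g g' unfolding P_def by auto
qed

text \<open>Multiplying a lift by a positive function does not change the loop below, and for equal
  signs this suffices to make the endpoints of the lifts agree. A homotopy in \<open>C\<close> is
  then pushed down by \<open>q\<close>.\<close>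

lemma same_sign_imp_homotopic:
  assumes triv: "homotopically_trivial C" and x: "x \<in> C"
    and g: "covers g p" "g 0 = x" "g 1 = c *\<^sub>R x"
    and g': "covers g' p'" "g' 0 = x" "g' 1 = c' *\<^sub>R x"
    and pos: "c * c' > 0"
  shows "loop_homotopic X (q x) p p'"
proof -
  \<comment> \<open>The factor runs linearly from 1 to \<open>c / c'\<close>, both positive, so
    \<open>k\<close> ends at \<open>c *\<^sub>R x\<close> like \<open>g\<close>.\<close>
  define k where "k t = ((1 - t) + t * (c / c')) *\<^sub>R g' t" for t
  have cc: "c / c' > 0" "c' \<noteq> 0" "c \<noteq> 0" using pos by (auto simp: zero_less_mult_iff zero_less_divide_iff)
  have fac: "(1 - t) + t * (c / c') > 0" if "t \<in> {0..1}" for t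
  proof (cases "t = 1")
    case False
    have "t * (c / c') \<ge> 0" using that cc(1) by (intro mult_nonneg_nonneg) auto
    then show ?thesis using that False by auto
  qed (use cc(1) in simp)
  have "continuous_on {0..1} k"
    unfolding k_def using g'(1) unfolding covers_def path_def
    by (intro continuous_on_fun_scaleR) (auto intro!: continuous_intros cc)
  then have pk: "path k" by (simp add: path_def)
  have kC: "k t \<in> C \<and> q (k t) = p' t" if "t \<in> {0..1}" for t
    using fac[OF that] g'(1) that by (auto simp: k_def covers_def scale q_scale)
  have k0: "k 0 = x" "k 1 = c *\<^sub>R x" using g' cc by (auto simp: k_def)
  have "homotopic_paths C g k"
    using triv[unfolded homotopically_trivial_def, rule_format, of g k] g pk kC k0
    by (auto simp: covers_def path_image_def pathstart_def pathfinish_def image_subset_iff)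
  then obtain h :: "real \<times> real \<Rightarrow> 'i \<Rightarrow> real"
    where h: "continuous_on ({0..1} \<times> {0..1}) h" "h \<in> ({0..1} \<times> {0..1}) \<rightarrow> C"
      "\<forall>t\<in>{0..1}. h (0, t) = g t" "\<forall>t\<in>{0..1}. h (1, t) = k t"
      "\<forall>t\<in>{0..1}. h (t, 0) = x \<and> h (t, 1) = c *\<^sub>R x"
    unfolding homotopic_paths pathstart_def pathfinish_def o_def g by blast
  have "continuous_map unit_square (top_of_set C) h" using h(1,2) by auto
  from continuous_map_compose[OF this q_cont]
  show ?thesis
    by (rule loop_homotopicI) (use h kC g cc x in \<open>auto simp: covers_def q_scale\<close>)
qed

lemma covers_based_loop:
  assumes g: "path g" "\<And>t. t \<in> {0..1} \<Longrightarrow> g t \<in> C" "g 0 = x" "g 1 = c *\<^sub>R x" "c \<noteq> 0"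
  shows "q \<circ> g \<in> based_loops X (q x)" "covers g (q \<circ> g)"
proof -
  have "continuous_map (top_of_set {0..1}) (top_of_set C) g" using g by (auto simp: path_def)
  from continuous_map_compose[OF this q_cont] show "q \<circ> g \<in> based_loops X (q x)"
    using g g(2)[of 0] by (simp add: based_loops_def pathin_def q_scale)
  show "covers g (q \<circ> g)" using g by (simp add: covers_def)
qed

end

text \<open>By homogeneity \<open>F\<close> carries a lift ending at \<open>c *\<^sub>R x\<close> to
  a lift ending at \<open>c *\<^sub>R F x\<close>, so the sign is preserved. Since the sign is
  invariant over \<open>Y\<close> and complete over \<open>X\<close>, the induced map is injective;
  since it is complete over \<open>Y\<close> and both signs occur over \<open>X\<close>, it is
  surjective.\<close>

lemma induces_pi1_isomorphism_cones:
  assumes X: "projective_cone C X q I" and Y: "projective_cone D Y r J"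
    and trivC: "homotopically_trivial C" and trivD: "homotopically_trivial D"
    and flip: "\<And>x. x \<in> C \<Longrightarrow> \<exists>g. path g \<and> path_image g \<subseteq> C \<and> pathstart g = x \<and> pathfinish g = - x"
    and F: "continuous_on C F" "\<And>x. x \<in> C \<Longrightarrow> F x \<in> D"
      "\<And>c x. x \<in> C \<Longrightarrow> c \<noteq> 0 \<Longrightarrow> F (c *\<^sub>R x) = c *\<^sub>R F x"
    and f: "\<And>x. x \<in> C \<Longrightarrow> f (q x) = r (F x)"
  shows "induces_pi1_isomorphism X Y f"
proof -
  interpret X: projective_cone C X q I by fact
  interpret Y: projective_cone D Y r J by fact
  have "continuous_map (top_of_set C) (top_of_set D) F" using F by auto
  from continuous_map_compose[OF this Y.q_cont] have "continuous_map (top_of_set C) Y (f \<circ> q)"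
    by (rule continuous_map_eq) (use f in auto)
  then have contf: "continuous_map X Y f" by (rule continuous_compose_quotient_map[OF X.quot])
  have "pi1_map X Y f a \<in> iso (fundamental_group X a) (fundamental_group Y (f a))"
    if a: "a \<in> topspace X" for a
  proof -
    obtain x where x: "x \<in> C" "q x = a" using a X.q_image by (metis imageE)
    have fa: "f a = r (F x)" using f x by auto
    have FC: "F x \<in> D" using F x by auto
    have push: "Y.covers (F \<circ> g) (f \<circ> p)" if "X.covers g p" for g p
    proof -
      have "continuous_on {0..1} (\<lambda>t. F (g t))"
        using that unfolding X.covers_def path_def by (intro continuous_on_compose2[OF F(1)]) auto
      then show ?thesis
        using that F(2) f[symmetric] by (simp add: X.covers_def Y.covers_def path_def o_def)
    qed
    have lift: thesis if "p \<in> based_loops X a"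
      "\<And>g c. X.covers g p \<Longrightarrow> g 0 = x \<Longrightarrow> g 1 = c *\<^sub>R x \<Longrightarrow> c \<noteq> 0 \<Longrightarrow>
         Y.covers (F \<circ> g) (f \<circ> p) \<Longrightarrow> (F \<circ> g) 0 = F x \<Longrightarrow> (F \<circ> g) 1 = c *\<^sub>R F x \<Longrightarrow> thesis" for p thesis
    proof -
      from that(1) x(2) have "p \<in> based_loops X (q x)" by simp
      from X.lift_endpoint[OF this x(1)] obtain g c
        where g: "X.covers g p" "g 0 = x" "g 1 = c *\<^sub>R x" "c \<noteq> 0" .
      show thesis
        by (rule that(2)[OF g push[OF g(1)]]) (use g F(3)[OF x(1)] in simp_all)
    qed
    have "inj_on (pi1_map X Y f a) (carrier (fundamental_group X a))"
    proof (rule inj_onI)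
      fix A B assume "A \<in> carrier (fundamental_group X a)" "B \<in> carrier (fundamental_group X a)"
        and eq: "pi1_map X Y f a A = pi1_map X Y f a B"
      then obtain p p' where p: "p \<in> based_loops X a" "A = loop_class X a p"
        "p' \<in> based_loops X a" "B = loop_class X a p'" by (auto simp: carrier_fundamental_group)
      have "loop_homotopic Y (f a) (f \<circ> p) (f \<circ> p')"
        using eq p pi1_map_loop_class[OF contf] loop_class_eq_iff[of "f \<circ> p" Y "f a" "f \<circ> p'"] by simp
      then have hom: "loop_homotopic Y (r (F x)) (f \<circ> p) (f \<circ> p')" by (simp add: fa)
      obtain g c where g: "X.covers g p" "g 0 = x" "g 1 = c *\<^sub>R x" "Y.covers (F \<circ> g) (f \<circ> p)"
          "(F \<circ> g) 0 = F x" "(F \<circ> g) 1 = c *\<^sub>R F x" using lift[OF p(1)] .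
      obtain g' c' where g': "X.covers g' p'" "g' 0 = x" "g' 1 = c' *\<^sub>R x" "Y.covers (F \<circ> g') (f \<circ> p')"
          "(F \<circ> g') 0 = F x" "(F \<circ> g') 1 = c' *\<^sub>R F x" using lift[OF p(3)] .
      have "c * c' > 0" by (rule Y.homotopic_imp_same_sign[OF hom FC g(4-6) g'(4-6)])
      then have "loop_homotopic X (q x) p p'"
        by (rule X.same_sign_imp_homotopic[OF trivC x(1) g(1-3) g'(1-3)])
      then show "A = B" using p x loop_class_eq_iff[of p X a p'] by simp
    qed
    moreover have "pi1_map X Y f a ` carrier (fundamental_group X a) = carrier (fundamental_group Y (f a))"
    proof (rule subset_antisym)
      show "pi1_map X Y f a ` carrier (fundamental_group X a) \<subseteq> carrier (fundamental_group Y (f a))"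
        using pi1_map_hom[OF contf] by (auto simp: hom_def)
      show "carrier (fundamental_group Y (f a)) \<subseteq> pi1_map X Y f a ` carrier (fundamental_group X a)"
      proof
        fix B assume "B \<in> carrier (fundamental_group Y (f a))"
        then obtain p' where p': "p' \<in> based_loops Y (f a)" "B = loop_class Y (f a) p'"
          by (auto simp: carrier_fundamental_group)
        obtain k e where k: "Y.covers k p'" "k 0 = F x" "k 1 = e *\<^sub>R F x" "e \<noteq> 0"
          using Y.lift_endpoint[OF _ FC] p'(1)[unfolded fa] by blast
        \<comment> \<open>Only the sign of \<open>e\<close> has to be matched: a constant path gives
          the positive one, \<open>flip\<close> the negative one.\<close>
        have "\<exists>g c. path g \<and> (\<forall>t\<in>{0..1}. g t \<in> C) \<and> g 0 = x \<and> g 1 = c *\<^sub>R x \<and> c * e > 0"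
        proof (cases "e > 0")
          case True
          then show ?thesis using x by (intro exI[of _ "\<lambda>_. x"] exI[of _ 1]) (auto simp: path_def)
        next
          case False
          obtain g where "path g" "path_image g \<subseteq> C" "pathstart g = x" "pathfinish g = - x"
            using flip[OF x(1)] by blast
          then show ?thesis using False k(4)
            by (intro exI[of _ g] exI[of _ "- 1"]) (auto simp: path_image_def pathstart_def pathfinish_def)
        qed
        then obtain g c where g: "path g" "\<And>t. t \<in> {0..1} \<Longrightarrow> g t \<in> C" "g 0 = x" "g 1 = c *\<^sub>R x" "c * e > 0"
          by blast
        have "c \<noteq> 0" using g(5) by auto
        note cov = X.covers_based_loop[OF g(1-4) this]
        have "loop_homotopic Y (r (F x)) (f \<circ> (q \<circ> g)) p'"
          using Y.same_sign_imp_homotopic[OF trivD FC push[OF cov(2)] _ _ k(1-3), of c] g F(3) x(1) \<open>c \<noteq> 0\<close>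
          by (simp add: F)
        moreover have "pi1_map X Y f a (loop_class X a (q \<circ> g)) = loop_class Y (f a) (f \<circ> (q \<circ> g))"
            "f \<circ> (q \<circ> g) \<in> based_loops Y (f a)"
          using pi1_map_loop_class[OF contf] cov(1) x by auto
        ultimately have "pi1_map X Y f a (loop_class X a (q \<circ> g)) = B"
          using p'(2) loop_class_eq_iff[of "f \<circ> (q \<circ> g)" Y "f a" p'] by (simp add: fa)
        then show "B \<in> pi1_map X Y f a ` carrier (fundamental_group X a)"
          using cov(1) x(2) by (auto simp: carrier_fundamental_group)
      qed
    qed
    ultimately show ?thesis
      using pi1_map_hom[OF contf] by (auto simp: iso_def bij_betw_def)
  qed
  then show ?thesis using contf by (simp add: induces_pi1_isomorphism_def)
qed

lemma induces_pi1_isomorphism_compose: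
  assumes f: "induces_pi1_isomorphism X Y f" and g: "induces_pi1_isomorphism Y Z g"
  shows "induces_pi1_isomorphism X Z (g \<circ> f)"
proof -
  have cont: "continuous_map X Y f" "continuous_map Y Z g"
    using f g by (auto simp: induces_pi1_isomorphism_def)
  have "pi1_map X Z (g \<circ> f) a \<in> iso (fundamental_group X a) (fundamental_group Z ((g \<circ> f) a))"
    if a: "a \<in> topspace X" for a
  proof -
    have fa: "f a \<in> topspace Y" using cont(1) a by (auto simp: continuous_map_def)
    have "pi1_map Y Z g (f a) \<circ> pi1_map X Y f a \<in> iso (fundamental_group X a) (fundamental_group Z (g (f a)))"
      using f g a fa by (auto simp: induces_pi1_isomorphism_def intro: iso_set_trans)
    moreover have "(pi1_map Y Z g (f a) \<circ> pi1_map X Y f a) A = pi1_map X Z (g \<circ> f) a A"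
      if "A \<in> carrier (fundamental_group X a)" for A
      using that pi1_map_loop_class[OF cont(1)] pi1_map_loop_class[OF cont(2)]
        pi1_map_loop_class[OF continuous_map_compose[OF cont]]
      by (auto simp: carrier_fundamental_group o_assoc)
    ultimately show ?thesis
      unfolding comp_apply[of g f]
      by (rule group.iso_eq[OF group_fundamental_group[OF a], OF _ sym])
  qed
  then show ?thesis
    using continuous_map_compose[OF cont] by (simp add: induces_pi1_isomorphism_def)
qed

section \<open>Paths in general position\<close>

text \<open>If \<open>x\<close> avoids the old subspaces but lies in the new \<open>K\<close>, take
  \<open>y\<close> in \<open>V\<close> outside \<open>K\<close>. The line of the points
  \<open>y + t *\<^sub>R x\<close> misses \<open>K\<close> and meets each old subspace at most once,
  so all but finitely many \<open>t\<close> work.\<close>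

lemma subspaces_avoidance:
  fixes V :: "'a::real_vector set"
  assumes V: "subspace V" and fin: "finite \<K>"
    and sub: "\<And>K. K \<in> \<K> \<Longrightarrow> subspace K" and proper: "\<And>K. K \<in> \<K> \<Longrightarrow> \<not> V \<subseteq> K"
  shows "\<exists>e\<in>V. \<forall>K\<in>\<K>. e \<notin> K"
  using fin sub proper
proof (induction \<K> rule: finite_induct)
  case empty
  then show ?case using V subspace_0 by blast
next
  case (insert K \<K>)
  then obtain x where x: "x \<in> V" "\<forall>L\<in>\<K>. x \<notin> L" by blast
  obtain y where y: "y \<in> V" "y \<notin> K" using insert.prems(2)[of K] by blast
  define B where "B L = {t::real. y + t *\<^sub>R x \<in> L}" for L
  show ?case
  proof (cases "x \<in> K")
    case False
    then show ?thesis using x by blast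
  next
    case True
    have "finite (B L)" if L: "L \<in> insert K \<K>" for L
    proof (cases "L = K")
      case True
      have "subspace K" using insert.prems by blast
      have "y + t *\<^sub>R x \<notin> K" for t
      proof
        assume "y + t *\<^sub>R x \<in> K"
        then have "(y + t *\<^sub>R x) - t *\<^sub>R x \<in> K"
          using \<open>subspace K\<close> \<open>x \<in> K\<close> by (blast intro: subspace_diff subspace_scale)
        then show False using y by simp
      qed
      then show ?thesis using True by (simp add: B_def)
    next
      case False
      then have L: "subspace L" "x \<notin> L" using L insert.prems x by auto
      have "s = t" if "s \<in> B L" "t \<in> B L" for s t
      proof (rule ccontr)
        assume "s \<noteq> t"
        have "(y + s *\<^sub>R x) - (y + t *\<^sub>R x) \<in> L" using that L(1) by (intro subspace_diff) (auto simp: B_def)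
        moreover have "(y + s *\<^sub>R x) - (y + t *\<^sub>R x) = (s - t) *\<^sub>R x"
          by (simp add: scaleR_left_diff_distrib)
        ultimately have "(1 / (s - t)) *\<^sub>R ((s - t) *\<^sub>R x) \<in> L"
          using L(1) by (simp only: subspace_scale)
        then show False using L(2) \<open>s \<noteq> t\<close> by simp
      qed
      then have "\<exists>t. B L \<subseteq> {t}" by blast
      then show ?thesis by (metis finite.emptyI finite_insert finite_subset)
    qed
    then have "finite (\<Union>L\<in>insert K \<K>. B L)" using insert.hyps by blast
    then obtain t where "t \<notin> (\<Union>L\<in>insert K \<K>. B L)"
      using ex_new_if_finite infinite_UNIV_char_0 by blast
    then show ?thesis
      using V x y by (intro bexI[of _ "y + t *\<^sub>R x"]) (auto simp: B_def intro: subspace_add subspace_scale)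
  qed
qed

lemma continuous_on_path_snd:
  assumes "path k"
  shows "continuous_on (S \<times> {0..1}) (\<lambda>z. k (snd z))"
  using assms unfolding path_def by (rule continuous_on_compose2) (auto intro: continuous_intros)

text \<open>A path is homotopic to the other three sides of any square of which it is one side.\<close>

lemma homotopic_paths_three_sides:
  fixes H :: "real \<times> real \<Rightarrow> 'a::topological_space"
  assumes "continuous_on ({0..1} \<times> {0..1}) H" "H ` ({0..1} \<times> {0..1}) \<subseteq> C"
  shows "homotopic_paths C (\<lambda>t. H (0, t))
    (\<lambda>t. H (min 1 (min (3 * t) (3 - 3 * t)), max 0 (min 1 (3 * t - 1))))"
proof -
  \<comment> \<open>The point \<open>(a t, b t)\<close> walks from (0, 0) to (1, 0), then to (1, 1),
    then to (0, 1), one side per third of the time. The square is convex, so the remaining side can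
    be moved there linearly with its endpoints fixed.\<close>
  define a b where "a t = min 1 (min (3 * t) (3 - 3 * t))" and "b t = max 0 (min 1 (3 * t - 1))" for t :: real
  have ab: "a t \<in> {0..1}" "b t \<in> {0..1}" if "t \<in> {0..1}" for t
    using that by (auto simp: a_def b_def)
  have cont: "continuous_on S (\<lambda>z. a (snd z))" "continuous_on S (\<lambda>z. b (snd z))" for S :: "(real \<times> real) set"
    unfolding a_def b_def by (intro continuous_intros)+
  have conv: "(r * a t, (1 - r) * t + r * b t) \<in> {0..1} \<times> {0..1}" if "r \<in> {0..1}" "t \<in> {0..1}" for r t
    using that ab[OF that(2)] convexD_alt[of "{0..1::real}" t "b t" r] mult_le_one[of r "a t"] by auto
  show ?thesis
    unfolding homotopic_paths a_def[symmetric] b_def[symmetric]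
  proof (intro exI[of _ "\<lambda>z. H (fst z * a (snd z), (1 - fst z) * snd z + fst z * b (snd z))"] conjI ballI)
    show "continuous_on ({0..1} \<times> {0..1}) (\<lambda>z. H (fst z * a (snd z), (1 - fst z) * snd z + fst z * b (snd z)))"
      by (rule continuous_on_compose2[OF assms(1)])
         (intro continuous_intros cont, use conv in auto)
    show "(\<lambda>z. H (fst z * a (snd z), (1 - fst z) * snd z + fst z * b (snd z))) \<in> {0..1} \<times> {0..1} \<rightarrow> C"
      using conv assms(2) by (auto simp: image_subset_iff)
  qed (auto simp: pathstart_def pathfinish_def a_def b_def)
qed

text \<open>Coning off moves the endpoints, so it is not itself a homotopy relative to them. If two
  contractions agree on the three other sides, both paths are homotopic relative to endpoints to the
  same detour.\<close>

lemma homotopic_paths_common_contraction: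
  fixes H K :: "real \<times> real \<Rightarrow> 'a::topological_space"
  assumes H: "continuous_on ({0..1} \<times> {0..1}) H" "H ` ({0..1} \<times> {0..1}) \<subseteq> C"
    and K: "continuous_on ({0..1} \<times> {0..1}) K" "K ` ({0..1} \<times> {0..1}) \<subseteq> C"
    and eq: "\<And>s. s \<in> {0..1} \<Longrightarrow> H (s, 0) = K (s, 0)" "\<And>s. s \<in> {0..1} \<Longrightarrow> H (s, 1) = K (s, 1)"
      "\<And>t. t \<in> {0..1} \<Longrightarrow> H (1, t) = K (1, t)"
  shows "homotopic_paths C (\<lambda>t. H (0, t)) (\<lambda>t. K (0, t))"
proof -
  let ?s = "\<lambda>L :: real \<times> real \<Rightarrow> 'a. \<lambda>t. L (min 1 (min (3 * t) (3 - 3 * t)), max 0 (min 1 (3 * t - 1)))"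
  have HH: "homotopic_paths C (\<lambda>t. H (0, t)) (?s H)" and KK: "homotopic_paths C (\<lambda>t. K (0, t)) (?s K)"
    by (rule homotopic_paths_three_sides[OF H], rule homotopic_paths_three_sides[OF K])
  have "?s H t = ?s K t" if t: "t \<in> {0..1}" for t
  proof -
    consider "t \<le> 1/3" | "1/3 \<le> t" "t \<le> 2/3" | "2/3 \<le> t" by linarith
    then show ?thesis
    proof cases
      case 1
      then have "max 0 (min 1 (3 * t - 1)) = 0" "min 1 (min (3 * t) (3 - 3 * t)) \<in> {0..1}" using t by auto
      then show ?thesis using eq(1) by simp
    next
      case 2
      then have "min 1 (min (3 * t) (3 - 3 * t)) = 1" "max 0 (min 1 (3 * t - 1)) \<in> {0..1}" by auto
      then show ?thesis using eq(3) by simp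
    next
      case 3
      then have "max 0 (min 1 (3 * t - 1)) = 1" "min 1 (min (3 * t) (3 - 3 * t)) \<in> {0..1}" using t by auto
      then show ?thesis using eq(2) by simp
    qed
  qed
  then have "homotopic_paths C (?s H) (?s K)"
    using homotopic_paths_imp_path[OF HH] homotopic_paths_imp_subset[OF HH] by (intro homotopic_paths_eq) auto
  then show ?thesis using HH KK homotopic_paths_trans homotopic_paths_sym by blast
qed

section \<open>Subdivision of paths and polygonal approximation\<close>

definition segment_of :: "real \<Rightarrow> real \<Rightarrow> (real \<Rightarrow> 'a) \<Rightarrow> real \<Rightarrow> 'a" where
  "segment_of a b p = (\<lambda>s. p (a + s * (b - a)))"

lemma segment_of_mem:
  fixes a b s :: real
  assumes "0 \<le> a" "a \<le> b" "b \<le> 1" "s \<in> {0..1}"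
  shows "a + s * (b - a) \<in> {a..b}"
proof -
  have "s * (b - a) \<ge> 0" "s * (b - a) \<le> b - a"
    using assms mult_right_mono[of s 1 "b - a"] by auto
  then show ?thesis by auto
qed

lemma path_segment_of:
  assumes "path p" "0 \<le> a" "a \<le> b" "b \<le> 1"
  shows "path (segment_of a b p)"
  unfolding path_def segment_of_def
proof (rule continuous_on_compose2[OF assms(1)[unfolded path_def]])
  show "(\<lambda>s. a + s * (b - a)) ` {0..1} \<subseteq> {0..1}"
    using segment_of_mem[OF assms(2-4)] assms(2-4) by fastforce
qed (intro continuous_intros)

lemma path_image_segment_of:
  assumes "0 \<le> a" "a \<le> b" "b \<le> 1"
  shows "path_image (segment_of a b p) \<subseteq> p ` {a..b}"
  using segment_of_mem[OF assms] by (auto simp: path_image_def segment_of_def)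

lemma segment_of_ends [simp]:
  "segment_of a b p 0 = p a" "segment_of a b p 1 = p b"
  "pathstart (segment_of a b p) = p a" "pathfinish (segment_of a b p) = p b"
  by (simp_all add: segment_of_def pathstart_def pathfinish_def)

lemma homotopic_paths_segment_of_join:
  fixes p :: "real \<Rightarrow> 'a::topological_space"
  assumes p: "path p" "path_image p \<subseteq> S" and le: "0 \<le> a" "a \<le> b" "b \<le> c" "c \<le> 1"
  shows "homotopic_paths S (segment_of a c p) (segment_of a b p +++ segment_of b c p)"
proof -
  have ps: "path (segment_of a c p)" "path_image (segment_of a c p) \<subseteq> S"
    using path_segment_of[OF p(1), of a c] path_image_segment_of[of a c p] p(2) le
    by (auto simp: path_image_def segment_of_def image_subset_iff)
  show ?thesis
  proof (cases "a = c")
    case True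
    then have "a = b" "b = c" using le by auto
    then show ?thesis
      using ps by (intro homotopic_paths_eq) (auto simp: segment_of_def joinpaths_def)
  next
    case False
    \<comment> \<open>\<open>l\<close> is the relative position of \<open>b\<close> in
      \<open>{a..c}\<close>; the join reaches it at time 1/2, and \<open>f\<close> is the piecewise
      linear change of time.\<close>
    define l where "l = (b - a) / (c - a)"
    have l: "0 \<le> l" "l \<le> 1" using le False by (auto simp: l_def field_simps)
    have lc: "l * (c - a) = b - a" using False le by (simp add: l_def)
    define f where "f t = (if t \<le> 1/2 then 2 * t * l else l + (2 * t - 1) * (1 - l))" for t :: real
    have bd: "f t \<in> {0..1}" if t: "t \<in> {0..1}" for t
    proof (cases "t \<le> 1/2")
      case True
      have "2 * t * l \<le> 1" using True t l mult_le_one[of "2 * t" l] by auto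
      then show ?thesis using True t l by (simp add: f_def)
    next
      case False
      have "(2 * t - 1) * (1 - l) \<le> 1 - l" using False t l mult_right_mono[of "2*t-1" 1 "1-l"] by simp
      moreover have "0 \<le> (2 * t - 1) * (1 - l)" using False t l by (intro mult_nonneg_nonneg) auto
      ultimately show ?thesis using False t l by (simp add: f_def)
    qed
    show ?thesis
    proof (rule homotopic_paths_reparametrize[OF ps])
      show "continuous_on {0..1} f"
        unfolding f_def by (rule continuous_on_if_real) (auto intro!: continuous_intros)
      show "f \<in> {0..1} \<rightarrow> {0..1}" using bd by blast
      show "f 0 = 0" "f 1 = 1" by (auto simp: f_def)
      fix t :: real
      have l1: "a + (2 * t * l) * (c - a) = a + 2 * t * (b - a)"
        using lc by (simp add: mult.assoc)
      have l2: "a + (l + (2 * t - 1) * (1 - l)) * (c - a) = b + (2 * t - 1) * (c - b)"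
      proof -
        have "(l + (2 * t - 1) * (1 - l)) * (c - a) = l * (c - a) + (2 * t - 1) * ((c - a) - l * (c - a))"
          by (simp add: algebra_simps)
        also have "\<dots> = (b - a) + (2 * t - 1) * (c - b)" by (simp add: lc)
        finally show ?thesis by simp
      qed
      show "(segment_of a b p +++ segment_of b c p) t = segment_of a c p (f t)"
        by (cases "t \<le> 1/2")
           (simp_all only: segment_of_def joinpaths_def f_def l1 l2 if_True if_False)
    qed
  qed
qed

lemma path_eventually_in:
  fixes p :: "real \<Rightarrow> real"
  assumes "continuous_on {0..1} p" "t \<in> {0..1}" "p t > 0"
  obtains d where "d > 0" "\<And>s. s \<in> {0..1} \<Longrightarrow> \<bar>s - t\<bar> < d \<Longrightarrow> p s > 0"
proof -
  obtain d where "d > 0" "\<And>s. s \<in> {0..1} \<Longrightarrow> dist s t < d \<Longrightarrow> dist (p s) (p t) < p t"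
    using assms unfolding continuous_on_iff by blast
  then show ?thesis using that[of d] by (force simp: dist_real_def)
qed

text \<open>Near any time some coordinate keeps its sign. The vectors of \<open>V\<close> with that
  sign in that coordinate form a convex set avoiding 0, in which the path can be moved to its chord.
  Of the resulting polygon only finitely many planes containing it are recorded, which is all that a
  generic choice needs.\<close>

lemma polygonal_approximation:
  fixes p :: "real \<Rightarrow> 'i \<Rightarrow> real"
  assumes V: "subspace V" and p: "path p" "path_image p \<subseteq> V - {0}"
  shows "\<exists>r T. homotopic_paths (V - {0}) p r \<and> finite T \<and> path_image r \<subseteq> (\<Union>(x, y)\<in>T. span {x, y})"
proof -
  define P where "P a b \<longleftrightarrow> (0 \<le> a \<longrightarrow> b \<le> 1 \<longrightarrow> (\<exists>r T. homotopic_paths (V - {0}) (segment_of a b p) r \<and>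
     finite T \<and> path_image r \<subseteq> (\<Union>(x, y)\<in>T. span {x, y})))" for a b
  have pV: "p t \<in> V" "p t \<noteq> 0" if "t \<in> {0..1}" for t using p(2) that unfolding path_image_def by blast+
  have "P 0 1"
  proof (rule Bolzano)
    fix a b c assume ab: "P a b" and bc: "P b c" and le: "a \<le> b" "b \<le> c"
    show "P a c" unfolding P_def
    proof (intro impI)
      assume *: "0 \<le> a" "c \<le> 1"
      obtain r T where r: "homotopic_paths (V - {0}) (segment_of a b p) r" "finite T"
          "path_image r \<subseteq> (\<Union>(x, y)\<in>T. span {x, y})"
        using ab * le unfolding P_def by force
      obtain r' T' where r': "homotopic_paths (V - {0}) (segment_of b c p) r'" "finite T'"
          "path_image r' \<subseteq> (\<Union>(x, y)\<in>T'. span {x, y})"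
        using bc * le unfolding P_def by force
      have "homotopic_paths (V - {0}) (segment_of a c p) (r +++ r')"
        using homotopic_paths_segment_of_join[OF p *(1) le *(2)]
          homotopic_paths_join[OF r(1) r'(1)] homotopic_paths_trans by fastforce
      moreover have "path_image (r +++ r') \<subseteq> (\<Union>(x, y)\<in>T \<union> T'. span {x, y})"
        using path_image_join_subset[of r r'] r(3) r'(3) by auto
      ultimately show "\<exists>r T. homotopic_paths (V - {0}) (segment_of a c p) r \<and>
          finite T \<and> path_image r \<subseteq> (\<Union>(x, y)\<in>T. span {x, y})"
        using r r' by (meson finite_UnI)
    qed
  next
    fix t0 :: real assume "0 \<le> t0" "t0 \<le> 1"
    then have t0: "t0 \<in> {0..1}" by simp
    obtain i where i: "p t0 i \<noteq> 0" using pV(2)[OF t0] by (auto simp: fun_eq_iff)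
    define \<sigma> where "\<sigma> = sgn (p t0 i)"
    have "continuous_on {0..1} (\<lambda>t. \<sigma> * p t i)"
      using continuous_on_product_then_coordinatewise[OF p(1)[unfolded path_def]] by (intro continuous_intros)
    moreover have "\<sigma> * p t0 i > 0" using i by (auto simp: \<sigma>_def sgn_if)
    ultimately obtain d where d: "d > 0" "\<And>s. s \<in> {0..1} \<Longrightarrow> \<bar>s - t0\<bar> < d \<Longrightarrow> \<sigma> * p s i > 0"
      using path_eventually_in[OF _ t0] by blast
    show "\<exists>d>0. \<forall>a b. a \<le> t0 \<and> t0 \<le> b \<and> b - a < d \<longrightarrow> P a b"
    proof (intro exI[of _ d] conjI d allI impI)
      fix a b assume ab: "a \<le> t0 \<and> t0 \<le> b \<and> b - a < d"
      show "P a b" unfolding P_def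
      proof (intro impI exI[of _ "\<lambda>s. (1 - s) *\<^sub>R p a + s *\<^sub>R p b"] exI[of _ "{(p a, p b)}"] conjI)
        assume *: "0 \<le> a" "b \<le> 1"
        let ?q = "\<lambda>s. (1 - s) *\<^sub>R p a + s *\<^sub>R p b"
        have pos: "\<sigma> * p s i > 0" "s \<in> {0..1}" if "s \<in> {a..b}" for s
          using that ab * d(2)[of s] by auto
        have sm: "segment_of a b p s \<in> V" "\<sigma> * segment_of a b p s i > 0" if "s \<in> {0..1}" for s
          using segment_of_mem[of a b s] that ab * pos pV by (auto simp: segment_of_def)
        have comb: "\<sigma> * ((1 - s) * x + s * y) > 0"
          if "\<sigma> * x > 0" "\<sigma> * y > 0" "s \<in> {0..1}" for s x y
        proof -
          have "(1 - s) * (\<sigma> * x) + s * (\<sigma> * y) > 0"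
            using that by (cases "s = 0") (auto intro!: add_nonneg_pos)
          then show ?thesis by (simp add: algebra_simps)
        qed
        have qm: "?q s \<in> V" "\<sigma> * ?q s i > 0" if "s \<in> {0..1}" for s
          using comb[OF pos(1)[of a] pos(1)[of b] that] ab pV pos(2) V
          by (auto intro!: subspace_add subspace_scale)
        show "homotopic_paths (V - {0}) (segment_of a b p) ?q"
          unfolding homotopic_paths
        proof (intro exI[of _ "\<lambda>z. (1 - fst z) *\<^sub>R segment_of a b p (snd z) + fst z *\<^sub>R ?q (snd z)"] conjI ballI)
          have seg: "path (segment_of a b p)"
            using path_segment_of[OF p(1), of a b] * ab by simp
          show "continuous_on ({0..1} \<times> {0..1})
              (\<lambda>z. (1 - fst z) *\<^sub>R segment_of a b p (snd z) + fst z *\<^sub>R ?q (snd z))"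
            by (intro continuous_on_fun_lincomb continuous_on_path_snd[OF seg] continuous_on_const
                continuous_on_diff continuous_on_fst continuous_on_snd continuous_on_id)
          show "(\<lambda>z. (1 - fst z) *\<^sub>R segment_of a b p (snd z) + fst z *\<^sub>R ?q (snd z)) \<in> {0..1} \<times> {0..1} \<rightarrow> V - {0}"
          proof
            fix z :: "real \<times> real" assume z: "z \<in> {0..1} \<times> {0..1}"
            let ?w = "(1 - fst z) *\<^sub>R segment_of a b p (snd z) + fst z *\<^sub>R ?q (snd z)"
            have "\<sigma> * ?w i > 0"
              using comb[OF sm(2)[of "snd z"] qm(2)[of "snd z"], of "fst z"] z by auto
            then have "?w \<noteq> 0" by (metis zero_fun_apply mult_zero_right less_irrefl)
            moreover have "?w \<in> V"
              using z by (intro subspace_add[OF V subspace_scale[OF V sm(1)] subspace_scale[OF V qm(1)]]) auto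
            ultimately show "?w \<in> V - {0}" by blast
          qed
        qed (auto simp: pathstart_def pathfinish_def simp flip: scaleR_left.add)
        have "?q s \<in> span {p a, p b}" for s by (intro span_add span_scale span_base) auto
        then show "path_image ?q \<subseteq> (\<Union>(x, y)\<in>{(p a, p b)}. span {x, y})"
          by (simp add: path_image_def image_subset_iff)
      qed simp
    qed
  qed simp
  then obtain r T where "homotopic_paths (V - {0}) (segment_of 0 1 p) r" "finite T"
     "path_image r \<subseteq> (\<Union>(x, y)\<in>T. span {x, y})" unfolding P_def by auto
  moreover have "segment_of 0 1 p = p" by (simp add: segment_of_def)
  ultimately show ?thesis by auto
qed

text \<open>\<open>big\<close> expresses dimension at least three in the form used: spans of two
  vectors are proper. So some \<open>e\<close> avoids all planes of both polygons, and a segment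
  from a nonzero point of these planes to \<open>e\<close> cannot meet 0, as \<open>e\<close> would
  then lie in the plane.\<close>

lemma homotopically_trivial_punctured_subspace:
  fixes V :: "('i \<Rightarrow> real) set"
  assumes V: "subspace V" and big: "\<And>x y. \<not> V \<subseteq> span {x, y}"
  shows "homotopically_trivial (V - {0})"
  unfolding homotopically_trivial_def
proof (intro allI impI, elim conjE)
  fix p p' assume p: "path p" "path_image p \<subseteq> V - {0}" "path p'" "path_image p' \<subseteq> V - {0}"
    and ends: "pathstart p = pathstart p'" "pathfinish p = pathfinish p'"
  obtain r T where r: "homotopic_paths (V - {0}) p r" "finite T" "path_image r \<subseteq> (\<Union>(x, y)\<in>T. span {x, y})"
    using polygonal_approximation[OF V p(1,2)] by blast
  obtain r' T' where r': "homotopic_paths (V - {0}) p' r'" "finite T'" "path_image r' \<subseteq> (\<Union>(x, y)\<in>T'. span {x, y})"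
    using polygonal_approximation[OF V p(3,4)] by blast
  have "\<exists>e\<in>V. \<forall>K\<in>(\<lambda>(x, y). span {x, y}) ` (T \<union> T'). e \<notin> K"
    by (rule subspaces_avoidance[OF V]) (use r r' big in auto)
  then obtain e where e: "e \<in> V" "\<And>x y. (x, y) \<in> T \<union> T' \<Longrightarrow> e \<notin> span {x, y}" by fastforce
  have H: "continuous_on ({0..1} \<times> {0..1}) (\<lambda>z. (1 - fst z) *\<^sub>R k (snd z) + fst z *\<^sub>R e)"
      "(\<lambda>z. (1 - fst z) *\<^sub>R k (snd z) + fst z *\<^sub>R e) ` ({0..1} \<times> {0..1}) \<subseteq> V - {0}"
    if k: "path k" "path_image k \<subseteq> V - {0}" "path_image k \<subseteq> (\<Union>(x, y)\<in>T \<union> T'. span {x, y})" for k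
  proof -
    show "continuous_on ({0..1} \<times> {0..1}) (\<lambda>z. (1 - fst z) *\<^sub>R k (snd z) + fst z *\<^sub>R e)"
      by (intro continuous_on_fun_lincomb continuous_on_path_snd[OF k(1)] continuous_on_const
          continuous_on_diff continuous_on_fst continuous_on_id)
    show "(\<lambda>z. (1 - fst z) *\<^sub>R k (snd z) + fst z *\<^sub>R e) ` ({0..1} \<times> {0..1}) \<subseteq> V - {0}"
    proof (rule image_subsetI)
      fix z :: "real \<times> real" assume "z \<in> {0..1} \<times> {0..1}"
      then have z: "fst z \<in> {0..1}" "snd z \<in> {0..1}" by auto
      have kz: "k (snd z) \<in> V" "k (snd z) \<noteq> 0" using k(2) z unfolding path_image_def by blast+
      obtain x y where xy: "(x, y) \<in> T \<union> T'" "k (snd z) \<in> span {x, y}"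
        using k(3) z(2) by (force simp: path_image_def)
      have "(1 - fst z) *\<^sub>R k (snd z) + fst z *\<^sub>R e \<noteq> 0"
      proof
        assume 0: "(1 - fst z) *\<^sub>R k (snd z) + fst z *\<^sub>R e = 0"
        show False
        proof (cases "fst z = 0")
          case True
          then show False using 0 kz by simp
        next
          case False
          have "fst z *\<^sub>R e = - ((1 - fst z) *\<^sub>R k (snd z))" using 0 by (simp add: eq_neg_iff_add_eq_0 add.commute)
          then have "fst z *\<^sub>R e \<in> span {x, y}" using xy by (simp add: span_neg span_scale)
          then have "(1 / fst z) *\<^sub>R (fst z *\<^sub>R e) \<in> span {x, y}" by (rule span_scale)
          then show False using False e(2)[OF xy(1)] by simp
        qed
      qed
      then show "(1 - fst z) *\<^sub>R k (snd z) + fst z *\<^sub>R e \<in> V - {0}"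
        using kz e V by (auto intro!: subspace_add subspace_scale)
    qed
  qed
  have rr: "path r" "path_image r \<subseteq> V - {0}" "path r'" "path_image r' \<subseteq> V - {0}"
    using r r' homotopic_paths_imp_path homotopic_paths_imp_subset by blast+
  have st: "r 0 = r' 0" "r 1 = r' 1"
    using homotopic_paths_imp_pathstart[OF r(1)] homotopic_paths_imp_pathstart[OF r'(1)]
      homotopic_paths_imp_pathfinish[OF r(1)] homotopic_paths_imp_pathfinish[OF r'(1)] ends
    by (auto simp: pathstart_def pathfinish_def)
  have "homotopic_paths (V - {0}) (\<lambda>t. (1 - fst (0::real, t)) *\<^sub>R r (snd (0::real, t)) + fst (0, t) *\<^sub>R e)
     (\<lambda>t. (1 - fst (0::real, t)) *\<^sub>R r' (snd (0::real, t)) + fst (0, t) *\<^sub>R e)"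
    by (rule homotopic_paths_common_contraction[OF H[of r] H[of r']])
       (use rr r(3) r'(3) st in auto)
  then have "homotopic_paths (V - {0}) r r'" by simp
  then show "homotopic_paths (V - {0}) p p'"
    using r(1) r'(1) homotopic_paths_trans homotopic_paths_sym by blast
qed

section \<open>Bivectors and moving frames\<close>

text \<open>Evaluation at \<open>c k\<close> kills all members except \<open>f k\<close>, which
  therefore is not in the span of the others. Explicit families of this kind bound dimensions from
  below.\<close>

lemma independent_dual_family:
  fixes f :: "'k \<Rightarrow> 'i \<Rightarrow> real"
  assumes dual: "\<And>k l. k \<in> K \<Longrightarrow> l \<in> K \<Longrightarrow> f k (c l) = (if k = l then 1 else 0)"
  shows "independent (f ` K)" "inj_on f K"
proof -
  show "independent (f ` K)"
    unfolding dependent_def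
  proof (intro notI, elim bexE)
    fix x assume "x \<in> f ` K" and x: "x \<in> span (f ` K - {x})"
    then obtain k where k: "k \<in> K" "x = f k" by blast
    have "subspace {y::'i \<Rightarrow> real. y (c k) = 0}" by (auto simp: subspace_def)
    moreover have "f ` K - {x} \<subseteq> {y. y (c k) = 0}" using k dual by auto
    ultimately have "x \<in> {y. y (c k) = 0}" using x span_minimal by blast
    then show False using k dual[of k k] by simp
  qed
  show "inj_on f K"
    by (rule inj_onI) (metis dual zero_neq_one)
qed

lemma not_subset_span_of_dual_family:
  fixes f :: "'k \<Rightarrow> 'i \<Rightarrow> real"
  assumes "\<And>k l. k \<in> K \<Longrightarrow> l \<in> K \<Longrightarrow> f k (c l) = (if k = l then 1 else 0)"
    and "f ` K \<subseteq> V" "finite S" "card S < card K"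
  shows "\<not> V \<subseteq> span S"
proof
  assume "V \<subseteq> span S"
  then have "card (f ` K) \<le> card S"
    using independent_span_bound[OF assms(3) independent_dual_family(1)[of K f c, OF assms(1)]] assms(2) by blast
  then show False
    using card_image[OF independent_dual_family(2)[of K f c, OF assms(1)]] assms(4) by simp
qed

section \<open>Coordinate spaces and the wedge product\<close>

definition vecs :: "nat \<Rightarrow> (nat \<Rightarrow> real) set" where
  "vecs n = {x. \<forall>i\<ge>n. x i = 0}"

text \<open>Passing to the topology of the function type makes \<open>path\<close>,
  \<open>continuous_on\<close> and \<open>homotopic_paths\<close> applicable.\<close>

lemma Euclidean_space_vecs: "Euclidean_space n = top_of_set (vecs n)"
  by (simp add: Euclidean_space_def vecs_def euclidean_product_topology)

lemma subspace_vecs: "subspace (vecs n)"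
  by (auto simp: vecs_def subspace_def)

lemmas vecs_intros = subspace_add[OF subspace_vecs] subspace_scale[OF subspace_vecs]
  subspace_diff[OF subspace_vecs] subspace_neg[OF subspace_vecs]

lemma vecs_not_subset_span:
  assumes "finite S" "card S < n"
  shows "\<not> vecs n \<subseteq> span S"
  by (rule not_subset_span_of_dual_family[of "{..<n}" "\<lambda>k i. if k = i then 1 else 0" id])
     (use assms in \<open>auto simp: vecs_def\<close>)

text \<open>The full antisymmetric matrix is kept, not just the entries with \<open>i < j\<close>,
  so that each row is a vector of the plane of \<open>u\<close> and \<open>v\<close>.\<close>

definition wedge :: "('i \<Rightarrow> real) \<Rightarrow> ('i \<Rightarrow> real) \<Rightarrow> 'i \<times> 'i \<Rightarrow> real" where
  "wedge u v = (\<lambda>(i, j). u i * v j - u j * v i)"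

definition bivector_row :: "'i \<Rightarrow> ('i \<times> 'i \<Rightarrow> real) \<Rightarrow> 'i \<Rightarrow> real" where
  "bivector_row i w = (\<lambda>k. w (i, k))"

lemma wedge_apply [simp]: "wedge u v (i, j) = u i * v j - u j * v i"
  by (simp add: wedge_def)

lemma row_apply [simp]: "bivector_row i w k = w (i, k)"
  by (simp add: bivector_row_def)

lemma wedge_lincomb:
  "wedge (a *\<^sub>R u + b *\<^sub>R v) (c *\<^sub>R u + d *\<^sub>R v) = (a * d - b * c) *\<^sub>R wedge u v"
  by (auto simp: fun_eq_iff algebra_simps)

lemma wedge_scaleR: "wedge (a *\<^sub>R u) v = a *\<^sub>R wedge u v" "wedge u (a *\<^sub>R v) = a *\<^sub>R wedge u v"
  by (auto simp: fun_eq_iff algebra_simps)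

lemma wedge_self [simp]: "wedge u u = 0"
  by (auto simp: fun_eq_iff)

lemma wedge_0 [simp]: "wedge 0 v = 0" "wedge u 0 = 0"
  by (auto simp: fun_eq_iff)

lemma wedge_eq_0D:
  assumes "wedge u v = 0" "u \<noteq> 0"
  shows "\<exists>c. v = c *\<^sub>R u"
proof -
  obtain i where i: "u i \<noteq> 0" using assms(2) by (auto simp: fun_eq_iff)
  have "u i * v j = u j * v i" for j using fun_cong[OF assms(1), of "(i, j)"] by simp
  then have "v = (v i / u i) *\<^sub>R u" using i by (auto simp: fun_eq_iff field_simps)
  then show ?thesis by blast
qed

lemma wedge_nonzero_iff: "wedge u v \<noteq> 0 \<longleftrightarrow> u \<noteq> v \<and> independent {u, v}"
proof -
  have "independent {u, v} \<longleftrightarrow> v \<noteq> 0 \<and> (\<forall>k. u \<noteq> k *\<^sub>R v)" if "u \<noteq> v"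
    using that by (auto simp: independent_insert span_singleton)
  moreover have "wedge u v = 0 \<longleftrightarrow> v = 0 \<or> (\<exists>k. u = k *\<^sub>R v)"
  proof (cases "v = 0")
    case False
    have "wedge v u = - wedge u v" by (auto simp: fun_eq_iff)
    then have "\<exists>k. u = k *\<^sub>R v" if "wedge u v = 0"
      using wedge_eq_0D[of v u] that False by simp
    then show ?thesis by (auto simp: wedge_scaleR)
  qed simp
  moreover have "u = v \<Longrightarrow> wedge u v = 0" by simp
  ultimately show ?thesis by metis
qed

lemma row_wedge: "bivector_row i (wedge u v) = u i *\<^sub>R v - v i *\<^sub>R u"
  by (auto simp: fun_eq_iff)

text \<open>A form of the Pluecker relations. Where the entry at \<open>(i, j)\<close> is nonzero,
  rows \<open>i\<close> and \<open>j\<close> are a frame of the plane depending continuously on the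
  bivector; all local arguments about the cone rest on this.\<close>

lemma wedge_rows: "wedge (bivector_row i (wedge u v)) (bivector_row j (wedge u v)) = wedge u v (i, j) *\<^sub>R wedge u v"
  by (auto simp: fun_eq_iff algebra_simps)

text \<open>Cramer's rule: the factors are recovered from two rows.\<close>

lemma wedge_factors:
  "wedge u v (i, j) *\<^sub>R u = u j *\<^sub>R bivector_row i (wedge u v) - u i *\<^sub>R bivector_row j (wedge u v)"
  "wedge u v (i, j) *\<^sub>R v = v j *\<^sub>R bivector_row i (wedge u v) - v i *\<^sub>R bivector_row j (wedge u v)"
  by (auto simp: fun_eq_iff algebra_simps)

definition decomposables :: "nat \<Rightarrow> (nat \<times> nat \<Rightarrow> real) set" where
  "decomposables n = {wedge u v | u v. u \<in> vecs n \<and> v \<in> vecs n} - {0}"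

lemma decomposables_scaleR: "w \<in> decomposables n \<Longrightarrow> c \<noteq> 0 \<Longrightarrow> c *\<^sub>R w \<in> decomposables n"
  unfolding decomposables_def
  by (safe, metis wedge_scaleR(1) vecs_intros(2), simp)

lemma row_in_vecs: "w \<in> decomposables n \<Longrightarrow> bivector_row i w \<in> vecs n"
  by (auto simp: decomposables_def vecs_def)

lemma decomposables_diag: "w \<in> decomposables n \<Longrightarrow> w (i, i) = 0"
  by (auto simp: decomposables_def)

lemma decomposables_swap: "w \<in> decomposables n \<Longrightarrow> w (j, i) = - w (i, j)"
  by (auto simp: decomposables_def)

lemma decomposables_rows:
  assumes "w \<in> decomposables n" shows "wedge (bivector_row i w) (bivector_row j w) = w (i, j) *\<^sub>R w"
  using assms wedge_rows by (auto simp: decomposables_def)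

text \<open>The rows of proportional bivectors are proportional, so Cramer's rule writes
  \<open>u'\<close> through rows that are combinations of \<open>u\<close> and
  \<open>v\<close>.\<close>

lemma same_plane:
  assumes eq: "wedge u' v' = c *\<^sub>R wedge u v" and nz: "wedge u' v' \<noteq> 0"
  obtains a b where "u' = a *\<^sub>R u + b *\<^sub>R v"
proof -
  obtain i j where ij: "wedge u' v' (i, j) \<noteq> 0" using nz by (auto simp: fun_eq_iff)
  let ?l = "wedge u' v' (i, j)"
  have r: "bivector_row k (wedge u' v') = (c * u k) *\<^sub>R v - (c * v k) *\<^sub>R u" for k
    unfolding eq by (auto simp: fun_eq_iff algebra_simps)
  have "u' = (1 / ?l) *\<^sub>R (?l *\<^sub>R u')" using ij by simp
  also have "\<dots> = (1 / ?l) *\<^sub>R (u' j *\<^sub>R ((c * u i) *\<^sub>R v - (c * v i) *\<^sub>R u) - u' i *\<^sub>R ((c * u j) *\<^sub>R v - (c * v j) *\<^sub>R u))"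
    by (simp only: wedge_factors(1) r)
  also have "\<dots> = ((u' i * (c * v j) - u' j * (c * v i)) / ?l) *\<^sub>R u + ((u' j * (c * u i) - u' i * (c * u j)) / ?l) *\<^sub>R v"
    by (simp add: fun_eq_iff diff_divide_distrib algebra_simps)
  finally show ?thesis using that by blast
qed

lemma same_plane2:
  assumes eq: "wedge u' v' = c *\<^sub>R wedge u v" and nz: "wedge u' v' \<noteq> 0"
  obtains a b a' b' where "u' = a *\<^sub>R u + b *\<^sub>R v" "v' = a' *\<^sub>R u + b' *\<^sub>R v" "a * b' - b * a' = c"
proof -
  have "wedge v' u' = - wedge u' v'" by (auto simp: fun_eq_iff)
  then have eq': "wedge v' u' = (- c) *\<^sub>R wedge u v" "wedge v' u' \<noteq> 0" using eq nz by auto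
  obtain a b where 1: "u' = a *\<^sub>R u + b *\<^sub>R v" using same_plane[OF assms] .
  obtain a' b' where 2: "v' = a' *\<^sub>R u + b' *\<^sub>R v" using same_plane[OF eq'] .
  have "(a * b' - b * a') *\<^sub>R wedge u v = c *\<^sub>R wedge u v"
    using eq unfolding 1 2 wedge_lincomb .
  moreover have "wedge u v \<noteq> 0" using eq nz by auto
  ultimately have "a * b' - b * a' = c" by simp
  then show ?thesis using that 1 2 by blast
qed

text \<open>The frame moves in finitely many pencils: at any time \<open>v\<close> is confined to a plane and \<open>u\<close>
  to a 3-space containing it.\<close>

definition pencil_path ::
  "nat \<Rightarrow> (nat \<times> nat \<Rightarrow> real) set \<Rightarrow> ((nat \<Rightarrow> real) \<times> (nat \<Rightarrow> real) \<times> (nat \<Rightarrow> real)) set \<Rightarrow>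
   (real \<Rightarrow> nat \<Rightarrow> real) \<Rightarrow> (real \<Rightarrow> nat \<Rightarrow> real) \<Rightarrow> bool" where
  "pencil_path n U T f g \<longleftrightarrow> path f \<and> path g \<and> finite T \<and>
     (\<forall>t\<in>{0..1}. f t \<in> vecs n \<and> g t \<in> vecs n \<and> wedge (f t) (g t) \<in> U \<and>
        (\<exists>(x, y, z)\<in>T. g t \<in> span {x, y} \<and> f t \<in> span {x, y, z}))"

lemma pencil_path_join:
  assumes f: "pencil_path n U T f g" and f': "pencil_path n U T' f' g'"
    and "f 1 = f' 0" "g 1 = g' 0"
  shows "pencil_path n U (T \<union> T') (f +++ f') (g +++ g')"
proof -
  have paths: "path (f +++ f')" "path (g +++ g')"
    using assms by (auto simp: pencil_path_def pathstart_def pathfinish_def)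
  have "(f +++ f') t \<in> vecs n \<and> (g +++ g') t \<in> vecs n \<and> wedge ((f +++ f') t) ((g +++ g') t) \<in> U \<and>
        (\<exists>(x, y, z)\<in>T \<union> T'. (g +++ g') t \<in> span {x, y} \<and> (f +++ f') t \<in> span {x, y, z})"
    if t: "t \<in> {0..1}" for t
  proof (cases "t \<le> 1/2")
    case True
    then have "2 * t \<in> {0..1}" using t by auto
    then show ?thesis using f True unfolding pencil_path_def joinpaths_def by (fastforce simp: Bex_def)
  next
    case False
    then have "2 * t - 1 \<in> {0..1}" using t by auto
    then show ?thesis using f' False unfolding pencil_path_def joinpaths_def by (fastforce simp: Bex_def)
  qed
  then show ?thesis using paths f f' by (simp add: pencil_path_def)
qed

section \<open>Moving frames by elementary steps\<close>

definition reachable ::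
  "nat \<Rightarrow> (nat \<times> nat \<Rightarrow> real) set \<Rightarrow> (nat \<Rightarrow> real) \<Rightarrow> (nat \<Rightarrow> real) \<Rightarrow> (nat \<Rightarrow> real) \<Rightarrow> (nat \<Rightarrow> real) \<Rightarrow> bool" where
  "reachable n U u v u' v' \<longleftrightarrow>
     (\<exists>T f g. pencil_path n U T f g \<and> f 0 = u \<and> g 0 = v \<and> f 1 = u' \<and> g 1 = v')"

lemma reachable_trans:
  assumes "reachable n U u v u' v'" "reachable n U u' v' u'' v''"
  shows "reachable n U u v u'' v''"
proof -
  obtain T f g where 1: "pencil_path n U T f g" "f 0 = u" "g 0 = v" "f 1 = u'" "g 1 = v'"
    using assms(1) by (auto simp: reachable_def)
  obtain T' f' g' where 2: "pencil_path n U T' f' g'" "f' 0 = u'" "g' 0 = v'" "f' 1 = u''" "g' 1 = v''"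
    using assms(2) by (auto simp: reachable_def)
  have "pencil_path n U (T \<union> T') (f +++ f') (g +++ g')"
    using pencil_path_join[OF 1(1) 2(1)] 1 2 by simp
  moreover have "(f +++ f') 0 = u" "(g +++ g') 0 = v" "(f +++ f') 1 = u''" "(g +++ g') 1 = v''"
    using 1 2 by (auto simp: joinpaths_def)
  ultimately show ?thesis unfolding reachable_def by blast
qed

lemma path_line: "path (\<lambda>s. (1 - s) *\<^sub>R (x::'i \<Rightarrow> real) + s *\<^sub>R y)"
  unfolding path_def by (intro continuous_on_fun_lincomb continuous_intros)

lemma reachable_move_first:
  assumes "u \<in> vecs n" "u' \<in> vecs n" "v \<in> vecs n"
    and "\<And>s. s \<in> {0..1} \<Longrightarrow> wedge ((1 - s) *\<^sub>R u + s *\<^sub>R u') v \<in> U"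
  shows "reachable n U u v u' v"
proof -
  \<comment> \<open>The order in the triple matters: the resting second vector \<open>v\<close> has
    to lie in the span of the first two entries.\<close>
  have "pencil_path n U {(v, u, u')} (\<lambda>s. (1 - s) *\<^sub>R u + s *\<^sub>R u') (\<lambda>_. v)"
    unfolding pencil_path_def
    by (intro conjI ballI path_line vecs_intros assms)
       (auto simp: path_def span_base intro!: span_add[OF span_scale span_scale])
  then show ?thesis unfolding reachable_def
    by (intro exI[of _ "{(v, u, u')}"] exI[of _ "\<lambda>s. (1 - s) *\<^sub>R u + s *\<^sub>R u'"] exI[of _ "\<lambda>_. v"]) simp
qed

lemma reachable_move_second:
  assumes "u \<in> vecs n" "v \<in> vecs n" "v' \<in> vecs n"
    and "\<And>s. s \<in> {0..1} \<Longrightarrow> wedge u ((1 - s) *\<^sub>R v + s *\<^sub>R v') \<in> U"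
  shows "reachable n U u v u v'"
proof -
  have "pencil_path n U {(v, v', u)} (\<lambda>_. u) (\<lambda>s. (1 - s) *\<^sub>R v + s *\<^sub>R v')"
    unfolding pencil_path_def
    by (intro conjI ballI path_line vecs_intros assms)
       (auto simp: path_def span_base intro!: span_add[OF span_scale span_scale])
  then show ?thesis unfolding reachable_def
    by (intro exI[of _ "{(v, v', u)}"] exI[of _ "\<lambda>_. u"] exI[of _ "\<lambda>s. (1 - s) *\<^sub>R v + s *\<^sub>R v'"]) simp
qed

text \<open>A rotation by a right angle is a product of three shears, \<open>(u, v)\<close> to
  \<open>(u + v, v)\<close> to \<open>(u + v, - u)\<close> to \<open>(v, - u)\<close>, and shears do
  not change the wedge.\<close>

lemma reachable_quarter_turn:
  assumes uv: "u \<in> vecs n" "v \<in> vecs n" and U: "wedge u v \<in> U"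
  shows "reachable n U u v v (- u)"
proof -
  have 1: "reachable n U u v (u + v) v"
  proof (rule reachable_move_first)
    fix s :: real
    have "wedge ((1 - s) *\<^sub>R u + s *\<^sub>R (u + v)) v = wedge u v" by (auto simp: fun_eq_iff algebra_simps)
    then show "wedge ((1 - s) *\<^sub>R u + s *\<^sub>R (u + v)) v \<in> U" using U by simp
  qed (intro vecs_intros uv)+
  have 2: "reachable n U (u + v) v (u + v) (- u)"
  proof (rule reachable_move_second)
    fix s :: real
    have "wedge (u + v) ((1 - s) *\<^sub>R v + s *\<^sub>R - u) = wedge u v" by (auto simp: fun_eq_iff algebra_simps)
    then show "wedge (u + v) ((1 - s) *\<^sub>R v + s *\<^sub>R - u) \<in> U" using U by simp
  qed (intro vecs_intros uv)+
  have 3: "reachable n U (u + v) (- u) v (- u)"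
  proof (rule reachable_move_first)
    fix s :: real
    have "wedge ((1 - s) *\<^sub>R (u + v) + s *\<^sub>R v) (- u) = wedge u v" by (auto simp: fun_eq_iff algebra_simps)
    then show "wedge ((1 - s) *\<^sub>R (u + v) + s *\<^sub>R v) (- u) \<in> U" using U by simp
  qed (intro vecs_intros uv)+
  show ?thesis using 1 2 3 reachable_trans by blast
qed

text \<open>Replacing \<open>u\<close> first and \<open>v\<close> afterwards moves the factor of
  \<open>wedge u v\<close> linearly from 1 to \<open>a\<close>, then from \<open>a\<close> to the
  determinant; it stays positive.\<close>

lemma reachable_same_plane_pos:
  assumes uv: "u \<in> vecs n" "v \<in> vecs n" and U: "\<And>c. c > 0 \<Longrightarrow> c *\<^sub>R wedge u v \<in> U"
    and det: "a * d - b * c > 0" and a: "a > 0"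
  shows "reachable n U u v (a *\<^sub>R u + b *\<^sub>R v) (c *\<^sub>R u + d *\<^sub>R v)"
proof -
  have pos: "(1 - s) * x + s * y > 0" if "x > 0" "y > 0" "s \<in> {0..1}" for s x y :: real
    using that by (cases "s = 0") (auto intro!: add_nonneg_pos)
  have 1: "reachable n U u v (a *\<^sub>R u + b *\<^sub>R v) v"
  proof (rule reachable_move_first)
    fix s :: real assume "s \<in> {0..1}"
    moreover have "wedge ((1 - s) *\<^sub>R u + s *\<^sub>R (a *\<^sub>R u + b *\<^sub>R v)) v = ((1 - s) * 1 + s * a) *\<^sub>R wedge u v"
      by (auto simp: fun_eq_iff algebra_simps)
    ultimately show "wedge ((1 - s) *\<^sub>R u + s *\<^sub>R (a *\<^sub>R u + b *\<^sub>R v)) v \<in> U"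
      using U pos[of 1 a s] a by simp
  qed (intro vecs_intros uv)+
  have 2: "reachable n U (a *\<^sub>R u + b *\<^sub>R v) v (a *\<^sub>R u + b *\<^sub>R v) (c *\<^sub>R u + d *\<^sub>R v)"
  proof (rule reachable_move_second)
    fix s :: real assume "s \<in> {0..1}"
    moreover have "wedge (a *\<^sub>R u + b *\<^sub>R v) ((1 - s) *\<^sub>R v + s *\<^sub>R (c *\<^sub>R u + d *\<^sub>R v)) =
        ((1 - s) * a + s * (a * d - b * c)) *\<^sub>R wedge u v"
      by (auto simp: fun_eq_iff algebra_simps)
    ultimately show "wedge (a *\<^sub>R u + b *\<^sub>R v) ((1 - s) *\<^sub>R v + s *\<^sub>R (c *\<^sub>R u + d *\<^sub>R v)) \<in> U"
      using U pos[OF a det] by simp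
  qed (intro vecs_intros uv)+
  show ?thesis using 1 2 reachable_trans by blast
qed

text \<open>Relative to the frames obtained by quarter turns, the leading coefficient
  \<open>a\<close> becomes \<open>b\<close>, \<open>- a\<close> or \<open>- b\<close>. As the
  determinant is positive, \<open>a\<close> and \<open>b\<close> are not both 0, so one of the four
  frames has a positive leading coefficient.\<close>

lemma reachable_same_plane:
  assumes uv: "u \<in> vecs n" "v \<in> vecs n" and U: "\<And>c. c > 0 \<Longrightarrow> c *\<^sub>R wedge u v \<in> U"
    and det: "a * d - b * c > 0"
  shows "reachable n U u v (a *\<^sub>R u + b *\<^sub>R v) (c *\<^sub>R u + d *\<^sub>R v)"
proof -
  have w: "wedge v (- u) = wedge u v" "wedge (- u) (- v) = wedge u v" "wedge (- v) u = wedge u v"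
    by (auto simp: fun_eq_iff)
  have mem: "- u \<in> vecs n" "- v \<in> vecs n" using uv by (auto intro: vecs_intros)
  have U1: "wedge u v \<in> U" using U[of 1] by simp
  have r1: "reachable n U u v v (- u)" by (rule reachable_quarter_turn[OF uv U1])
  have r2: "reachable n U u v (- u) (- v)"
    using reachable_trans[OF r1 reachable_quarter_turn[OF uv(2) mem(1)]] U1 w by simp
  have r3: "reachable n U u v (- v) u"
    using reachable_trans[OF r2 reachable_quarter_turn[OF mem]] U1 w by simp
  consider "a > 0" | "a < 0" | "a = 0" "b > 0" | "a = 0" "b < 0" using det by force
  then show ?thesis
  proof cases
    case 1
    show ?thesis by (rule reachable_same_plane_pos[OF uv U det 1])
  next
    case 2
    have "reachable n U (- u) (- v) ((- a) *\<^sub>R - u + (- b) *\<^sub>R - v) ((- c) *\<^sub>R - u + (- d) *\<^sub>R - v)"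
      by (rule reachable_same_plane_pos) (use mem U w det 2 in auto)
    then show ?thesis using reachable_trans[OF r2] by simp
  next
    case 3
    have "reachable n U v (- u) (b *\<^sub>R v + (- a) *\<^sub>R - u) (d *\<^sub>R v + (- c) *\<^sub>R - u)"
      by (rule reachable_same_plane_pos) (use mem uv U w det 3 in auto)
    then show ?thesis using reachable_trans[OF r1] by (simp add: add.commute)
  next
    case 4
    have "reachable n U (- v) u ((- b) *\<^sub>R - v + a *\<^sub>R u) ((- d) *\<^sub>R - v + c *\<^sub>R u)"
      by (rule reachable_same_plane_pos) (use mem uv U w det 4 in auto)
    then show ?thesis using reachable_trans[OF r3] by (simp add: add.commute)
  qed
qed

lemma reachable_same_wedge:
  assumes uv: "u \<in> vecs n" "v \<in> vecs n" and eq: "wedge u v = wedge u' v'"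
    and U: "\<And>c. c > 0 \<Longrightarrow> c *\<^sub>R wedge u v \<in> U" and nz: "wedge u v \<noteq> 0"
  shows "reachable n U u v u' v'"
proof -
  have e: "wedge u' v' = 1 *\<^sub>R wedge u v" "wedge u' v' \<noteq> 0" using eq nz by auto
  obtain a b a' b' where "u' = a *\<^sub>R u + b *\<^sub>R v" "v' = a' *\<^sub>R u + b' *\<^sub>R v" "a * b' - b * a' = 1"
    using same_plane2[OF e] .
  then show ?thesis using reachable_same_plane[OF uv U, of a b' b a'] by simp
qed

section \<open>The cone of decomposable bivectors\<close>

lemma continuous_on_wedge:
  assumes "continuous_on S f" "continuous_on S g"
  shows "continuous_on S (\<lambda>x. wedge (f x) (g x))"
proof (rule continuous_on_coordinatewise_then_product)
  fix ij
  show "continuous_on S (\<lambda>x. wedge (f x) (g x) ij)"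
    by (cases ij; simp only: wedge_apply)
       (intro continuous_intros assms[THEN continuous_on_product_then_coordinatewise])
qed

lemma continuous_on_row:
  assumes "continuous_on S f"
  shows "continuous_on S (\<lambda>x. bivector_row i (f x))"
  by (rule continuous_on_coordinatewise_then_product, simp only: row_apply)
     (rule continuous_on_product_then_coordinatewise[OF assms])

definition chart :: "nat \<Rightarrow> real \<Rightarrow> nat \<Rightarrow> nat \<Rightarrow> (nat \<times> nat \<Rightarrow> real) set" where
  "chart n \<sigma> i j = {w \<in> decomposables n. \<sigma> * w (i, j) > 0}"

lemma convex_comb_pos:
  fixes x y :: real
  assumes "\<sigma> * x > 0" "\<sigma> * y > 0" "s \<in> {0..1}"
  shows "\<sigma> * ((1 - s) * x + s * y) > 0"
proof -
  have "(1 - s) * (\<sigma> * x) + s * (\<sigma> * y) > 0"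
    using assms by (cases "s = 0") (auto intro!: add_nonneg_pos)
  then show ?thesis by (simp add: algebra_simps)
qed

lemma chartI:
  assumes "u \<in> vecs n" "v \<in> vecs n" "\<sigma> * wedge u v (i, j) > 0"
  shows "wedge u v \<in> chart n \<sigma> i j"
proof -
  have "wedge u v \<noteq> 0" using assms(3) by (metis zero_fun_apply mult_zero_right less_irrefl)
  then show ?thesis using assms by (auto simp: chart_def decomposables_def)
qed

text \<open>In the coordinates given by two rows, a chart is convex.\<close>

lemma homotopic_paths_chart:
  assumes p: "path p" "path_image p \<subseteq> chart n \<sigma> i j" and r: "path r" "path_image r \<subseteq> chart n \<sigma> i j"
    and ends: "pathstart p = pathstart r" "pathfinish p = pathfinish r"
  shows "homotopic_paths (decomposables n) p r"
proof -
  have pc: "p t \<in> decomposables n" "\<sigma> * p t (i, j) > 0"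
    and rc: "r t \<in> decomposables n" "\<sigma> * r t (i, j) > 0" if "t \<in> {0..1}" for t
    using p(2) r(2) that by (auto simp: path_image_def chart_def image_subset_iff)
  \<comment> \<open>Two rows and their common entry are interpolated linearly. The entry of
    \<open>wedge (A i z) (A j z)\<close> at \<open>(i, j)\<close> is the square of
    \<open>l z\<close>, so the wedge is nonzero; division by \<open>l z\<close> makes the formula
    return \<open>p\<close> and \<open>r\<close> at the ends.\<close>
  define A where "A k z = (1 - fst z) *\<^sub>R bivector_row k (p (snd z)) + fst z *\<^sub>R bivector_row k (r (snd z))"
    for k and z :: "real \<times> real"
  define l where "l z = (1 - fst z) * p (snd z) (i, j) + fst z * r (snd z) (i, j)" for z :: "real \<times> real"
  let ?h = "\<lambda>z. (1 / l z) *\<^sub>R wedge (A i z) (A j z)"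
  have lpos: "\<sigma> * l z > 0" if "z \<in> {0..1} \<times> {0..1}" for z
    using convex_comb_pos[of \<sigma> "p (snd z) (i, j)" "r (snd z) (i, j)" "fst z"] pc(2) rc(2) that
    by (auto simp: l_def)
  have lnz: "l z \<noteq> 0" if "z \<in> {0..1} \<times> {0..1}" for z using lpos[OF that] by auto
  have h1: "(1 / w (i, j)) *\<^sub>R wedge (bivector_row i w) (bivector_row j w) = w"
    if "w \<in> decomposables n" "\<sigma> * w (i, j) > 0" for w
    using that decomposables_rows[OF that(1), of i j] by auto
  have hends: "?h (s, t) = p t" if "p t = r t" "s \<in> {0..1}" "t \<in> {0..1}" for s t
  proof -
    have "A k (s, t) = bivector_row k (p t)" for k
      using that(1) by (auto simp: A_def fun_eq_iff algebra_simps)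
    moreover have "l (s, t) = p t (i, j)" using that(1) by (simp add: l_def algebra_simps)
    ultimately show ?thesis using h1 pc[OF that(3)] by simp
  qed
  show ?thesis
    unfolding homotopic_paths
  proof (intro exI[of _ ?h] conjI ballI)
    have pr: "continuous_on ({0..1} \<times> {0..1}) (\<lambda>z. bivector_row k (p (snd z)))"
      "continuous_on ({0..1} \<times> {0..1}) (\<lambda>z. bivector_row k (r (snd z)))" for k
      by (intro continuous_on_row continuous_on_path_snd p r)+
    have "continuous_on ({0..1} \<times> {0..1}) (A k)" for k
      unfolding A_def
      by (intro continuous_on_fun_lincomb pr continuous_on_const continuous_on_diff continuous_on_fst continuous_on_id)
    moreover have "continuous_on ({0..1} \<times> {0..1}) l"
      unfolding l_def
      by (intro continuous_on_add continuous_on_mult continuous_on_const continuous_on_diff continuous_on_fst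
          continuous_on_id continuous_on_path_snd[OF p(1), THEN continuous_on_product_then_coordinatewise]
          continuous_on_path_snd[OF r(1), THEN continuous_on_product_then_coordinatewise])
    ultimately show "continuous_on ({0..1} \<times> {0..1}) ?h"
      by (intro continuous_on_fun_scaleR continuous_on_wedge continuous_on_divide continuous_on_const)
         (use lnz in auto)
    show "?h \<in> {0..1} \<times> {0..1} \<rightarrow> decomposables n"
    proof
      fix z :: "real \<times> real" assume z: "z \<in> {0..1} \<times> {0..1}"
      then have z': "fst z \<in> {0..1}" "snd z \<in> {0..1}" by auto
      have "A k z \<in> vecs n" for k
        unfolding A_def by (intro vecs_intros row_in_vecs pc rc z')
      then have "wedge (A i z) (A j z) \<in> chart n 1 i j"
      proof (intro chartI)
        have "A i z i = 0" "A i z j = l z" "A j z i = - l z"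
          using decomposables_diag[of "p (snd z)" n i] decomposables_diag[of "r (snd z)" n i]
            decomposables_swap[of "p (snd z)" n j i] decomposables_swap[of "r (snd z)" n j i] pc rc z'
          by (auto simp: A_def l_def)
        then show "1 * wedge (A i z) (A j z) (i, j) > 0" using lnz[OF z] by (auto simp: zero_less_mult_iff neq_iff)
      qed
      then have "wedge (A i z) (A j z) \<in> decomposables n" by (simp add: chart_def)
      then show "?h z \<in> decomposables n" using lnz[OF z] decomposables_scaleR by simp
    qed
    fix x :: real assume x: "x \<in> {0..1}"
    show "?h (0, x) = p x" "?h (1, x) = r x"
      using h1 pc[OF x] rc[OF x] by (auto simp: A_def l_def)
    show "pathstart (?h \<circ> Pair x) = pathstart p" "pathfinish (?h \<circ> Pair x) = pathfinish p"
      using hends[of 0 x] hends[of 1 x] ends x by (auto simp: pathstart_def pathfinish_def)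
  qed
qed

section \<open>Lifting paths of bivectors to paths of frames\<close>

lemma pencil_path_imp_path:
  "pencil_path n U T f g \<Longrightarrow> path (\<lambda>t. wedge (f t) (g t))"
  "pencil_path n U T f g \<Longrightarrow> path_image (\<lambda>t. wedge (f t) (g t)) \<subseteq> U"
  by (auto simp: pencil_path_def path_def path_image_def intro: continuous_on_wedge)

lemma pencil_path_mono: "pencil_path n U T f g \<Longrightarrow> U \<subseteq> U' \<Longrightarrow> pencil_path n U' T f g"
  unfolding pencil_path_def by blast

lemma chart_scaleR: "w \<in> chart n \<sigma> i j \<Longrightarrow> c > 0 \<Longrightarrow> c *\<^sub>R w \<in> chart n \<sigma> i j"
  using decomposables_scaleR by (auto simp: chart_def zero_less_mult_iff mult_less_0_iff)

lemma reachable_in_chart: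
  assumes uv: "u \<in> vecs n" "v \<in> vecs n" "wedge u v \<in> chart n \<sigma> i j"
    and uv': "u' \<in> vecs n" "v' \<in> vecs n" "wedge u' v' \<in> chart n \<sigma> i j"
  shows "reachable n (chart n \<sigma> i j) u v u' v'"
proof -
  let ?U = "chart n \<sigma> i j"
  define w w' where "w = wedge u v" and "w' = wedge u' v'"
  have w: "w \<in> decomposables n" "w \<noteq> 0" "\<sigma> * w (i, j) > 0" and w': "w' \<in> decomposables n" "w' \<noteq> 0" "\<sigma> * w' (i, j) > 0"
    using uv uv' by (auto simp: chart_def w_def w'_def decomposables_def)
  \<comment> \<open>Normal form in the chart: \<open>a\<close> has entries 0 and
    \<open>w (i, j)\<close> at \<open>i\<close> and \<open>j\<close>, while \<open>b\<close> has -1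
    and 0. Interpolating \<open>a\<close> thus interpolates the entry of the wedge at
    \<open>(i, j)\<close>, and interpolating \<open>b\<close> leaves it unchanged.\<close>
  define a b a' b' where "a = bivector_row i w" and "b = (1 / w (i, j)) *\<^sub>R bivector_row j w"
    and "a' = bivector_row i w'" and "b' = (1 / w' (i, j)) *\<^sub>R bivector_row j w'"
  have nz: "w (i, j) \<noteq> 0" "w' (i, j) \<noteq> 0" using w w' by auto
  have mem: "a \<in> vecs n" "b \<in> vecs n" "a' \<in> vecs n" "b' \<in> vecs n"
    unfolding a_def b_def a'_def b'_def by (intro vecs_intros row_in_vecs w w')+
  have ab: "wedge a b = w" "wedge a' b' = w'"
    using decomposables_rows[OF w(1), of i j] decomposables_rows[OF w'(1), of i j] nz
    by (simp_all add: a_def b_def a'_def b'_def wedge_scaleR)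
  have ent: "a i = 0" "a j = w (i, j)" "b i = - 1" "b j = 0"
      "a' i = 0" "a' j = w' (i, j)" "b' i = - 1" "b' j = 0"
    using decomposables_diag[OF w(1)] decomposables_diag[OF w'(1)] nz
      decomposables_swap[OF w(1), of j i] decomposables_swap[OF w'(1), of j i]
    by (auto simp: a_def b_def a'_def b'_def)
  have 1: "reachable n ?U u v a b"
    by (rule reachable_same_wedge) (use uv w ab chart_scaleR in \<open>auto simp: w_def\<close>)
  have 4: "reachable n ?U a' b' u' v'"
    by (rule reachable_same_wedge) (use mem uv' w' ab chart_scaleR in \<open>auto simp: w'_def\<close>)
  have 2: "reachable n ?U a b a' b"
  proof (rule reachable_move_first[OF mem(1,3,2)], rule chartI)
    fix s :: real assume "s \<in> {0..1}"
    then show "\<sigma> * wedge ((1 - s) *\<^sub>R a + s *\<^sub>R a') b (i, j) > 0"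
      using convex_comb_pos[OF w(3) w'(3)] by (simp add: ent add.commute)
  qed (intro vecs_intros mem)+
  have 3: "reachable n ?U a' b a' b'"
  proof (rule reachable_move_second[OF mem(3,2,4)], rule chartI)
    fix s :: real assume "s \<in> {0..1}"
    show "\<sigma> * wedge a' ((1 - s) *\<^sub>R b + s *\<^sub>R b') (i, j) > 0"
      using w'(3) by (simp add: ent algebra_simps)
  qed (intro vecs_intros mem)+
  show ?thesis using 1 2 3 4 reachable_trans by blast
qed

text \<open>Both end frames are prescribed, so that two paths with equal endpoints receive lifts
  with equal end frames, whose contractions then agree along the sides. Within one chart any two
  frames are joined, and the wedge of the joining path is homotopic to the given path.\<close>

lemma frame_lifting:
  assumes p: "path p" "path_image p \<subseteq> decomposables n"
    and uv: "u \<in> vecs n" "v \<in> vecs n" "wedge u v = p 0"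
    and uv': "u' \<in> vecs n" "v' \<in> vecs n" "wedge u' v' = p 1"
  obtains T f g where "pencil_path n (decomposables n) T f g" "f 0 = u" "g 0 = v" "f 1 = u'" "g 1 = v'"
    "homotopic_paths (decomposables n) p (\<lambda>t. wedge (f t) (g t))"
proof -
  let ?D = "decomposables n"
  define P where "P a b \<longleftrightarrow> (0 \<le> a \<longrightarrow> b \<le> 1 \<longrightarrow> (\<forall>u\<in>vecs n. \<forall>v\<in>vecs n. \<forall>u'\<in>vecs n. \<forall>v'\<in>vecs n.
     wedge u v = p a \<longrightarrow> wedge u' v' = p b \<longrightarrow>
     (\<exists>T f g. pencil_path n ?D T f g \<and> f 0 = u \<and> g 0 = v \<and> f 1 = u' \<and> g 1 = v' \<and>
        homotopic_paths ?D (segment_of a b p) (\<lambda>t. wedge (f t) (g t)))))" for a b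
  have pD: "p t \<in> ?D" if "t \<in> {0..1}" for t using p(2) that unfolding path_image_def by blast
  have "P 0 1"
  proof (rule Bolzano)
    fix a b c assume ab: "P a b" and bc: "P b c" and le: "a \<le> b" "b \<le> c"
    show "P a c" unfolding P_def
    proof (intro impI ballI)
      fix u v u' v' assume *: "0 \<le> a" "c \<le> 1" and uv: "u \<in> vecs n" "v \<in> vecs n" "wedge u v = p a"
        and uv': "u' \<in> vecs n" "v' \<in> vecs n" "wedge u' v' = p c"
      have "p b \<in> ?D" using pD[of b] * le by auto
      then obtain x y where xy: "x \<in> vecs n" "y \<in> vecs n" "wedge x y = p b" by (auto simp: decomposables_def)
      obtain T f g where f: "pencil_path n ?D T f g" "f 0 = u" "g 0 = v" "f 1 = x" "g 1 = y"
          "homotopic_paths ?D (segment_of a b p) (\<lambda>t. wedge (f t) (g t))"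
        using ab[unfolded P_def, rule_format, of u v x y] * le uv xy by auto
      obtain T' f' g' where f': "pencil_path n ?D T' f' g'" "f' 0 = x" "g' 0 = y" "f' 1 = u'" "g' 1 = v'"
          "homotopic_paths ?D (segment_of b c p) (\<lambda>t. wedge (f' t) (g' t))"
        using bc[unfolded P_def, rule_format, of x y u' v'] * le uv' xy by auto
      have "homotopic_paths ?D (segment_of a c p) ((\<lambda>t. wedge (f t) (g t)) +++ (\<lambda>t. wedge (f' t) (g' t)))"
        using homotopic_paths_segment_of_join[OF p *(1) le *(2)]
          homotopic_paths_join[OF f(6) f'(6)] homotopic_paths_trans by fastforce
      moreover have "(\<lambda>t. wedge (f t) (g t)) +++ (\<lambda>t. wedge (f' t) (g' t)) =
          (\<lambda>t. wedge ((f +++ f') t) ((g +++ g') t))" by (auto simp: joinpaths_def fun_eq_iff)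
      moreover have "pencil_path n ?D (T \<union> T') (f +++ f') (g +++ g')"
        using pencil_path_join[OF f(1) f'(1)] f f' by simp
      moreover have "(f +++ f') 0 = u" "(g +++ g') 0 = v" "(f +++ f') 1 = u'" "(g +++ g') 1 = v'"
        using f f' by (auto simp: joinpaths_def)
      ultimately show "\<exists>T f g. pencil_path n ?D T f g \<and> f 0 = u \<and> g 0 = v \<and> f 1 = u' \<and> g 1 = v' \<and>
        homotopic_paths ?D (segment_of a c p) (\<lambda>t. wedge (f t) (g t))"
        by metis
    qed
  next
    fix t0 :: real assume "0 \<le> t0" "t0 \<le> 1"
    then have t0: "t0 \<in> {0..1}" by simp
    have "p t0 \<noteq> 0" using pD[OF t0] by (simp add: decomposables_def)
    then obtain i j where i: "p t0 (i, j) \<noteq> 0" by (auto simp: fun_eq_iff)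
    define \<sigma> where "\<sigma> = sgn (p t0 (i, j))"
    have "continuous_on {0..1} (\<lambda>t. \<sigma> * p t (i, j))"
      using continuous_on_product_then_coordinatewise[OF p(1)[unfolded path_def]] by (intro continuous_intros)
    moreover have "\<sigma> * p t0 (i, j) > 0" using i by (auto simp: \<sigma>_def sgn_if)
    ultimately obtain d where d: "d > 0" "\<And>s. s \<in> {0..1} \<Longrightarrow> \<bar>s - t0\<bar> < d \<Longrightarrow> \<sigma> * p s (i, j) > 0"
      using path_eventually_in[OF _ t0] by blast
    show "\<exists>d>0. \<forall>a b. a \<le> t0 \<and> t0 \<le> b \<and> b - a < d \<longrightarrow> P a b"
    proof (intro exI[of _ d] conjI d allI impI)
      fix a b assume ab: "a \<le> t0 \<and> t0 \<le> b \<and> b - a < d"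
      show "P a b" unfolding P_def
      proof (intro impI ballI)
        fix u v u' v' assume *: "0 \<le> a" "b \<le> 1" and uv: "u \<in> vecs n" "v \<in> vecs n" "wedge u v = p a"
          and uv': "u' \<in> vecs n" "v' \<in> vecs n" "wedge u' v' = p b"
        have pc: "p s \<in> chart n \<sigma> i j" if "s \<in> {a..b}" for s
          using that ab * d(2)[of s] pD[of s] by (auto simp: chart_def)
        have "reachable n (chart n \<sigma> i j) u v u' v'"
          by (rule reachable_in_chart) (use uv uv' pc ab in auto)
        then obtain T f g where f: "pencil_path n (chart n \<sigma> i j) T f g" "f 0 = u" "g 0 = v" "f 1 = u'" "g 1 = v'"
          by (auto simp: reachable_def)
        have "homotopic_paths ?D (segment_of a b p) (\<lambda>t. wedge (f t) (g t))"
        proof (rule homotopic_paths_chart)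
          show "path (segment_of a b p)" using path_segment_of[OF p(1)] * ab by auto
          show "path_image (segment_of a b p) \<subseteq> chart n \<sigma> i j"
          proof (rule order_trans[OF path_image_segment_of])
            show "p ` {a..b} \<subseteq> chart n \<sigma> i j" using pc by blast
          qed (use * ab in auto)
        qed (use pencil_path_imp_path[OF f(1)] f uv uv' in \<open>auto simp: pathstart_def pathfinish_def\<close>)
        moreover have "pencil_path n ?D T f g"
          by (rule pencil_path_mono[OF f(1)]) (auto simp: chart_def)
        ultimately show "\<exists>T f g. pencil_path n ?D T f g \<and> f 0 = u \<and> g 0 = v \<and> f 1 = u' \<and> g 1 = v' \<and>
            homotopic_paths ?D (segment_of a b p) (\<lambda>t. wedge (f t) (g t))"
          using f by blast
      qed
    qed
  qed simp
  from this[unfolded P_def, rule_format, of u v u' v'] obtain T f g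
    where "pencil_path n ?D T f g" "f 0 = u" "g 0 = v" "f 1 = u'" "g 1 = v'"
      "homotopic_paths ?D (segment_of 0 1 p) (\<lambda>t. wedge (f t) (g t))" using uv uv' by auto
  moreover have "segment_of 0 1 p = p" by (simp add: segment_of_def)
  ultimately show ?thesis using that by metis
qed

text \<open>In the first half of the time \<open>f\<close> is moved to \<open>e\<close> with
  \<open>g\<close> at rest, in the second half \<open>g\<close> is moved to \<open>e'\<close>.
  Independence then fails only if \<open>e\<close> lies in the span containing \<open>f\<close> and
  \<open>g\<close>, or \<open>e'\<close> in the span of \<open>e\<close> and the plane containing
  \<open>g\<close>: three generators each time, which makes dimension four enough.\<close>

definition frame_contraction ::
  "(nat \<Rightarrow> real) \<Rightarrow> (nat \<Rightarrow> real) \<Rightarrow> (real \<Rightarrow> nat \<Rightarrow> real) \<Rightarrow> (real \<Rightarrow> nat \<Rightarrow> real) \<Rightarrow>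
   real \<times> real \<Rightarrow> nat \<times> nat \<Rightarrow> real" where
  "frame_contraction e e' f g z =
     (let a = min 1 (2 * fst z); b = max 0 (2 * fst z - 1)
      in wedge ((1 - a) *\<^sub>R f (snd z) + a *\<^sub>R e) ((1 - b) *\<^sub>R g (snd z) + b *\<^sub>R e'))"

lemma frame_contraction_nonzero:
  fixes u v :: "nat \<Rightarrow> real"
  assumes w: "wedge u v \<noteq> 0" and u: "u \<in> span {x, y, z}" and v: "v \<in> span {x, y}"
    and e: "e \<notin> span {x, y, z}" and e': "e' \<notin> span {e, x, y}" and ab: "b = 0 \<or> a = 1"
  shows "wedge ((1 - a) *\<^sub>R u + a *\<^sub>R e) ((1 - b) *\<^sub>R v + b *\<^sub>R e') \<noteq> 0"
proof
  assume 0: "wedge ((1 - a) *\<^sub>R u + a *\<^sub>R e) ((1 - b) *\<^sub>R v + b *\<^sub>R e') = 0"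
  have solve: "x \<in> K" if "subspace K" "d *\<^sub>R x \<in> K" "d \<noteq> 0" for d K and x :: "nat \<Rightarrow> real"
    using subspace_scale[OF that(1,2), of "1 / d"] that(3) by simp
  have vnz: "v \<noteq> 0" using w by auto
  have v3: "v \<in> span {x, y, z}" using v span_mono[of "{x, y}" "{x, y, z}"] by blast
  consider "b = 0" "a = 0" | "b = 0" "a \<noteq> 0" | "b \<noteq> 0" "a = 1" using ab by blast
  then show False
  proof cases
    case 1
    then show False using 0 w by simp
  next
    case 2
    have "wedge v ((1 - a) *\<^sub>R u + a *\<^sub>R e) = - wedge ((1 - a) *\<^sub>R u + a *\<^sub>R e) v"
      by (auto simp: fun_eq_iff)
    then have "wedge v ((1 - a) *\<^sub>R u + a *\<^sub>R e) = 0" using 0 2 by simp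
    then obtain c where "(1 - a) *\<^sub>R u + a *\<^sub>R e = c *\<^sub>R v" using wedge_eq_0D vnz by blast
    then have "a *\<^sub>R e = c *\<^sub>R v - (1 - a) *\<^sub>R u" by (simp add: algebra_simps)
    also have "\<dots> \<in> span {x, y, z}" by (intro span_diff span_scale u v3)
    finally have "a *\<^sub>R e \<in> span {x, y, z}" .
    from solve[OF subspace_span this 2(2)] show False using e by simp
  next
    case 3
    have "e \<noteq> 0" using e by (metis span_zero)
    moreover have "wedge e ((1 - b) *\<^sub>R v + b *\<^sub>R e') = 0" using 0 3 by simp
    ultimately obtain c where "(1 - b) *\<^sub>R v + b *\<^sub>R e' = c *\<^sub>R e" using wedge_eq_0D by blast
    then have "b *\<^sub>R e' = c *\<^sub>R e - (1 - b) *\<^sub>R v" by (simp add: algebra_simps)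
    also have "\<dots> \<in> span {e, x, y}"
      using v span_mono[of "{x, y}" "{e, x, y}"] by (intro span_diff span_scale) (auto simp: span_base)
    finally have "b *\<^sub>R e' \<in> span {e, x, y}" .
    from solve[OF subspace_span this 3(1)] show False using e' by simp
  qed
qed

lemma homotopically_trivial_decomposables:
  assumes n: "n \<ge> 4"
  shows "homotopically_trivial (decomposables n)"
  unfolding homotopically_trivial_def
proof (intro allI impI, elim conjE)
  let ?D = "decomposables n"
  fix p p' assume p: "path p" "path_image p \<subseteq> ?D" "path p'" "path_image p' \<subseteq> ?D"
    and ends: "pathstart p = pathstart p'" "pathfinish p = pathfinish p'"
  have "p 0 \<in> ?D" "p 1 \<in> ?D" using p(2) by (auto simp: path_image_def image_subset_iff)
  then obtain u v u' v' where uv: "u \<in> vecs n" "v \<in> vecs n" "wedge u v = p 0"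
    and uv': "u' \<in> vecs n" "v' \<in> vecs n" "wedge u' v' = p 1" by (auto simp: decomposables_def)
  have ends': "wedge u v = p' 0" "wedge u' v' = p' 1"
    using ends uv uv' by (simp_all add: pathstart_def pathfinish_def)
  obtain T f g where f: "pencil_path n ?D T f g" "f 0 = u" "g 0 = v" "f 1 = u'" "g 1 = v'"
    "homotopic_paths ?D p (\<lambda>t. wedge (f t) (g t))"
    using frame_lifting[OF p(1,2) uv uv'] .
  obtain T' f' g' where f': "pencil_path n ?D T' f' g'" "f' 0 = u" "g' 0 = v" "f' 1 = u'" "g' 1 = v'"
    "homotopic_paths ?D p' (\<lambda>t. wedge (f' t) (g' t))"
    using frame_lifting[OF p(3,4) uv(1,2) ends'(1) uv'(1,2) ends'(2)] .
  have finT: "finite (T \<union> T')" using f(1) f'(1) by (auto simp: pencil_path_def)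
  \<comment> \<open>Here \<open>n \<ge> 4\<close> enters: spans of three vectors are proper.\<close>
  have small: "\<not> vecs n \<subseteq> span {x, y, z}" for x y z
  proof (rule vecs_not_subset_span)
    have "card {x, y, z} \<le> 3" by (simp add: card_insert_if)
    then show "card {x, y, z} < n" using n by simp
  qed simp
  have "\<exists>e\<in>vecs n. \<forall>K\<in>(\<lambda>(x, y, z). span {x, y, z}) ` (T \<union> T'). e \<notin> K"
    by (rule subspaces_avoidance[OF subspace_vecs]) (use finT small in auto)
  then obtain e where e: "e \<in> vecs n" "\<And>x y z. (x, y, z) \<in> T \<union> T' \<Longrightarrow> e \<notin> span {x, y, z}" by fastforce
  \<comment> \<open>\<open>e'\<close> is chosen after \<open>e\<close>, because the subspaces it
    must avoid contain \<open>e\<close>.\<close>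
  have "\<exists>e'\<in>vecs n. \<forall>K\<in>(\<lambda>(x, y, z). span {e, x, y}) ` (T \<union> T'). e' \<notin> K"
    by (rule subspaces_avoidance[OF subspace_vecs]) (use finT small in auto)
  then obtain e' where e': "e' \<in> vecs n" "\<And>x y z. (x, y, z) \<in> T \<union> T' \<Longrightarrow> e' \<notin> span {e, x, y}" by fastforce
  have H: "continuous_on ({0..1} \<times> {0..1}) (frame_contraction e e' f g)"
      "frame_contraction e e' f g ` ({0..1} \<times> {0..1}) \<subseteq> ?D"
    if f: "pencil_path n ?D S f g" "S \<subseteq> T \<union> T'" for S f g
  proof -
    have fg: "path f" "path g" using f by (auto simp: pencil_path_def)
    show "continuous_on ({0..1} \<times> {0..1}) (frame_contraction e e' f g)"
      unfolding frame_contraction_def Let_def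
      by (intro continuous_on_wedge continuous_on_fun_lincomb continuous_on_path_snd fg continuous_on_const
          continuous_on_diff continuous_on_min continuous_on_max continuous_on_mult continuous_on_fst continuous_on_id)
    show "frame_contraction e e' f g ` ({0..1} \<times> {0..1}) \<subseteq> ?D"
    proof (rule image_subsetI)
      fix z :: "real \<times> real" assume "z \<in> {0..1} \<times> {0..1}"
      then have z: "fst z \<in> {0..1}" "snd z \<in> {0..1}" by auto
      define a b where "a = min 1 (2 * fst z)" and "b = max 0 (2 * fst z - 1)"
      have ab: "b = 0 \<or> a = 1" by (auto simp: a_def b_def)
      have fz: "f (snd z) \<in> vecs n" "g (snd z) \<in> vecs n" "wedge (f (snd z)) (g (snd z)) \<noteq> 0"
        using f(1) z(2) by (auto simp: pencil_path_def decomposables_def)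
      obtain x y k where xyk: "(x, y, k) \<in> S" "g (snd z) \<in> span {x, y}" "f (snd z) \<in> span {x, y, k}"
        using f(1) z(2) unfolding pencil_path_def by force
      have "(x, y, k) \<in> T \<union> T'" using xyk(1) f(2) by blast
      then have "wedge ((1 - a) *\<^sub>R f (snd z) + a *\<^sub>R e) ((1 - b) *\<^sub>R g (snd z) + b *\<^sub>R e') \<noteq> 0"
        using frame_contraction_nonzero[OF fz(3) xyk(3,2) e(2) e'(2) ab] by blast
      moreover have "(1 - a) *\<^sub>R f (snd z) + a *\<^sub>R e \<in> vecs n" "(1 - b) *\<^sub>R g (snd z) + b *\<^sub>R e' \<in> vecs n"
        by (intro vecs_intros fz e e')+
      ultimately show "frame_contraction e e' f g z \<in> ?D"
        unfolding frame_contraction_def Let_def a_def[symmetric] b_def[symmetric] decomposables_def by blast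
    qed
  qed
  have "homotopic_paths ?D (\<lambda>t. frame_contraction e e' f g (0, t)) (\<lambda>t. frame_contraction e e' f' g' (0, t))"
    \<comment> \<open>The sides agree because the contraction at either endpoint depends only on the
      common end frame, and both contractions finish at the constant
      \<open>wedge e e'\<close>.\<close>
    by (rule homotopic_paths_common_contraction[OF H[OF f(1)] H[OF f'(1)]])
       (use f f' in \<open>auto simp: frame_contraction_def\<close>)
  then have "homotopic_paths ?D (\<lambda>t. wedge (f t) (g t)) (\<lambda>t. wedge (f' t) (g' t))"
    by (simp add: frame_contraction_def)
  then show "homotopic_paths ?D p p'"
    using f(6) f'(6) homotopic_paths_trans homotopic_paths_sym by blast
qed

section \<open>Dimension three and reversal of orientation\<close>

definition bivectors3 :: "(nat \<times> nat \<Rightarrow> real) set" where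
  "bivectors3 = {w. (\<forall>i j. w (i, j) = - w (j, i)) \<and> (\<forall>i j. i \<ge> 3 \<or> j \<ge> 3 \<longrightarrow> w (i, j) = 0)}"

lemma decomposables_3: "decomposables 3 = bivectors3 - {0}"
proof
  show "decomposables 3 \<subseteq> bivectors3 - {0}"
    by (auto simp: decomposables_def bivectors3_def vecs_def)
  show "bivectors3 - {0} \<subseteq> decomposables 3"
  proof
    fix w assume w: "w \<in> bivectors3 - {0}"
    then obtain i j where ij: "w (i, j) \<noteq> 0" by (auto simp: fun_eq_iff)
    have anti: "w (k, l) = - w (l, k)" and big: "k \<ge> 3 \<or> l \<ge> 3 \<Longrightarrow> w (k, l) = 0" for k l
      using w unfolding bivectors3_def by blast+
    have diag: "w (k, k) = 0" for k using anti[of k k] by linarith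
    have "wedge (bivector_row i w) (bivector_row j w) (k, l) = w (i, j) * w (k, l)" for k l
    proof (cases "k \<ge> 3 \<or> l \<ge> 3")
      case True
      then show ?thesis using big[of k l] big[of i k] big[of i l] big[of j k] big[of j l] by auto
    next
      case False
      moreover have "i < 3" "j < 3" using big[of i j] ij by (auto simp: not_less[symmetric])
      \<comment> \<open>Four indices out of three values repeat, so antisymmetry alone settles the
        Pluecker relation.\<close>
      ultimately have "i \<in> {0, 1, 2}" "j \<in> {0, 1, 2}" "k \<in> {0, 1, 2}" "l \<in> {0, 1, 2}" by auto
      then show ?thesis
        using anti[of 0 1] anti[of 0 2] anti[of 1 2] diag by (auto simp: algebra_simps)
    qed
    then have "wedge (bivector_row i w) (bivector_row j w) = w (i, j) *\<^sub>R w" by (auto simp: fun_eq_iff)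
    then have "w = wedge ((1 / w (i, j)) *\<^sub>R bivector_row i w) (bivector_row j w)" using ij by (simp add: wedge_scaleR)
    moreover have "(1 / w (i, j)) *\<^sub>R bivector_row i w \<in> vecs 3" "bivector_row j w \<in> vecs 3"
      using big by (auto simp: vecs_def)
    ultimately show "w \<in> decomposables 3" using w unfolding decomposables_def by blast
  qed
qed

lemma homotopically_trivial_decomposables_3: "homotopically_trivial (decomposables 3)"
  unfolding decomposables_3
proof (rule homotopically_trivial_punctured_subspace)
  show "subspace bivectors3"
  proof -
    have anti: "w (i, j) = - w (j, i)" if "w \<in> bivectors3" for w i j
      using that unfolding bivectors3_def by blast
    have zero: "w (i, j) = 0" if "w \<in> bivectors3" "i \<ge> 3 \<or> j \<ge> 3" for w i j
      using that unfolding bivectors3_def by blast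
    have mem: "w \<in> bivectors3" if "\<And>i j. w (i, j) = - w (j, i)" "\<And>i j. i \<ge> 3 \<or> j \<ge> 3 \<Longrightarrow> w (i, j) = 0" for w
      using that unfolding bivectors3_def by blast
    show ?thesis
    proof (rule subspaceI)
      show "0 \<in> bivectors3" by (rule mem) simp_all
      show "x + y \<in> bivectors3" if "x \<in> bivectors3" "y \<in> bivectors3" for x y
      proof (rule mem)
        show "(x + y) (i, j) = - (x + y) (j, i)" for i j
          using anti[OF that(1), of i j] anti[OF that(2), of i j] by simp
      qed (simp add: zero that)
      show "c *\<^sub>R x \<in> bivectors3" if "x \<in> bivectors3" for c x
      proof (rule mem)
        show "(c *\<^sub>R x) (i, j) = - (c *\<^sub>R x) (j, i)" for i j
          using anti[OF that, of i j] by simp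
      qed (simp add: zero that)
    qed
  qed
  define K :: "(nat \<times> nat) set" where "K = {(0, 1), (0, 2), (1, 2)}"
  \<comment> \<open>The elementary bivectors, dual to the three entries above the diagonal; three
    exceeds the two generators of a plane.\<close>
  define f :: "nat \<times> nat \<Rightarrow> nat \<times> nat \<Rightarrow> real" where
    "f = (\<lambda>k l. if k = l then 1 else if k = (snd l, fst l) then - 1 else 0)"
  show "\<not> bivectors3 \<subseteq> span {x, y}" for x y
  proof (rule not_subset_span_of_dual_family[of K f id])
    show "card {x, y} < card K" by (simp add: K_def card_insert_if)
    have "f k (i, j) = - f k (j, i)" if "k \<in> K" for k i j
    proof -
      have "k = (i, j) \<Longrightarrow> k \<noteq> (j, i)" using that by (auto simp: K_def)
      then show ?thesis by (simp add: f_def)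
    qed
    moreover have "f k (i, j) = 0" if "k \<in> K" "i \<ge> 3 \<or> j \<ge> 3" for k i j
    proof -
      have "fst k < 3" "snd k < 3" using that(1) by (auto simp: K_def)
      then have "k \<noteq> (i, j)" "k \<noteq> (j, i)" using that(2) by (auto simp: not_less[symmetric])
      then show ?thesis by (simp add: f_def)
    qed
    ultimately show "f ` K \<subseteq> bivectors3" unfolding bivectors3_def by blast
  qed (auto simp: K_def f_def)
qed

text \<open>With \<open>u\<close> fixed, \<open>v\<close> makes a half turn through a vector
  \<open>e\<close> outside the plane, which exists from dimension three on. In dimension two the
  cone is a punctured line and no such path exists.\<close>

lemma decomposables_flip:
  assumes n: "n \<ge> 3" and w: "w \<in> decomposables n"
  shows "\<exists>g. path g \<and> path_image g \<subseteq> decomposables n \<and> pathstart g = w \<and> pathfinish g = - w"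
proof -
  obtain u v where uv: "u \<in> vecs n" "v \<in> vecs n" "w = wedge u v" "wedge u v \<noteq> 0"
    using w by (auto simp: decomposables_def)
  have "\<not> vecs n \<subseteq> span {u, v}"
  proof (rule vecs_not_subset_span)
    have "card {u, v} \<le> 2" by (simp add: card_insert_if)
    then show "card {u, v} < n" using n by simp
  qed simp
  then obtain e where e: "e \<in> vecs n" "e \<notin> span {u, v}" by blast
  let ?v = "\<lambda>t::real. cos (pi * t) *\<^sub>R v + sin (pi * t) *\<^sub>R e"
  have nz: "wedge u (?v t) \<noteq> 0" for t
  proof
    assume 0: "wedge u (?v t) = 0"
    have "u \<noteq> 0" using uv(4) by auto
    then obtain c where c: "?v t = c *\<^sub>R u" using wedge_eq_0D[OF 0] by blast
    show False
    proof (cases "sin (pi * t) = 0")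
      case True
      then have "cos (pi * t) \<noteq> 0" using sin_zero_abs_cos_one by fastforce
      moreover have "cos (pi * t) *\<^sub>R wedge u v = 0" using 0 True by (simp add: wedge_scaleR)
      ultimately show False using uv(4) by simp
    next
      case False
      have "sin (pi * t) *\<^sub>R e = c *\<^sub>R u - cos (pi * t) *\<^sub>R v" using c by (simp add: algebra_simps)
      also have "\<dots> \<in> span {u, v}" by (intro span_diff span_scale) (auto simp: span_base)
      finally have "(1 / sin (pi * t)) *\<^sub>R (sin (pi * t) *\<^sub>R e) \<in> span {u, v}" by (rule span_scale)
      then show False using e(2) False by simp
    qed
  qed
  show ?thesis
  proof (intro exI[of _ "\<lambda>t. wedge u (?v t)"] conjI)
    show "path (\<lambda>t. wedge u (?v t))"
      unfolding path_def by (intro continuous_on_wedge continuous_on_fun_lincomb continuous_on_const continuous_intros)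
    have "?v t \<in> vecs n" for t by (intro vecs_intros uv e)
    then show "path_image (\<lambda>t. wedge u (?v t)) \<subseteq> decomposables n"
      using uv nz by (auto simp: path_image_def decomposables_def)
    show "pathstart (\<lambda>t. wedge u (?v t)) = w" "pathfinish (\<lambda>t. wedge u (?v t)) = - w"
      using uv by (auto simp: pathstart_def pathfinish_def fun_eq_iff)
  qed
qed

section \<open>The Grassmannian as a space of lines\<close>

definition plane_of :: "(nat \<times> nat \<Rightarrow> real) \<Rightarrow> (nat \<Rightarrow> real) set" where
  "plane_of w = span (range (\<lambda>i. bivector_row i w))"

lemma row_wedge_in_span: "bivector_row i (wedge u v) \<in> span {u, v}"
  unfolding row_wedge by (intro span_diff span_scale span_base) simp_all

lemma plane_of_rows:
  assumes "wedge u v (i, j) \<noteq> 0"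
  shows "span {bivector_row i (wedge u v), bivector_row j (wedge u v)} = span {u, v}"
proof (rule span_subspace)
  show "{bivector_row i (wedge u v), bivector_row j (wedge u v)} \<subseteq> span {u, v}"
    by (simp add: row_wedge_in_span)
  have *: "x \<in> K" if "subspace K" "d *\<^sub>R x \<in> K" "d \<noteq> 0" for d K and x :: "'a \<Rightarrow> real"
    using subspace_scale[OF that(1,2), of "1 / d"] that(3) by simp
  have "wedge u v (i, j) *\<^sub>R u \<in> span {bivector_row i (wedge u v), bivector_row j (wedge u v)}"
    "wedge u v (i, j) *\<^sub>R v \<in> span {bivector_row i (wedge u v), bivector_row j (wedge u v)}"
    unfolding wedge_factors by (intro span_diff span_scale span_base; simp)+
  then have "{u, v} \<subseteq> span {bivector_row i (wedge u v), bivector_row j (wedge u v)}"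
    using *[OF subspace_span _ assms] by blast
  then show "span {u, v} \<subseteq> span {bivector_row i (wedge u v), bivector_row j (wedge u v)}"
    by (rule span_minimal) simp
qed simp

lemma plane_of_wedge:
  fixes u v :: "nat \<Rightarrow> real"
  assumes "wedge u v \<noteq> 0"
  shows "plane_of (wedge u v) = span {u, v}"
proof -
  obtain i j where ij: "wedge u v (i, j) \<noteq> 0" using assms by (auto simp: fun_eq_iff)
  show ?thesis
    unfolding plane_of_def
  proof (rule span_subspace)
    show "range (\<lambda>i. bivector_row i (wedge u v)) \<subseteq> span {u, v}"
      by (intro image_subsetI row_wedge_in_span)
    show "span {u, v} \<subseteq> span (range (\<lambda>i. bivector_row i (wedge u v)))"
      unfolding plane_of_rows[OF ij, symmetric] by (rule span_mono) auto
  qed simp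
qed

lemma in_span_pair: "x \<in> span {u, v} \<longleftrightarrow> (\<exists>a b. x = a *\<^sub>R u + b *\<^sub>R v)" for x :: "'a \<Rightarrow> real"
  by (auto simp: span_insert span_singleton algebra_simps)

lemma plane_of_eq_iff:
  assumes w: "w \<in> decomposables n" "w' \<in> decomposables n"
  shows "plane_of w = plane_of w' \<longleftrightarrow> (\<exists>c. c \<noteq> 0 \<and> w' = c *\<^sub>R w)"
proof
  obtain u v u' v' where uv: "w = wedge u v" "wedge u v \<noteq> 0" "w' = wedge u' v'" "wedge u' v' \<noteq> 0"
    using w by (auto simp: decomposables_def)
  assume "plane_of w = plane_of w'"
  then have "u' \<in> span {u, v}" "v' \<in> span {u, v}" using uv by (auto simp: plane_of_wedge span_base)
  then obtain a b c d where "u' = a *\<^sub>R u + b *\<^sub>R v" "v' = c *\<^sub>R u + d *\<^sub>R v" by (auto simp: in_span_pair)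
  then have "w' = (a * d - b * c) *\<^sub>R w" using uv by (simp add: wedge_lincomb)
  moreover from this have "a * d - b * c \<noteq> 0" using uv by auto
  ultimately show "\<exists>c. c \<noteq> 0 \<and> w' = c *\<^sub>R w" by blast
next
  assume "\<exists>c. c \<noteq> 0 \<and> w' = c *\<^sub>R w"
  then obtain c where c: "c \<noteq> 0" "w' = c *\<^sub>R w" by blast
  have eq: "bivector_row i w' = c *\<^sub>R bivector_row i w" "bivector_row i w = (1 / c) *\<^sub>R bivector_row i w'" for i using c by (auto simp: fun_eq_iff)
  show "plane_of w = plane_of w'"
    unfolding plane_of_def
  proof (rule span_eq[THEN iffD2], intro conjI image_subsetI)
    fix i
    show "bivector_row i w \<in> span (range (\<lambda>i. bivector_row i w'))" by (subst eq(2)) (auto intro: span_scale span_base)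
    show "bivector_row i w' \<in> span (range (\<lambda>i. bivector_row i w))" by (subst eq(1)) (auto intro: span_scale span_base)
  qed
qed

definition frames :: "nat \<Rightarrow> ((nat \<Rightarrow> real) \<times> (nat \<Rightarrow> real)) topology" where
  "frames n = subtopology (prod_topology (Euclidean_space n) (Euclidean_space n))
     {(u, v). u \<noteq> v \<and> independent {u, v}}"

lemma frames_eq: "frames n = top_of_set {(u, v). u \<in> vecs n \<and> v \<in> vecs n \<and> wedge u v \<noteq> 0}"
proof -
  have "frames n = top_of_set ((vecs n \<times> vecs n) \<inter> {(u, v). u \<noteq> v \<and> independent {u, v}})"
    by (simp add: frames_def Euclidean_space_vecs subtopology_subtopology)
  also have "(vecs n \<times> vecs n) \<inter> {(u, v). u \<noteq> v \<and> independent {u, v}} =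
      {(u, v). u \<in> vecs n \<and> v \<in> vecs n \<and> wedge u v \<noteq> 0}"
    by (auto simp: wedge_nonzero_iff)
  finally show ?thesis .
qed

text \<open>The quotient map from frames factors through the wedge, so continuity of
  \<open>plane_of\<close> is what remains. On the open set where \<open>w (i, j)\<close> is nonzero,
  rows \<open>i\<close> and \<open>j\<close> give a continuous frame of the plane of
  \<open>w\<close>; these sets cover the cone.\<close>

lemma quotient_map_plane_of: "quotient_map (top_of_set (decomposables n)) (Gr2 n) plane_of"
proof (rule quotient_map_from_composition)
  let ?q = "\<lambda>(u, v). span {u, v} :: (nat \<Rightarrow> real) set"
  have q: "quotient_map (frames n) (Gr2 n) ?q"
    unfolding Gr2_def frames_def by (rule quotient_map_quotient_topology)
  show "continuous_map (frames n) (top_of_set (decomposables n)) (\<lambda>(u, v). wedge u v)"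
    unfolding frames_eq
    by (auto simp: case_prod_unfold decomposables_def intro!: continuous_on_wedge continuous_on_fst continuous_on_snd continuous_on_id)
  show "quotient_map (frames n) (Gr2 n) (plane_of \<circ> (\<lambda>(u, v). wedge u v))"
    by (rule quotient_map_eq[OF q]) (auto simp: frames_eq plane_of_wedge)
  let ?T = "\<lambda>(i, j). {w \<in> decomposables n. w (i, j) \<noteq> 0}"
  show "continuous_map (top_of_set (decomposables n)) (Gr2 n) plane_of"
  proof (rule pasting_lemma[of UNIV _ ?T _ "\<lambda>_. plane_of"])
    fix k :: "nat \<times> nat"
    obtain i j where k: "k = (i, j)" by force
    have "open {w :: nat \<times> nat \<Rightarrow> real. w (i, j) \<noteq> 0}"
      by (intro open_Collect_neq continuous_on_const
          continuous_on_product_then_coordinatewise[OF continuous_on_id])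
    then have "openin (top_of_set (decomposables n)) (decomposables n \<inter> {w. w (i, j) \<noteq> 0})"
      by (rule openin_open_Int)
    moreover have "decomposables n \<inter> {w. w (i, j) \<noteq> 0} = ?T k" by (auto simp: k)
    ultimately show "openin (top_of_set (decomposables n)) (?T k)" by simp
    have sub: "subtopology (top_of_set (decomposables n)) (?T k) = top_of_set (?T k)"
      by (auto simp: k subtopology_subtopology intro!: arg_cong[of _ _ top_of_set])
    have "continuous_map (top_of_set (?T k)) (frames n) (\<lambda>w. (bivector_row i w, bivector_row j w))"
      unfolding frames_eq
      by (auto simp: k decomposables_rows row_in_vecs intro!: continuous_on_Pair continuous_on_row continuous_on_id)
    from continuous_map_compose[OF this quotient_imp_continuous_map[OF q]]
    have "continuous_map (top_of_set (?T k)) (Gr2 n) (?q \<circ> (\<lambda>w. (bivector_row i w, bivector_row j w)))" .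
    then show "continuous_map (subtopology (top_of_set (decomposables n)) (?T k)) (Gr2 n) plane_of"
      unfolding sub
    proof (rule continuous_map_eq)
      fix w assume "w \<in> topspace (top_of_set (?T k))"
      then obtain u v where uv: "w = wedge u v" "wedge u v \<noteq> 0" "wedge u v (i, j) \<noteq> 0"
        by (auto simp: k decomposables_def)
      then show "(?q \<circ> (\<lambda>w. (bivector_row i w, bivector_row j w))) w = plane_of w"
        by (simp add: plane_of_rows plane_of_wedge)
    qed
  next
    fix w assume "w \<in> topspace (top_of_set (decomposables n))"
    then have "w \<noteq> 0" "w \<in> decomposables n" by (auto simp: decomposables_def)
    then show "\<exists>j. j \<in> UNIV \<and> w \<in> ?T j \<and> plane_of w = plane_of w" by (auto simp: fun_eq_iff)
  qed simp
qed

lemma projective_cone_Gr2: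
  "projective_cone (decomposables n) (Gr2 n) plane_of ({..<n} \<times> {..<n})"
proof
  show "quotient_map (top_of_set (decomposables n)) (Gr2 n) plane_of" by (rule quotient_map_plane_of)
  show "x i = 0" if "x \<in> decomposables n" "i \<notin> {..<n} \<times> {..<n}" for x i
    using that by (cases i) (auto simp: decomposables_def vecs_def)
qed (auto simp: decomposables_scaleR plane_of_eq_iff, simp add: decomposables_def)

lemma span_single_eq_iff:
  fixes x y :: "'a::real_vector"
  assumes "y \<noteq> 0"
  shows "span {x} = span {y} \<longleftrightarrow> (\<exists>c. c \<noteq> 0 \<and> y = c *\<^sub>R x)"
proof
  assume "span {x} = span {y}"
  then have "y \<in> span {x}" by (simp add: span_base)
  then show "\<exists>c. c \<noteq> 0 \<and> y = c *\<^sub>R x" using assms by (auto simp: span_singleton)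
next
  assume "\<exists>c. c \<noteq> 0 \<and> y = c *\<^sub>R x"
  then obtain c where c: "c \<noteq> 0" "y = c *\<^sub>R x" by blast
  then have "x = (1 / c) *\<^sub>R y" by simp
  then have "x \<in> span {y}" "y \<in> span {x}" using c by (metis span_base span_scale singletonI)+
  then show "span {x} = span {y}" by (simp add: span_eq)
qed

lemma projective_cone_RP:
  "projective_cone (vecs (k + 1) - {0}) (real_projective_space k) (\<lambda>u. span {u}) {..k}"
proof
  have "subtopology (Euclidean_space (k + 1)) (- {0}) = top_of_set (vecs (k + 1) - {0})"
    by (simp add: Euclidean_space_vecs subtopology_subtopology Diff_eq)
  then show "quotient_map (top_of_set (vecs (k + 1) - {0})) (real_projective_space k) (\<lambda>u. span {u})"
    unfolding real_projective_space_def using quotient_map_quotient_topology by metis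
qed (auto simp: vecs_def span_single_eq_iff fun_eq_iff)

section \<open>The octonionic form\<close>

text \<open>The \<open>k\<close>-th coordinate of the octonion product \<open>x\<close>-conjugate times \<open>y\<close>, as a linear form in the
  products \<open>B i j = x i * y j\<close> (Cayley--Dickson basis).  Each coordinate only involves indices whose
  bitwise exclusive or is \<open>k\<close>, so the complex numbers and the quaternions sit in the first two and
  four coordinates.\<close>

definition oct :: "nat \<Rightarrow> (nat \<Rightarrow> nat \<Rightarrow> real) \<Rightarrow> real" where
  "oct k B =
    (if k = 0 then B 0 0 + B 1 1 + B 2 2 + B 3 3 + B 4 4 + B 5 5 + B 6 6 + B 7 7 else
     if k = 1 then B 0 1 - B 1 0 - B 2 3 + B 3 2 - B 4 5 + B 5 4 + B 6 7 - B 7 6 else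
     if k = 2 then B 0 2 + B 1 3 - B 2 0 - B 3 1 - B 4 6 - B 5 7 + B 6 4 + B 7 5 else
     if k = 3 then B 0 3 - B 1 2 + B 2 1 - B 3 0 - B 4 7 + B 5 6 - B 6 5 + B 7 4 else
     if k = 4 then B 0 4 + B 1 5 + B 2 6 + B 3 7 - B 4 0 - B 5 1 - B 6 2 - B 7 3 else
     if k = 5 then B 0 5 - B 1 4 + B 2 7 - B 3 6 + B 4 1 - B 5 0 + B 6 3 - B 7 2 else
     if k = 6 then B 0 6 - B 1 7 - B 2 4 + B 3 5 + B 4 2 - B 5 3 - B 6 0 + B 7 1 else
     if k = 7 then B 0 7 + B 1 6 - B 2 5 - B 3 4 + B 4 3 + B 5 2 - B 6 1 - B 7 0 else
     0)"

lemma less_8_cases: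
  assumes "i < (8::nat)"
  shows "i = 0 \<or> i = 1 \<or> i = 2 \<or> i = 3 \<or> i = 4 \<or> i = 5 \<or> i = 6 \<or> i = 7"
  using assms by linarith

lemma sum_lessThan_8: "(\<Sum>i<8. f i) = f 0 + f 1 + f 2 + f 3 + f 4 + f 5 + f 6 + f (7::nat)"
  for f :: "nat \<Rightarrow> real"
  by (simp add: eval_nat_numeral)

lemma oct_scaleR: "oct k (\<lambda>i j. c * B i j) = c * oct k B"
  by (simp add: oct_def algebra_simps)

text \<open>For \<open>k \<ge> 1\<close> the terms \<open>B i j\<close> and \<open>B j i\<close>
  carry opposite signs, so transposing \<open>B\<close> negates the value. The real part,
  \<open>k = 0\<close>, is symmetric.\<close>

lemma oct_alternating:
  assumes "1 \<le> k" "k < 8"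
  shows "oct k (\<lambda>i j. x i * y j - x j * y i) = 2 * oct k (\<lambda>i j. x i * y j)"
  using less_8_cases[OF assms(2)] assms(1) by (auto simp: oct_def)

lemma oct_diff: "oct k (\<lambda>i j. A i j - B i j) = oct k A - oct k B"
  by (simp add: oct_def)

lemma continuous_on_oct:
  assumes "\<And>i j. continuous_on S (\<lambda>w. B w i j)"
  shows "continuous_on S (\<lambda>w. oct k (B w))"
proof (cases "k < 8")
  case True
  show ?thesis
    using less_8_cases[OF True]
    by (elim disjE; simp add: oct_def; intro continuous_intros assms)
qed (simp add: oct_def)

text \<open>Degen's eight-square identity, that is, multiplicativity of the octonion norm.\<close>

lemma eight_squares:
  fixes x0 x1 x2 x3 x4 x5 x6 x7 y0 y1 y2 y3 y4 y5 y6 y7 :: real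
  shows "(x0 * y0 + x1 * y1 + x2 * y2 + x3 * y3 + x4 * y4 + x5 * y5 + x6 * y6 + x7 * y7)\<^sup>2 +
     (x0 * y1 - x1 * y0 - x2 * y3 + x3 * y2 - x4 * y5 + x5 * y4 + x6 * y7 - x7 * y6)\<^sup>2 +
     (x0 * y2 + x1 * y3 - x2 * y0 - x3 * y1 - x4 * y6 - x5 * y7 + x6 * y4 + x7 * y5)\<^sup>2 +
     (x0 * y3 - x1 * y2 + x2 * y1 - x3 * y0 - x4 * y7 + x5 * y6 - x6 * y5 + x7 * y4)\<^sup>2 +
     (x0 * y4 + x1 * y5 + x2 * y6 + x3 * y7 - x4 * y0 - x5 * y1 - x6 * y2 - x7 * y3)\<^sup>2 +
     (x0 * y5 - x1 * y4 + x2 * y7 - x3 * y6 + x4 * y1 - x5 * y0 + x6 * y3 - x7 * y2)\<^sup>2 +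
     (x0 * y6 - x1 * y7 - x2 * y4 + x3 * y5 + x4 * y2 - x5 * y3 - x6 * y0 + x7 * y1)\<^sup>2 +
     (x0 * y7 + x1 * y6 - x2 * y5 - x3 * y4 + x4 * y3 + x5 * y2 - x6 * y1 - x7 * y0)\<^sup>2 =
    (x0\<^sup>2 + x1\<^sup>2 + x2\<^sup>2 + x3\<^sup>2 + x4\<^sup>2 + x5\<^sup>2 + x6\<^sup>2 + x7\<^sup>2) * (y0\<^sup>2 + y1\<^sup>2 + y2\<^sup>2 + y3\<^sup>2 + y4\<^sup>2 + y5\<^sup>2 + y6\<^sup>2 + y7\<^sup>2)"
  by (simp add: power2_eq_square algebra_simps)

lemma oct_norm:
  "(\<Sum>k<8. (oct k (\<lambda>i j. x i * y j))\<^sup>2) = (\<Sum>i<8. (x i)\<^sup>2) * (\<Sum>i<8. (y i)\<^sup>2)"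
  unfolding sum_lessThan_8 eight_squares[symmetric] by (simp add: oct_def)

lemma sum_squares_eq_0:
  fixes f :: "nat \<Rightarrow> real"
  shows "(\<Sum>i<n. (f i)\<^sup>2) = 0 \<longleftrightarrow> (\<forall>i<n. f i = 0)"
  by (auto simp: sum_nonneg_eq_0_iff)

lemma oct_no_zero_divisors:
  assumes "\<And>k. k < 8 \<Longrightarrow> oct k (\<lambda>i j. x i * y j) = 0"
  shows "(\<forall>i<8. x i = 0) \<or> (\<forall>i<8. y i = 0)"
proof -
  have "(\<Sum>k<8. (oct k (\<lambda>i j. x i * y j))\<^sup>2) = 0" using assms by simp
  then show ?thesis unfolding oct_norm by (simp add: sum_squares_eq_0)
qed

text \<open>By the norm identity the imaginary part measures the defect in the Cauchy--Schwarz inequality.\<close>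

lemma oct_imaginary_eq_0:
  assumes im: "\<And>k. 1 \<le> k \<Longrightarrow> k < 8 \<Longrightarrow> oct k (\<lambda>i j. x i * y j) = 0"
    and ij: "i < 8" "j < 8"
  shows "x i * y j = x j * y i"
proof -
  define N b where "N = (\<Sum>i<8. (x i)\<^sup>2)" and "b = (\<Sum>i<8. x i * y i)"
  have "(\<Sum>k<8. (oct k (\<lambda>i j. x i * y j))\<^sup>2) = (\<Sum>k\<in>{0::nat}. (oct k (\<lambda>i j. x i * y j))\<^sup>2)"
    using im by (intro sum.mono_neutral_right) auto
  moreover have "oct 0 (\<lambda>i j. x i * y j) = b" by (simp add: oct_def b_def sum_lessThan_8)
  ultimately have eq: "N * (\<Sum>i<8. (y i)\<^sup>2) = b\<^sup>2" unfolding oct_norm N_def by simp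
  \<comment> \<open>Equality in Cauchy--Schwarz makes the squared length of \<open>N y - b x\<close>
    vanish, so \<open>y\<close> is a multiple of \<open>x\<close> unless \<open>N = 0\<close>, when
    \<open>x\<close> vanishes.\<close>
  have "(\<Sum>i<8. (N * y i - b * x i)\<^sup>2) =
      N * N * (\<Sum>i<8. (y i)\<^sup>2) - 2 * N * b * (\<Sum>i<8. x i * y i) + b * b * (\<Sum>i<8. (x i)\<^sup>2)"
    unfolding sum_lessThan_8 by (simp add: power2_eq_square algebra_simps)
  also have "\<dots> = N * (N * (\<Sum>i<8. (y i)\<^sup>2) - b\<^sup>2)"
    unfolding N_def[symmetric] b_def[symmetric] by (simp add: power2_eq_square algebra_simps)
  also have "\<dots> = 0" by (simp add: eq)
  finally have par: "N * y l = b * x l" if "l < 8" for l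
    using that by (simp add: sum_squares_eq_0)
  show ?thesis
  proof (cases "N = 0")
    case True
    then show ?thesis using ij by (simp add: N_def sum_squares_eq_0)
  next
    case False
    have "N * (x i * y j) = x i * (N * y j)" by simp
    also have "\<dots> = x j * (N * y i)" by (simp only: par[OF ij(1)] par[OF ij(2)] mult_ac)
    finally have "N * (x i * y j) = N * (x j * y i)" by simp
    then show ?thesis using False by simp
  qed
qed

text \<open>For \<open>u = (a, b)\<close> and \<open>v = (c, d)\<close> in two copies of the octonions and \<open>w = wedge u v\<close>, the three blocks
  are, up to factors two, the imaginary part of \<open>a\<close>-conjugate times \<open>c\<close>, the difference of
  \<open>d\<close>-conjugate times \<open>a\<close> and \<open>b\<close>-conjugate times \<open>c\<close>, and the imaginary part of \<open>b\<close>-conjugate times \<open>d\<close>.\<close>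

definition octonionic_form :: "(nat \<times> nat \<Rightarrow> real) \<Rightarrow> nat \<Rightarrow> real" where
  "octonionic_form w k =
     (if k < 7 then oct (k + 1) (\<lambda>i j. w (i, j))
      else if k < 15 then oct (k - 7) (\<lambda>i j. w (j, 8 + i))
      else if k < 22 then oct (k - 14) (\<lambda>i j. w (8 + i, 8 + j)) else 0)"

lemma octonionic_form_scaleR: "octonionic_form (c *\<^sub>R w) = c *\<^sub>R octonionic_form w"
  by (auto simp: octonionic_form_def oct_scaleR fun_eq_iff)

lemma continuous_on_octonionic_form: "continuous_on S octonionic_form"
proof (rule continuous_on_coordinatewise_then_product)
  fix k :: nat
  have c: "continuous_on S (\<lambda>w. w (i, j))" for i j :: nat
    by (rule continuous_on_product_then_coordinatewise[OF continuous_on_id])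
  consider "k < 7" | "\<not> k < 7" "k < 15" | "\<not> k < 7" "\<not> k < 15" "k < 22" | "\<not> k < 22" by linarith
  then show "continuous_on S (\<lambda>w. octonionic_form w k)"
    by cases (simp_all add: octonionic_form_def, (intro continuous_on_oct c)+)
qed

lemma octonionic_form_eq_0D:
  assumes 0: "octonionic_form (wedge u v) = 0"
  shows "\<And>k. 1 \<le> k \<Longrightarrow> k < 8 \<Longrightarrow> oct k (\<lambda>i j. u i * v j) = 0"
    "\<And>k. k < 8 \<Longrightarrow> oct k (\<lambda>i j. v (8 + i) * u j) = oct k (\<lambda>i j. u (8 + i) * v j)"
    "\<And>k. 1 \<le> k \<Longrightarrow> k < 8 \<Longrightarrow> oct k (\<lambda>i j. u (8 + i) * v (8 + j)) = 0"
proof -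
  fix k :: nat assume k: "1 \<le> k" "k < 8"
  \<comment> \<open>Blocks without real part start at index 1: imaginary index \<open>k\<close> sits
    at position \<open>k - 1\<close> in the first block and \<open>k + 14\<close> in the last. The
    middle block keeps its real part, so index \<open>k\<close> sits at
    \<open>k + 7\<close>.\<close>
  obtain m where m: "k = m + 1" "m < 7" using k by (cases k) auto
  have "octonionic_form (wedge u v) m = 2 * oct k (\<lambda>i j. u i * v j)"
    using m oct_alternating[OF k, of u v] by (simp add: octonionic_form_def)
  then show "oct k (\<lambda>i j. u i * v j) = 0" using 0 by simp
  have "octonionic_form (wedge u v) (k + 14) = 2 * oct k (\<lambda>i j. u (8 + i) * v (8 + j))"
    using k oct_alternating[OF k, of "\<lambda>i. u (8 + i)" "\<lambda>i. v (8 + i)"] by (simp add: octonionic_form_def)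
  then show "oct k (\<lambda>i j. u (8 + i) * v (8 + j)) = 0" using 0 by simp
next
  fix k :: nat assume k: "k < 8"
  have "octonionic_form (wedge u v) (k + 7) = oct k (\<lambda>i j. u j * v (8 + i) - u (8 + i) * v j)"
    using k by (simp add: octonionic_form_def)
  also have "\<dots> = oct k (\<lambda>i j. v (8 + i) * u j) - oct k (\<lambda>i j. u (8 + i) * v j)"
    by (simp add: oct_diff mult.commute)
  finally show "oct k (\<lambda>i j. v (8 + i) * u j) = oct k (\<lambda>i j. u (8 + i) * v j)" using 0 by simp
qed

text \<open>If the second halves are parallel, a change of basis of the plane makes one of them vanish;
  then the middle block kills the other one.\<close>

lemma octonionic_form_nonzero:
  assumes w: "w \<in> decomposables 16"
  shows "octonionic_form w \<noteq> 0"
proof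
  assume F0: "octonionic_form w = 0"
  obtain u v where uv: "u \<in> vecs 16" "v \<in> vecs 16" "w = wedge u v" "w \<noteq> 0"
    using w by (auto simp: decomposables_def)
  note D = octonionic_form_eq_0D[OF F0[unfolded uv(3)]]
  have par: "u (8 + i) * v (8 + j) = u (8 + j) * v (8 + i)" if "i < 8" "j < 8" for i j
    using oct_imaginary_eq_0[of "\<lambda>i. u (8 + i)" "\<lambda>i. v (8 + i)", OF D(3) that] by simp
  have "\<exists>\<alpha> \<beta>. (\<alpha> \<noteq> 0 \<or> \<beta> \<noteq> 0) \<and> (\<forall>j<8. \<alpha> * u (8 + j) + \<beta> * v (8 + j) = 0)"
  proof (cases "\<forall>i<8. u (8 + i) = 0")
    case True
    then show ?thesis by (intro exI[of _ 1] exI[of _ 0]) simp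
  next
    case False
    then obtain i where i: "i < 8" "u (8 + i) \<noteq> 0" by blast
    then show ?thesis
      using par by (intro exI[of _ "v (8 + i)"] exI[of _ "- u (8 + i)"]) (simp add: mult.commute)
  qed
  then obtain \<alpha> \<beta> where ab: "\<alpha> \<noteq> 0 \<or> \<beta> \<noteq> 0" "\<And>j. j < 8 \<Longrightarrow> \<alpha> * u (8 + j) + \<beta> * v (8 + j) = 0" by blast
  \<comment> \<open>The coefficient vectors of \<open>x\<close> and \<open>y\<close> are orthogonal,
    so the change of basis has determinant \<alpha>^2 + \<beta>^2, and \<open>y\<close> has
    vanishing second half.\<close>
  define x y where "x = \<beta> *\<^sub>R u + (- \<alpha>) *\<^sub>R v" and "y = \<alpha> *\<^sub>R u + \<beta> *\<^sub>R v"
  have xy: "x \<in> vecs 16" "y \<in> vecs 16" unfolding x_def y_def by (intro vecs_intros uv)+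
  have "wedge x y = (\<beta> * \<beta> - - \<alpha> * \<alpha>) *\<^sub>R w" unfolding x_def y_def wedge_lincomb uv(3) ..
  then have wxy: "wedge x y = (\<alpha>\<^sup>2 + \<beta>\<^sup>2) *\<^sub>R w" by (simp add: power2_eq_square)
  have "\<alpha>\<^sup>2 + \<beta>\<^sup>2 \<noteq> 0" using ab(1) by (simp add: sum_power2_eq_zero_iff)
  then have nz: "wedge x y \<noteq> 0" using wxy uv(4) by simp
  have "octonionic_form (wedge x y) = 0" unfolding wxy octonionic_form_scaleR F0 by simp
  note E = octonionic_form_eq_0D[OF this]
  have y8: "y (8 + j) = 0" if "j < 8" for j using ab(2)[OF that] by (simp add: y_def)
  have y0: "y l = 0" if "l \<ge> 8" for l
    using that y8[of "l - 8"] xy(2) by (cases "l < 16") (auto simp: vecs_def)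
  have "oct k (\<lambda>i j. y (8 + i) * x j) = 0" for k using y0 by (simp add: oct_def)
  then have "oct k (\<lambda>i j. x (8 + i) * y j) = 0" if "k < 8" for k using E(2)[OF that] by simp
  then have "(\<forall>i<8. x (8 + i) = 0) \<or> (\<forall>i<8. y i = 0)" by (rule oct_no_zero_divisors)
  moreover have "\<not> (\<forall>i<8. y i = 0)"
  proof
    assume "\<forall>i<8. y i = 0"
    then have "y l = 0" for l using y0[of l] by (cases "l < 8") auto
    then have "y = 0" by (auto simp: fun_eq_iff)
    then show False using nz by simp
  qed
  ultimately have x8: "\<forall>i<8. x (8 + i) = 0" by blast
  have x0: "x l = 0" if "l \<ge> 8" for l
    using that x8[rule_format, of "l - 8"] xy(1) by (cases "l < 16") (auto simp: vecs_def)
  \<comment> \<open>Both vectors now live in one copy of the octonions, where the first block forces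
    them to be parallel.\<close>
  have "wedge x y (i, j) = 0" for i j
  proof (cases "i < 8 \<and> j < 8")
    case True
    then show ?thesis using oct_imaginary_eq_0[OF E(1), of i j] by simp
  next
    case False
    then show ?thesis using x0 y0 by (auto simp: not_less)
  qed
  then have "wedge x y = 0" by (auto simp: fun_eq_iff)
  then show False using nz by simp
qed

section \<open>Target dimensions and induced maps\<close>

lemma decomposables_mono: "m \<le> n \<Longrightarrow> decomposables m \<subseteq> decomposables n"
  unfolding decomposables_def vecs_def by (auto 4 4)

text \<open>If the second half has \<open>d\<close> coordinates with \<open>d\<close> = 1, 2, 4 or
  8, the last block is the imaginary part of an algebra of dimension \<open>d\<close>, leaving 7 + 8
  + (d - 1) coordinates: 15, 16, 18 and 22. For \<open>n\<close> = 8 only the first block with 7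
  survives, and for \<open>n\<close> = 4 only its quaternionic part with 3. The projective dimension
  is one less.\<close>

lemma octonionic_form_in_vecs:
  assumes w: "w \<in> decomposables n"
    and nk: "(n, k) \<in> {(4, 2), (8, 6), (9, 14), (10, 15), (12, 17), (16, 21)}"
  shows "octonionic_form w \<in> vecs (k + 1)"
proof -
  have z: "w (i, j) = 0" if "i \<ge> n \<or> j \<ge> n" for i j
    using w that by (auto simp: decomposables_def vecs_def)
  have "octonionic_form w l = 0" if "l \<ge> k + 1" for l
  proof -
    consider "l < 7" | "\<not> l < 7" "l < 15" | "\<not> l < 7" "\<not> l < 15" "l < 22" | "\<not> l < 22" by linarith
    then show ?thesis
    proof cases
      case 1
      then have "l + 1 < 8" by simp
      from less_8_cases[OF this] have "oct (l + 1) (\<lambda>i j. w (i, j)) = 0"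
        using nk z that by (auto simp: oct_def)
      then show ?thesis using 1 by (simp add: octonionic_form_def)
    next
      case 2
      then have "l - 7 < 8" by simp
      from less_8_cases[OF this] have "oct (l - 7) (\<lambda>i j. w (j, 8 + i)) = 0"
        using nk z that 2 by (auto simp: oct_def)
      then show ?thesis using 2 by (simp add: octonionic_form_def)
    next
      case 3
      then have "l - 14 < 8" by simp
      from less_8_cases[OF this] have "oct (l - 14) (\<lambda>i j. w (8 + i, 8 + j)) = 0"
        using nk z that 3 by (auto simp: oct_def)
      then show ?thesis using 3 by (simp add: octonionic_form_def)
    qed (simp add: octonionic_form_def)
  qed
  then show ?thesis by (simp add: vecs_def)
qed

lemma induces_pi1_isomorphism_octonionic:
  assumes nk: "(n, k) \<in> {(4, 2), (8, 6), (9, 14), (10, 15), (12, 17), (16, 21)}"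
  shows "\<exists>f. induces_pi1_isomorphism (Gr2 n) (real_projective_space k) f"
proof -
  have n: "4 \<le> n" "n \<le> 16" "2 \<le> k" using nk by auto
  \<comment> \<open>The representative is unique up to a nonzero factor, and homogeneity of the form
    makes the line independent of it.\<close>
  define f where "f L = span {octonionic_form (SOME w. w \<in> decomposables n \<and> plane_of w = L)}" for L
  have F: "octonionic_form w \<in> vecs (k + 1) - {0}" if "w \<in> decomposables n" for w
    using octonionic_form_in_vecs[OF that nk] octonionic_form_nonzero decomposables_mono[OF n(2)] that by blast
  have "induces_pi1_isomorphism (Gr2 n) (real_projective_space k) f"
  proof (rule induces_pi1_isomorphism_cones[OF projective_cone_Gr2 projective_cone_RP])
    show "homotopically_trivial (decomposables n)" by (rule homotopically_trivial_decomposables[OF n(1)])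
    show "homotopically_trivial (vecs (k + 1) - {0})"
    proof (rule homotopically_trivial_punctured_subspace[OF subspace_vecs vecs_not_subset_span])
      \<comment> \<open>Uses \<open>k \<ge> 2\<close>: the cone over the projective line is a
        punctured plane, which is not simply connected.\<close>
      show "card {x, y} < k + 1" for x y :: "nat \<Rightarrow> real" using n(3) by (simp add: card_insert_if)
    qed simp
    show "continuous_on (decomposables n) octonionic_form" by (rule continuous_on_octonionic_form)
    fix w assume w: "w \<in> decomposables n"
    show "\<exists>g. path g \<and> path_image g \<subseteq> decomposables n \<and> pathstart g = w \<and> pathfinish g = - w"
      using decomposables_flip[OF _ w] n by simp
    show "octonionic_form w \<in> vecs (k + 1) - {0}" by (rule F[OF w])
    show "octonionic_form (c *\<^sub>R w) = c *\<^sub>R octonionic_form w" for c by (rule octonionic_form_scaleR)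
    define w' where "w' = (SOME w'. w' \<in> decomposables n \<and> plane_of w' = plane_of w)"
    have "w' \<in> decomposables n \<and> plane_of w' = plane_of w"
      unfolding w'_def by (rule someI[of _ w]) (use w in simp)
    then obtain c where "c \<noteq> 0" "w = c *\<^sub>R w'" using plane_of_eq_iff[of w' n w] w by auto
    then have "span {octonionic_form w'} = span {octonionic_form w}"
      using F[OF w] by (subst span_single_eq_iff) (auto simp: octonionic_form_scaleR)
    then show "f (plane_of w) = span {octonionic_form w}" by (simp add: f_def w'_def)
  qed
  then show ?thesis by blast
qed

text \<open>On bivectors the inclusion is the identity, which is trivially homogeneous. The source
  may be the exceptional dimension three.\<close>

lemma induces_pi1_isomorphism_Gr2_inclusion:
  assumes "3 \<le> m" "m \<le> n" "4 \<le> n"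
  shows "induces_pi1_isomorphism (Gr2 m) (Gr2 n) Gr2_inclusion"
proof (rule induces_pi1_isomorphism_cones[OF projective_cone_Gr2 projective_cone_Gr2])
  show "homotopically_trivial (decomposables m)"
    using homotopically_trivial_decomposables_3 homotopically_trivial_decomposables[of m] assms
    by (cases "m = 3") auto
  show "homotopically_trivial (decomposables n)" by (rule homotopically_trivial_decomposables[OF assms(3)])
  show "continuous_on (decomposables m) id" by (rule continuous_on_id')
  show "\<exists>g. path g \<and> path_image g \<subseteq> decomposables m \<and> pathstart g = w \<and> pathfinish g = - w"
    if "w \<in> decomposables m" for w by (rule decomposables_flip[OF assms(1) that])
  show "id w \<in> decomposables n" if "w \<in> decomposables m" for w
    using decomposables_mono[OF assms(2)] that by auto
qed (simp_all add: Gr2_inclusion_def)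

theorem theorem1p2:
  shows "((\<exists>f. induces_pi1_isomorphism (Gr2 4) (real_projective_space 2) f) \<and>
          (\<exists>f. induces_pi1_isomorphism (Gr2 8) (real_projective_space 6) f) \<and>
          (\<exists>f. induces_pi1_isomorphism (Gr2 9) (real_projective_space 14) f) \<and>
          (\<exists>f. induces_pi1_isomorphism (Gr2 10) (real_projective_space 15) f) \<and>
          (\<exists>f. induces_pi1_isomorphism (Gr2 12) (real_projective_space 17) f) \<and>
          (\<exists>f. induces_pi1_isomorphism (Gr2 16) (real_projective_space 21) f)) \<and>
         (\<forall>n k f. n - 1 > 2 \<longrightarrow> induces_pi1_isomorphism (Gr2 n) (real_projective_space k) f \<longrightarrow>
            induces_pi1_isomorphism (Gr2 (n - 1)) (real_projective_space k) (f \<circ> Gr2_inclusion))"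
proof (intro conjI allI impI)
  fix n k f
  assume n: "n - 1 > 2" and f: "induces_pi1_isomorphism (Gr2 n) (real_projective_space k) f"
  \<comment> \<open>The inclusion is itself an isomorphism on \<pi>_1, so \<open>f\<close> may be
    arbitrary and need not come from the octonionic form.\<close>
  have "induces_pi1_isomorphism (Gr2 (n - 1)) (Gr2 n) Gr2_inclusion"
    by (rule induces_pi1_isomorphism_Gr2_inclusion) (use n in auto)
  then show "induces_pi1_isomorphism (Gr2 (n - 1)) (real_projective_space k) (f \<circ> Gr2_inclusion)"
    using f by (rule induces_pi1_isomorphism_compose)
qed (rule induces_pi1_isomorphism_octonionic; simp)+

end
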